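(* Let $\mathcal C$, $\mathcal C'$, $\mathcal C''$ be fusion categories over a field $\Bbbk$ and let $i:\mathcal C'\to\mathcal C$, $F:\mathcal C\to\mathcal C''$ be tensor functors. Assume that $F$ is dominant, $i$ is full and $i(\mathcal C')\subset\mathfrak{Ker}_F$. Then $\operatorname{FPdim}\mathcal C\ge\operatorname{FPdim}\mathcal C'\,\operatorname{FPdim}\mathcal C''$. Moreover the diagram $$\mathcal C'\xrightarrow{\ i\ }\mathcal C\xrightarrow{\ F\ }\mathcal C''$$ is an exact sequence if and only if $\operatorname{FPdim}\mathcal C=\operatorname{FPdim}\mathcal C'\,\operatorname{FPdim}\mathcal C''$. If such is the case, then for every simple object $Y$ of $\mathcal C''$, $$\operatorname{FPdim}Y=\frac1{\operatorname{FPdim}\mathcal C'}\sum_{X\in\Lambda_{\mathcal C}}m_Y(F(X))\,\operatorname{FPdim}X.$$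
   Context: A tensor category over $\Bbbk$ is a $\Bbbk$-linear abelian rigid monoidal category with finite-dimensional Hom spaces, all objects of finite length, monoidal product $\Bbbk$-linear in each variable, and $\operatorname{End}(\mathbf 1)=\Bbbk$. A fusion category is a split semisimple tensor category with finitely many isomorphism classes of simple objects. A tensor functor is a $\Bbbk$-linear exact strong monoidal functor. An object is trivial if isomorphic to $\mathbf 1^n$ for some $n$. For a tensor functor $F:\mathcal C\to\mathcal D$: $\mathfrak{Ker}_F\subset\mathcal C$ is the full subcategory of objects $X$ with $F(X)$ trivial; $F$ is dominant if every object of $\mathcal D$ is a subobject of $F(X)$ for some $X$; $F$ is normal if every $X$ in $\mathcal C$ has a subobject $X_0$ such that $F(X_0)$ is the largest trivial subobject of $F(X)$. A sequence of tensor functors $\mathcal C'\xrightarrow{f}\mathcal C\xrightarrow{F}\mathcal C''$ is exact if $F$ is dominant and normal, $f$ is a full embedding and the essential image of $f$ is $\mathfrak{Ker}_F$. $\Lambda_{\mathcal C}$ is the set of isomorphism classes of simple objects of $\mathcal C$; $m_Y(Z)=\dim\operatorname{Hom}(Y,Z)$ is the multiplicity of the simple object $Y$ in $Z$. For $X\in\Lambda_{\mathcal C}$, $\operatorname{FPdim}X$ is the largest positive eigenvalue of left multiplication by $[X]$ in the Grothendieck ring of $\mathcal C$ with respect to the basis $\Lambda_{\mathcal C}$; $\operatorname{FPdim}\mathcal C=\sum_{X\in\Lambda_{\mathcal C}}(\operatorname{FPdim}X)^2$. *)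

theory Defs
  imports Complex_Main "HOL-Algebra.Module"
begin

section \<open>Linear algebra over a field\<close>

definition is_basis :: "'k ring \<Rightarrow> ('k, 'v) module \<Rightarrow> 'v set \<Rightarrow> bool" where
  "is_basis K V B \<longleftrightarrow> finite B \<and> B \<subseteq> carrier V \<and>
     (\<forall>v \<in> carrier V. \<exists>!c. c \<in> B \<rightarrow>\<^sub>E carrier K \<and> v = (\<Oplus>\<^bsub>V\<^esub>b\<in>B. c b \<odot>\<^bsub>V\<^esub> b))"

definition finite_dim :: "'k ring \<Rightarrow> ('k, 'v) module \<Rightarrow> bool" where
  "finite_dim K V \<longleftrightarrow> (\<exists>B. is_basis K V B)"

definition vdim :: "'k ring \<Rightarrow> ('k, 'v) module \<Rightarrow> nat" where
  "vdim K V = card (SOME B. is_basis K V B)"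


section \<open>Categories\<close>

record ('o, 'm) cat =
  Obj :: "'o set"
  Arr :: "'m set"
  Src :: "'m \<Rightarrow> 'o"
  Trg :: "'m \<Rightarrow> 'o"
  Ident :: "'o \<Rightarrow> 'm"
  Comp :: "'m \<Rightarrow> 'm \<Rightarrow> 'm" (infixr \<open>\<cdot>\<index>\<close> 65)

definition Hom :: "('o, 'm, 'z) cat_scheme \<Rightarrow> 'o \<Rightarrow> 'o \<Rightarrow> 'm set" where
  "Hom C X Y = {f \<in> Arr C. Src C f = X \<and> Trg C f = Y}"

locale category =
  fixes C :: "('o, 'm, 'z) cat_scheme" (structure)
  assumes src_closed: "f \<in> Arr C \<Longrightarrow> Src C f \<in> Obj C"
    and trg_closed: "f \<in> Arr C \<Longrightarrow> Trg C f \<in> Obj C"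
    and ident_hom: "X \<in> Obj C \<Longrightarrow> Ident C X \<in> Hom C X X"
    and comp_hom: "\<lbrakk>f \<in> Hom C X Y; g \<in> Hom C Y Z\<rbrakk> \<Longrightarrow> g \<cdot> f \<in> Hom C X Z"
    and comp_ident_right: "f \<in> Hom C X Y \<Longrightarrow> f \<cdot> Ident C X = f"
    and comp_ident_left: "f \<in> Hom C X Y \<Longrightarrow> Ident C Y \<cdot> f = f"
    and comp_assoc: "\<lbrakk>f \<in> Hom C W X; g \<in> Hom C X Y; h \<in> Hom C Y Z\<rbrakk>
                       \<Longrightarrow> (h \<cdot> g) \<cdot> f = h \<cdot> (g \<cdot> f)"

definition mono_arr :: "('o, 'm, 'z) cat_scheme \<Rightarrow> 'm \<Rightarrow> bool" where
  "mono_arr C f \<longleftrightarrow> f \<in> Arr C \<and>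
     (\<forall>W. \<forall>g \<in> Hom C W (Src C f). \<forall>h \<in> Hom C W (Src C f).
        f \<cdot>\<^bsub>C\<^esub> g = f \<cdot>\<^bsub>C\<^esub> h \<longrightarrow> g = h)"

definition epi_arr :: "('o, 'm, 'z) cat_scheme \<Rightarrow> 'm \<Rightarrow> bool" where
  "epi_arr C f \<longleftrightarrow> f \<in> Arr C \<and>
     (\<forall>W. \<forall>g \<in> Hom C (Trg C f) W. \<forall>h \<in> Hom C (Trg C f) W.
        g \<cdot>\<^bsub>C\<^esub> f = h \<cdot>\<^bsub>C\<^esub> f \<longrightarrow> g = h)"

definition inverse_arrs :: "('o, 'm, 'z) cat_scheme \<Rightarrow> 'm \<Rightarrow> 'm \<Rightarrow> bool" where
  "inverse_arrs C f g \<longleftrightarrow> f \<in> Arr C \<and> g \<in> Hom C (Trg C f) (Src C f) \<and>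
     g \<cdot>\<^bsub>C\<^esub> f = Ident C (Src C f) \<and> f \<cdot>\<^bsub>C\<^esub> g = Ident C (Trg C f)"

definition iso_arr :: "('o, 'm, 'z) cat_scheme \<Rightarrow> 'm \<Rightarrow> bool" where
  "iso_arr C f \<longleftrightarrow> (\<exists>g. inverse_arrs C f g)"

definition inv_arr :: "('o, 'm, 'z) cat_scheme \<Rightarrow> 'm \<Rightarrow> 'm" where
  "inv_arr C f = (THE g. inverse_arrs C f g)"

definition isomorphic :: "('o, 'm, 'z) cat_scheme \<Rightarrow> 'o \<Rightarrow> 'o \<Rightarrow> bool" where
  "isomorphic C X Y \<longleftrightarrow> (\<exists>f \<in> Hom C X Y. iso_arr C f)"

definition iso_class :: "('o, 'm, 'z) cat_scheme \<Rightarrow> 'o \<Rightarrow> 'o set" where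
  "iso_class C X = {Y \<in> Obj C. isomorphic C X Y}"

definition rep_obj :: "'o set \<Rightarrow> 'o" where
  "rep_obj S = (SOME X. X \<in> S)"

definition zero_object :: "('o, 'm, 'z) cat_scheme \<Rightarrow> 'o \<Rightarrow> bool" where
  "zero_object C X \<longleftrightarrow> X \<in> Obj C \<and>
     (\<forall>Y \<in> Obj C. (\<exists>!f. f \<in> Hom C X Y) \<and> (\<exists>!f. f \<in> Hom C Y X))"

definition simple_object :: "('o, 'm, 'z) cat_scheme \<Rightarrow> 'o \<Rightarrow> bool" where
  "simple_object C X \<longleftrightarrow> X \<in> Obj C \<and> \<not> zero_object C X \<and>
     (\<forall>Y. \<forall>u \<in> Hom C Y X. mono_arr C u \<longrightarrow> zero_object C Y \<or> iso_arr C u)"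

definition simple_classes :: "('o, 'm, 'z) cat_scheme \<Rightarrow> 'o set set" where
  "simple_classes C = iso_class C ` {X. simple_object C X}"


section \<open>Linear and abelian categories\<close>

record ('o, 'm, 'k) lincat = "('o, 'm) cat" +
  ZeroArr :: "'o \<Rightarrow> 'o \<Rightarrow> 'm"
  PlusArr :: "'m \<Rightarrow> 'm \<Rightarrow> 'm"
  Scale :: "'k \<Rightarrow> 'm \<Rightarrow> 'm"

text \<open>A \<open>module\<close> record also has the operations of a ring; for hom-spaces they carry no
  information and no notion below refers to them.\<close>

definition hom_space :: "('o, 'm, 'k, 'z) lincat_scheme \<Rightarrow> 'o \<Rightarrow> 'o \<Rightarrow> ('k, 'm) module" where
  "hom_space C X Y = \<lparr>carrier = Hom C X Y, mult = undefined, one = undefined,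
     zero = ZeroArr C X Y, add = PlusArr C, smult = Scale C\<rparr>"

locale linear_category = field K + category C
  for K :: "'k ring" and C :: "('o, 'm, 'k, 'z) lincat_scheme" (structure) +
  assumes hom_module: "\<lbrakk>X \<in> Obj C; Y \<in> Obj C\<rbrakk> \<Longrightarrow> Module.module K (hom_space C X Y)"
    and comp_plus_left: "\<lbrakk>f \<in> Hom C X Y; g \<in> Hom C Y Z; h \<in> Hom C Y Z\<rbrakk>
          \<Longrightarrow> PlusArr C g h \<cdot> f = PlusArr C (g \<cdot> f) (h \<cdot> f)"
    and comp_plus_right: "\<lbrakk>f \<in> Hom C X Y; g \<in> Hom C X Y; h \<in> Hom C Y Z\<rbrakk>
          \<Longrightarrow> h \<cdot> PlusArr C f g = PlusArr C (h \<cdot> f) (h \<cdot> g)"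
    and comp_scale_left: "\<lbrakk>a \<in> carrier K; f \<in> Hom C X Y; g \<in> Hom C Y Z\<rbrakk>
          \<Longrightarrow> Scale C a g \<cdot> f = Scale C a (g \<cdot> f)"
    and comp_scale_right: "\<lbrakk>a \<in> carrier K; f \<in> Hom C X Y; g \<in> Hom C Y Z\<rbrakk>
          \<Longrightarrow> g \<cdot> Scale C a f = Scale C a (g \<cdot> f)"

text \<open>\<open>B\<close> is the direct sum of the objects in the list \<open>Xs\<close>, with injections \<open>inc\<close> and
  projections \<open>prj\<close>; for \<open>Xs = []\<close> the last clause says that \<open>B\<close> is a zero object.\<close>

definition is_biproduct ::
  "('o, 'm, 'k, 'z) lincat_scheme \<Rightarrow> 'o list \<Rightarrow> 'o \<Rightarrow> (nat \<Rightarrow> 'm) \<Rightarrow> (nat \<Rightarrow> 'm) \<Rightarrow> bool" where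
  "is_biproduct C Xs B inc prj \<longleftrightarrow> set Xs \<subseteq> Obj C \<and> B \<in> Obj C \<and>
     (\<forall>i < length Xs. inc i \<in> Hom C (Xs ! i) B \<and> prj i \<in> Hom C B (Xs ! i)) \<and>
     (\<forall>i < length Xs. \<forall>j < length Xs. prj j \<cdot>\<^bsub>C\<^esub> inc i =
        (if i = j then Ident C (Xs ! i) else ZeroArr C (Xs ! i) (Xs ! j))) \<and>
     (\<Oplus>\<^bsub>hom_space C B B\<^esub>i \<in> {..<length Xs}. inc i \<cdot>\<^bsub>C\<^esub> prj i) = Ident C B"

definition is_direct_sum :: "('o, 'm, 'k, 'z) lincat_scheme \<Rightarrow> 'o list \<Rightarrow> 'o \<Rightarrow> bool" where
  "is_direct_sum C Xs B \<longleftrightarrow> (\<exists>inc prj. is_biproduct C Xs B inc prj)"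

definition is_kernel :: "('o, 'm, 'k, 'z) lincat_scheme \<Rightarrow> 'm \<Rightarrow> 'm \<Rightarrow> bool" where
  "is_kernel C k f \<longleftrightarrow> f \<in> Arr C \<and> k \<in> Arr C \<and> Trg C k = Src C f \<and>
     f \<cdot>\<^bsub>C\<^esub> k = ZeroArr C (Src C k) (Trg C f) \<and>
     (\<forall>W. \<forall>h \<in> Hom C W (Src C f). f \<cdot>\<^bsub>C\<^esub> h = ZeroArr C W (Trg C f) \<longrightarrow>
        (\<exists>!u. u \<in> Hom C W (Src C k) \<and> k \<cdot>\<^bsub>C\<^esub> u = h))"

definition is_cokernel :: "('o, 'm, 'k, 'z) lincat_scheme \<Rightarrow> 'm \<Rightarrow> 'm \<Rightarrow> bool" where
  "is_cokernel C q f \<longleftrightarrow> f \<in> Arr C \<and> q \<in> Arr C \<and> Src C q = Trg C f \<and>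
     q \<cdot>\<^bsub>C\<^esub> f = ZeroArr C (Src C f) (Trg C q) \<and>
     (\<forall>W. \<forall>h \<in> Hom C (Trg C f) W. h \<cdot>\<^bsub>C\<^esub> f = ZeroArr C (Src C f) W \<longrightarrow>
        (\<exists>!u. u \<in> Hom C (Trg C q) W \<and> u \<cdot>\<^bsub>C\<^esub> q = h))"

text \<open>Exactness of \<open>0 \<rightarrow> X \<rightarrow> Y \<rightarrow> Z \<rightarrow> 0\<close> with arrows \<open>f\<close> and \<open>g\<close>.\<close>

definition short_exact :: "('o, 'm, 'k, 'z) lincat_scheme \<Rightarrow> 'm \<Rightarrow> 'm \<Rightarrow> bool" where
  "short_exact C f g \<longleftrightarrow> is_kernel C f g \<and> is_cokernel C g f"

locale abelian_category = linear_category K C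
  for K :: "'k ring" and C :: "('o, 'm, 'k, 'z) lincat_scheme" (structure) +
  assumes has_zero: "\<exists>X. zero_object C X"
    and has_biproducts: "\<lbrakk>X \<in> Obj C; Y \<in> Obj C\<rbrakk> \<Longrightarrow> \<exists>B. is_direct_sum C [X, Y] B"
    and has_kernels: "f \<in> Arr C \<Longrightarrow> \<exists>k. is_kernel C k f"
    and has_cokernels: "f \<in> Arr C \<Longrightarrow> \<exists>q. is_cokernel C q f"
    and mono_is_kernel: "mono_arr C f \<Longrightarrow> \<exists>g. is_kernel C f g"
    and epi_is_cokernel: "epi_arr C f \<Longrightarrow> \<exists>g. is_cokernel C f g"

inductive finite_length :: "('o, 'm, 'k, 'z) lincat_scheme \<Rightarrow> 'o \<Rightarrow> bool"
  for C :: "('o, 'm, 'k, 'z) lincat_scheme" where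
  zero: "zero_object C X \<Longrightarrow> finite_length C X"
| extend: "\<lbrakk>short_exact C f g; finite_length C (Src C f); simple_object C (Trg C g)\<rbrakk>
             \<Longrightarrow> finite_length C (Trg C f)"


section \<open>Monoidal and rigid categories\<close>

record ('o, 'm, 'k) moncat = "('o, 'm, 'k) lincat" +
  TensObj :: "'o \<Rightarrow> 'o \<Rightarrow> 'o" (infixr \<open>\<otimes>\<^sub>o\<index>\<close> 70)
  TensArr :: "'m \<Rightarrow> 'm \<Rightarrow> 'm" (infixr \<open>\<otimes>\<^sub>a\<index>\<close> 70)
  UnitObj :: "'o" (\<open>\<one>\<^sub>o\<index>\<close>)
  Assoc :: "'o \<Rightarrow> 'o \<Rightarrow> 'o \<Rightarrow> 'm"
  LUnit :: "'o \<Rightarrow> 'm"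
  RUnit :: "'o \<Rightarrow> 'm"

locale monoidal_category = category C
  for C :: "('o, 'm, 'k, 'z) moncat_scheme" (structure) +
  assumes tensor_obj: "\<lbrakk>X \<in> Obj C; Y \<in> Obj C\<rbrakk> \<Longrightarrow> X \<otimes>\<^sub>o Y \<in> Obj C"
    and tensor_hom: "\<lbrakk>f \<in> Hom C X X'; g \<in> Hom C Y Y'\<rbrakk>
          \<Longrightarrow> f \<otimes>\<^sub>a g \<in> Hom C (X \<otimes>\<^sub>o Y) (X' \<otimes>\<^sub>o Y')"
    and tensor_ident: "\<lbrakk>X \<in> Obj C; Y \<in> Obj C\<rbrakk>
          \<Longrightarrow> Ident C X \<otimes>\<^sub>a Ident C Y = Ident C (X \<otimes>\<^sub>o Y)"
    and tensor_comp: "\<lbrakk>f \<in> Hom C X X'; f' \<in> Hom C X' X''; g \<in> Hom C Y Y'; g' \<in> Hom C Y' Y''\<rbrakk>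
          \<Longrightarrow> (f' \<cdot> f) \<otimes>\<^sub>a (g' \<cdot> g) = (f' \<otimes>\<^sub>a g') \<cdot> (f \<otimes>\<^sub>a g)"
    and unit_obj: "\<one>\<^sub>o \<in> Obj C"
    and assoc_hom: "\<lbrakk>X \<in> Obj C; Y \<in> Obj C; Z \<in> Obj C\<rbrakk>
          \<Longrightarrow> Assoc C X Y Z \<in> Hom C ((X \<otimes>\<^sub>o Y) \<otimes>\<^sub>o Z) (X \<otimes>\<^sub>o (Y \<otimes>\<^sub>o Z))"
    and assoc_iso: "\<lbrakk>X \<in> Obj C; Y \<in> Obj C; Z \<in> Obj C\<rbrakk> \<Longrightarrow> iso_arr C (Assoc C X Y Z)"
    and assoc_natural: "\<lbrakk>f \<in> Hom C X X'; g \<in> Hom C Y Y'; h \<in> Hom C Z Z'\<rbrakk>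
          \<Longrightarrow> Assoc C X' Y' Z' \<cdot> ((f \<otimes>\<^sub>a g) \<otimes>\<^sub>a h) = (f \<otimes>\<^sub>a (g \<otimes>\<^sub>a h)) \<cdot> Assoc C X Y Z"
    and lunit_hom: "X \<in> Obj C \<Longrightarrow> LUnit C X \<in> Hom C (\<one>\<^sub>o \<otimes>\<^sub>o X) X"
    and lunit_iso: "X \<in> Obj C \<Longrightarrow> iso_arr C (LUnit C X)"
    and lunit_natural: "f \<in> Hom C X Y
          \<Longrightarrow> LUnit C Y \<cdot> (Ident C \<one>\<^sub>o \<otimes>\<^sub>a f) = f \<cdot> LUnit C X"
    and runit_hom: "X \<in> Obj C \<Longrightarrow> RUnit C X \<in> Hom C (X \<otimes>\<^sub>o \<one>\<^sub>o) X"
    and runit_iso: "X \<in> Obj C \<Longrightarrow> iso_arr C (RUnit C X)"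
    and runit_natural: "f \<in> Hom C X Y
          \<Longrightarrow> RUnit C Y \<cdot> (f \<otimes>\<^sub>a Ident C \<one>\<^sub>o) = f \<cdot> RUnit C X"
    and pentagon: "\<lbrakk>W \<in> Obj C; X \<in> Obj C; Y \<in> Obj C; Z \<in> Obj C\<rbrakk>
          \<Longrightarrow> Assoc C W X (Y \<otimes>\<^sub>o Z) \<cdot> Assoc C (W \<otimes>\<^sub>o X) Y Z =
              (Ident C W \<otimes>\<^sub>a Assoc C X Y Z) \<cdot> Assoc C W (X \<otimes>\<^sub>o Y) Z \<cdot>
              (Assoc C W X Y \<otimes>\<^sub>a Ident C Z)"
    and triangle: "\<lbrakk>X \<in> Obj C; Y \<in> Obj C\<rbrakk>
          \<Longrightarrow> (Ident C X \<otimes>\<^sub>a LUnit C Y) \<cdot> Assoc C X \<one>\<^sub>o Y = RUnit C X \<otimes>\<^sub>a Ident C Y"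

text \<open>\<open>Y\<close> is a left dual of \<open>X\<close> (equivalently, \<open>X\<close> is a right dual of \<open>Y\<close>).  The unit
  constraints in the two snake identities are kept on the outside, so that no inverse unit
  constraint is needed.\<close>

definition is_dual :: "('o, 'm, 'k, 'z) moncat_scheme \<Rightarrow> 'o \<Rightarrow> 'o \<Rightarrow> bool" where
  "is_dual C Y X \<longleftrightarrow> X \<in> Obj C \<and> Y \<in> Obj C \<and>
     (\<exists>ev \<in> Hom C (Y \<otimes>\<^sub>o\<^bsub>C\<^esub> X) \<one>\<^sub>o\<^bsub>C\<^esub>. \<exists>coev \<in> Hom C \<one>\<^sub>o\<^bsub>C\<^esub> (X \<otimes>\<^sub>o\<^bsub>C\<^esub> Y).
        RUnit C X \<cdot>\<^bsub>C\<^esub> (Ident C X \<otimes>\<^sub>a\<^bsub>C\<^esub> ev) \<cdot>\<^bsub>C\<^esub> Assoc C X Y X \<cdot>\<^bsub>C\<^esub>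
          (coev \<otimes>\<^sub>a\<^bsub>C\<^esub> Ident C X) = LUnit C X \<and>
        LUnit C Y \<cdot>\<^bsub>C\<^esub> (ev \<otimes>\<^sub>a\<^bsub>C\<^esub> Ident C Y) \<cdot>\<^bsub>C\<^esub> inv_arr C (Assoc C Y X Y) \<cdot>\<^bsub>C\<^esub>
          (Ident C Y \<otimes>\<^sub>a\<^bsub>C\<^esub> coev) = RUnit C Y)"


section \<open>Tensor categories and fusion categories\<close>

text \<open>\<open>End(X) = K\<close>: every endomorphism of \<open>X\<close> is a unique scalar multiple of the identity.\<close>

definition scalar_End :: "'k ring \<Rightarrow> ('o, 'm, 'k, 'z) lincat_scheme \<Rightarrow> 'o \<Rightarrow> bool" where
  "scalar_End K C X \<longleftrightarrow> bij_betw (\<lambda>a. Scale C a (Ident C X)) (carrier K) (Hom C X X)"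

locale tensor_category = abelian_category K C + monoidal_category C
  for K :: "'k ring" and C :: "('o, 'm, 'k, 'z) moncat_scheme" (structure) +
  assumes left_dual: "X \<in> Obj C \<Longrightarrow> \<exists>Y. is_dual C Y X"
    and right_dual: "X \<in> Obj C \<Longrightarrow> \<exists>Y. is_dual C X Y"
    and tensor_plus_left: "\<lbrakk>f \<in> Hom C X X'; g \<in> Hom C X X'; h \<in> Hom C Y Y'\<rbrakk>
          \<Longrightarrow> PlusArr C f g \<otimes>\<^sub>a h = PlusArr C (f \<otimes>\<^sub>a h) (g \<otimes>\<^sub>a h)"
    and tensor_plus_right: "\<lbrakk>f \<in> Hom C X X'; g \<in> Hom C Y Y'; h \<in> Hom C Y Y'\<rbrakk>
          \<Longrightarrow> f \<otimes>\<^sub>a PlusArr C g h = PlusArr C (f \<otimes>\<^sub>a g) (f \<otimes>\<^sub>a h)"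
    and tensor_scale_left: "\<lbrakk>a \<in> carrier K; f \<in> Hom C X X'; g \<in> Hom C Y Y'\<rbrakk>
          \<Longrightarrow> Scale C a f \<otimes>\<^sub>a g = Scale C a (f \<otimes>\<^sub>a g)"
    and tensor_scale_right: "\<lbrakk>a \<in> carrier K; f \<in> Hom C X X'; g \<in> Hom C Y Y'\<rbrakk>
          \<Longrightarrow> f \<otimes>\<^sub>a Scale C a g = Scale C a (f \<otimes>\<^sub>a g)"
    and hom_finite_dim: "\<lbrakk>X \<in> Obj C; Y \<in> Obj C\<rbrakk> \<Longrightarrow> finite_dim K (hom_space C X Y)"
    and all_finite_length: "X \<in> Obj C \<Longrightarrow> finite_length C X"
    and End_unit: "scalar_End K C \<one>\<^sub>o"

locale fusion_category = tensor_category K C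
  for K :: "'k ring" and C :: "('o, 'm, 'k, 'z) moncat_scheme" (structure) +
  assumes semisimple: "X \<in> Obj C \<Longrightarrow> \<exists>Ss. (\<forall>S \<in> set Ss. simple_object C S) \<and> is_direct_sum C Ss X"
    and split_simple: "simple_object C X \<Longrightarrow> scalar_End K C X"
    and finite_simples: "finite (simple_classes C)"

definition trivial_object :: "('o, 'm, 'k, 'z) moncat_scheme \<Rightarrow> 'o \<Rightarrow> bool" where
  "trivial_object C X \<longleftrightarrow> X \<in> Obj C \<and>
     (\<exists>n P. is_direct_sum C (replicate n \<one>\<^sub>o\<^bsub>C\<^esub>) P \<and> isomorphic C X P)"


section \<open>Tensor functors\<close>

text \<open>\<open>FTens F X Y\<close> is the structure isomorphism from \<open>F X \<otimes> F Y\<close> to \<open>F (X \<otimes> Y)\<close>, and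
  \<open>FUnit F\<close> the one from the unit of the target to the image of the unit of the source.\<close>

record ('o1, 'm1, 'o2, 'm2) monfun =
  FObj :: "'o1 \<Rightarrow> 'o2"
  FArr :: "'m1 \<Rightarrow> 'm2"
  FTens :: "'o1 \<Rightarrow> 'o1 \<Rightarrow> 'm2"
  FUnit :: "'m2"

locale tensor_functor = C: tensor_category K C + D: tensor_category K D
  for K :: "'k ring"
    and C :: "('o1, 'm1, 'k, 'z1) moncat_scheme"
    and D :: "('o2, 'm2, 'k, 'z2) moncat_scheme" +
  fixes F :: "('o1, 'm1, 'o2, 'm2) monfun"
  assumes map_obj: "X \<in> Obj C \<Longrightarrow> FObj F X \<in> Obj D"
    and map_hom: "f \<in> Hom C X Y \<Longrightarrow> FArr F f \<in> Hom D (FObj F X) (FObj F Y)"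
    and map_ident: "X \<in> Obj C \<Longrightarrow> FArr F (Ident C X) = Ident D (FObj F X)"
    and map_comp: "\<lbrakk>f \<in> Hom C X Y; g \<in> Hom C Y Z\<rbrakk>
          \<Longrightarrow> FArr F (g \<cdot>\<^bsub>C\<^esub> f) = FArr F g \<cdot>\<^bsub>D\<^esub> FArr F f"
    and map_plus: "\<lbrakk>f \<in> Hom C X Y; g \<in> Hom C X Y\<rbrakk>
          \<Longrightarrow> FArr F (PlusArr C f g) = PlusArr D (FArr F f) (FArr F g)"
    and map_scale: "\<lbrakk>a \<in> carrier K; f \<in> Hom C X Y\<rbrakk>
          \<Longrightarrow> FArr F (Scale C a f) = Scale D a (FArr F f)"
    and map_short_exact: "short_exact C f g \<Longrightarrow> short_exact D (FArr F f) (FArr F g)"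
    and tens_hom: "\<lbrakk>X \<in> Obj C; Y \<in> Obj C\<rbrakk>
          \<Longrightarrow> FTens F X Y \<in> Hom D (FObj F X \<otimes>\<^sub>o\<^bsub>D\<^esub> FObj F Y) (FObj F (X \<otimes>\<^sub>o\<^bsub>C\<^esub> Y))"
    and tens_iso: "\<lbrakk>X \<in> Obj C; Y \<in> Obj C\<rbrakk> \<Longrightarrow> iso_arr D (FTens F X Y)"
    and tens_natural: "\<lbrakk>f \<in> Hom C X X'; g \<in> Hom C Y Y'\<rbrakk>
          \<Longrightarrow> FTens F X' Y' \<cdot>\<^bsub>D\<^esub> (FArr F f \<otimes>\<^sub>a\<^bsub>D\<^esub> FArr F g) =
              FArr F (f \<otimes>\<^sub>a\<^bsub>C\<^esub> g) \<cdot>\<^bsub>D\<^esub> FTens F X Y"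
    and unit_hom: "FUnit F \<in> Hom D \<one>\<^sub>o\<^bsub>D\<^esub> (FObj F \<one>\<^sub>o\<^bsub>C\<^esub>)"
    and unit_iso: "iso_arr D (FUnit F)"
    and tens_assoc: "\<lbrakk>X \<in> Obj C; Y \<in> Obj C; Z \<in> Obj C\<rbrakk>
          \<Longrightarrow> FArr F (Assoc C X Y Z) \<cdot>\<^bsub>D\<^esub> FTens F (X \<otimes>\<^sub>o\<^bsub>C\<^esub> Y) Z \<cdot>\<^bsub>D\<^esub>
                (FTens F X Y \<otimes>\<^sub>a\<^bsub>D\<^esub> Ident D (FObj F Z)) =
              FTens F X (Y \<otimes>\<^sub>o\<^bsub>C\<^esub> Z) \<cdot>\<^bsub>D\<^esub> (Ident D (FObj F X) \<otimes>\<^sub>a\<^bsub>D\<^esub> FTens F Y Z) \<cdot>\<^bsub>D\<^esub>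
                Assoc D (FObj F X) (FObj F Y) (FObj F Z)"
    and tens_lunit: "X \<in> Obj C
          \<Longrightarrow> FArr F (LUnit C X) \<cdot>\<^bsub>D\<^esub> FTens F \<one>\<^sub>o\<^bsub>C\<^esub> X \<cdot>\<^bsub>D\<^esub>
                (FUnit F \<otimes>\<^sub>a\<^bsub>D\<^esub> Ident D (FObj F X)) = LUnit D (FObj F X)"
    and tens_runit: "X \<in> Obj C
          \<Longrightarrow> FArr F (RUnit C X) \<cdot>\<^bsub>D\<^esub> FTens F X \<one>\<^sub>o\<^bsub>C\<^esub> \<cdot>\<^bsub>D\<^esub>
                (Ident D (FObj F X) \<otimes>\<^sub>a\<^bsub>D\<^esub> FUnit F) = RUnit D (FObj F X)"

definition full_functor ::
  "('o1, 'm1, 'k, 'z1) moncat_scheme \<Rightarrow> ('o2, 'm2, 'k, 'z2) moncat_scheme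
     \<Rightarrow> ('o1, 'm1, 'o2, 'm2) monfun \<Rightarrow> bool" where
  "full_functor C D F \<longleftrightarrow> (\<forall>X \<in> Obj C. \<forall>Y \<in> Obj C.
     FArr F ` Hom C X Y = Hom D (FObj F X) (FObj F Y))"

definition faithful_functor ::
  "('o1, 'm1, 'k, 'z1) moncat_scheme \<Rightarrow> ('o2, 'm2, 'k, 'z2) moncat_scheme
     \<Rightarrow> ('o1, 'm1, 'o2, 'm2) monfun \<Rightarrow> bool" where
  "faithful_functor C D F \<longleftrightarrow> (\<forall>X \<in> Obj C. \<forall>Y \<in> Obj C. inj_on (FArr F) (Hom C X Y))"

definition essential_image ::
  "('o1, 'm1, 'k, 'z1) moncat_scheme \<Rightarrow> ('o2, 'm2, 'k, 'z2) moncat_scheme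
     \<Rightarrow> ('o1, 'm1, 'o2, 'm2) monfun \<Rightarrow> 'o2 set" where
  "essential_image C D F = {Y \<in> Obj D. \<exists>X \<in> Obj C. isomorphic D (FObj F X) Y}"

definition dominant_functor ::
  "('o1, 'm1, 'k, 'z1) moncat_scheme \<Rightarrow> ('o2, 'm2, 'k, 'z2) moncat_scheme
     \<Rightarrow> ('o1, 'm1, 'o2, 'm2) monfun \<Rightarrow> bool" where
  "dominant_functor C D F \<longleftrightarrow>
     (\<forall>Y \<in> Obj D. \<exists>X \<in> Obj C. \<exists>u \<in> Hom D Y (FObj F X). mono_arr D u)"

text \<open>A full subcategory is represented by its set of objects.\<close>

definition Ker_functor ::
  "('o1, 'm1, 'k, 'z1) moncat_scheme \<Rightarrow> ('o2, 'm2, 'k, 'z2) moncat_scheme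
     \<Rightarrow> ('o1, 'm1, 'o2, 'm2) monfun \<Rightarrow> 'o1 set" where
  "Ker_functor C D F = {X \<in> Obj C. trivial_object D (FObj F X)}"

text \<open>\<open>u : T \<rightarrow> Y\<close> exhibits \<open>T\<close> as the largest trivial subobject of \<open>Y\<close>: it is a trivial
  subobject, and every trivial subobject factors through it.\<close>

definition largest_trivial_subobject :: "('o, 'm, 'k, 'z) moncat_scheme \<Rightarrow> 'm \<Rightarrow> 'o \<Rightarrow> bool" where
  "largest_trivial_subobject D u Y \<longleftrightarrow>
     mono_arr D u \<and> Trg D u = Y \<and> trivial_object D (Src D u) \<and>
     (\<forall>T. \<forall>v \<in> Hom D T Y. mono_arr D v \<and> trivial_object D T \<longrightarrow>
        (\<exists>w \<in> Hom D T (Src D u). u \<cdot>\<^bsub>D\<^esub> w = v))"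

definition normal_functor ::
  "('o1, 'm1, 'k, 'z1) moncat_scheme \<Rightarrow> ('o2, 'm2, 'k, 'z2) moncat_scheme
     \<Rightarrow> ('o1, 'm1, 'o2, 'm2) monfun \<Rightarrow> bool" where
  "normal_functor C D F \<longleftrightarrow> (\<forall>X \<in> Obj C. \<exists>X\<^sub>0 \<in> Obj C. \<exists>u \<in> Hom C X\<^sub>0 X.
     mono_arr C u \<and> largest_trivial_subobject D (FArr F u) (FObj F X))"

definition exact_sequence ::
  "('o1, 'm1, 'k, 'z1) moncat_scheme \<Rightarrow> ('o2, 'm2, 'k, 'z2) moncat_scheme
     \<Rightarrow> ('o3, 'm3, 'k, 'z3) moncat_scheme
     \<Rightarrow> ('o1, 'm1, 'o2, 'm2) monfun \<Rightarrow> ('o2, 'm2, 'o3, 'm3) monfun \<Rightarrow> bool" where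
  "exact_sequence C' C C'' f F \<longleftrightarrow>
     dominant_functor C C'' F \<and> normal_functor C C'' F \<and>
     full_functor C' C f \<and> faithful_functor C' C f \<and>
     essential_image C' C f = Ker_functor C C'' F"


section \<open>Grothendieck ring and Frobenius-Perron dimension\<close>

definition simple_multiplicity :: "'k ring \<Rightarrow> ('o, 'm, 'k, 'z) lincat_scheme \<Rightarrow> 'o \<Rightarrow> 'o \<Rightarrow> nat" where
  "simple_multiplicity K C Y Z = vdim K (hom_space C Y Z)"

definition Gr_class :: "'k ring \<Rightarrow> ('o, 'm, 'k, 'z) moncat_scheme \<Rightarrow> 'o \<Rightarrow> ('o set \<Rightarrow> int)" where
  "Gr_class K C X = (\<lambda>S \<in> simple_classes C. int (simple_multiplicity K C (rep_obj S) X))"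

text \<open>The Grothendieck ring of a fusion category: the free abelian group on the isomorphism
  classes of simple objects, with the product that extends \<open>[X] [Y] = [X \<otimes> Y]\<close> bilinearly from
  the basis.\<close>

definition Gr_ring :: "'k ring \<Rightarrow> ('o, 'm, 'k, 'z) moncat_scheme \<Rightarrow> ('o set \<Rightarrow> int) ring" where
  "Gr_ring K C = \<lparr>
     carrier = simple_classes C \<rightarrow>\<^sub>E UNIV,
     mult = (\<lambda>a b. \<lambda>U \<in> simple_classes C. \<Sum>S \<in> simple_classes C. \<Sum>T \<in> simple_classes C.
               a S * b T * Gr_class K C (rep_obj S \<otimes>\<^sub>o\<^bsub>C\<^esub> rep_obj T) U),
     one = Gr_class K C \<one>\<^sub>o\<^bsub>C\<^esub>,
     zero = (\<lambda>S \<in> simple_classes C. 0),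
     add = (\<lambda>a b. \<lambda>S \<in> simple_classes C. a S + b S)\<rparr>"

text \<open>Entry \<open>(U, T)\<close> of the matrix of left multiplication by \<open>[X]\<close> in the basis of simple
  classes; \<open>Gr_class K C (rep_obj T)\<close> is the basis vector of \<open>T\<close>.\<close>

definition left_mult_matrix ::
  "'k ring \<Rightarrow> ('o, 'm, 'k, 'z) moncat_scheme \<Rightarrow> 'o \<Rightarrow> 'o set \<Rightarrow> 'o set \<Rightarrow> int" where
  "left_mult_matrix K C X U T = (Gr_class K C X \<otimes>\<^bsub>Gr_ring K C\<^esub> Gr_class K C (rep_obj T)) U"

definition left_mult_eigenvalue ::
  "'k ring \<Rightarrow> ('o, 'm, 'k, 'z) moncat_scheme \<Rightarrow> 'o \<Rightarrow> real \<Rightarrow> bool" where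
  "left_mult_eigenvalue K C X a \<longleftrightarrow> (\<exists>v :: 'o set \<Rightarrow> real.
     (\<exists>S \<in> simple_classes C. v S \<noteq> 0) \<and>
     (\<forall>U \<in> simple_classes C.
        (\<Sum>T \<in> simple_classes C. real_of_int (left_mult_matrix K C X U T) * v T) = a * v U))"

definition FPdim :: "'k ring \<Rightarrow> ('o, 'm, 'k, 'z) moncat_scheme \<Rightarrow> 'o \<Rightarrow> real" where
  "FPdim K C X = Max {a. 0 < a \<and> left_mult_eigenvalue K C X a}"

definition FPdim_cat :: "'k ring \<Rightarrow> ('o, 'm, 'k, 'z) moncat_scheme \<Rightarrow> real" where
  "FPdim_cat K C = (\<Sum>S \<in> simple_classes C. (FPdim K C (rep_obj S))\<^sup>2)"

end

theory Submission
  imports Defs "HOL-Analysis.Function_Topology" "Jordan_Normal_Form.Char_Poly"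
    "Jordan_Normal_Form.Missing_VectorSpace"
begin

text \<open>
  Everything happens in the fusion rings. Write \<open>\<Lambda>\<close> for the simple classes of a fusion category,
  \<open>N\<close> for the multiplicities of simple objects in tensor products of simple objects, and \<open>d\<close> for
  the Frobenius--Perron dimension of a simple class.

  Duality makes left multiplication by a simple class and by its dual class transposes of one
  another, and likewise on the right. So the sum of all right multiplications is a symmetric matrix
  with positive entries. Its positive eigenvector is unique up to scalars, and left multiplications
  commute with right multiplications, hence it is an eigenvector of all left multiplications; its
  eigenvalues are the numbers \<open>d\<close> (\<open>common_positive_eigenvector\<close>, \<open>fp_eqI\<close>). It follows that \<open>d\<close> is
  multiplicative and that the regular element \<open>R = (\<Sum>X. d X [X])\<close> satisfies \<open>[X] R = d X R\<close>
  (\<open>fp_mult\<close>, \<open>fp_regular\<close>).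

  A tensor functor \<open>F\<close> induces a ring homomorphism with nonnegative coefficients. Pairing the two
  characters \<open>d\<close> and \<open>d \<circ> F\<close> with \<open>R\<close> shows that they agree (\<open>fp_image\<close>). If \<open>F\<close> is dominant, then
  \<open>F R\<close> and the regular element \<open>R''\<close> of the target are eigenvectors, for the same eigenvalue, of one
  matrix with positive entries; so they are proportional, and taking dimensions gives
  \<open>F R = (FPdim C / FPdim C'') R''\<close> (\<open>regular_image\<close>). In the coefficient of a simple object \<open>Y\<close> this
  reads \<open>(\<Sum>X. m Y (F X) d X) = (FPdim C / FPdim C'') d Y\<close>.

  Now take for \<open>Y\<close> the unit object. A full tensor functor \<open>i\<close> sends simple objects to simple objects,
  injectively on classes. If \<open>X\<close> comes from \<open>C'\<close>, then \<open>F X\<close> is trivial, so the unit occurs in it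
  \<open>d X\<close> times, and these \<open>X\<close> together contribute \<open>FPdim C'\<close> to the sum (\<open>FPdim_quotient\<close>). The
  remaining terms are nonnegative, which is the inequality, and equality means that \<open>F X\<close> does not
  contain the unit for any simple \<open>X\<close> outside the image of \<open>C'\<close>. This condition is exactness: it makes
  the trivial part of \<open>F X\<close> come from the summands of \<open>X\<close> in the image of \<open>C'\<close>
  (\<open>no_unit_imp_normal\<close>, \<open>no_unit_imp_essential_image\<close>), and conversely a normal functor sends a
  simple object either to a trivial object or to an object without the unit
  (\<open>exact_imp_no_unit\<close>). The last formula is the identity for \<open>Y\<close> above.

  The categorical input consists of Schur's lemma, additivity of dimensions of hom spaces, and
  reciprocity for duals. For reciprocity only inequalities are proved directly
  (\<open>hdim_dual_left\<close>, \<open>hdim_dual_right\<close>); applying them to an object and to its dual turns them into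
  equalities.
\<close>

section \<open>Positive eigenvectors\<close>

text \<open>This is the first-order condition at a maximum: a linear term that is bounded by a
  quadratic one, for arguments of both signs, vanishes.\<close>

lemma quadratic_le_imp_zero:
  fixes a b :: real
  assumes "\<And>s. s * a \<le> s\<^sup>2 * b"
  shows "a = 0"
proof (rule ccontr)
  assume a: "a \<noteq> 0"
  define d where "d = 1 + \<bar>b\<bar>"
  have d: "0 < d" "b < d" by (auto simp: d_def)
  have "(a / d) * a \<le> (a / d)\<^sup>2 * b" by (rule assms)
  then have "a\<^sup>2 * d \<le> a\<^sup>2 * b"
    using d by (simp add: power2_eq_square field_simps)
  then show False using a d by simp
qed

text \<open>The quadratic form of \<open>M\<close> attains its maximum on the nonnegative part of the unit
  sphere. Since replacing a vector by its absolute values does not decrease the form, this is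
  a maximum on the whole sphere, and varying one coordinate there yields the eigenvector
  equation. A vanishing coordinate would contradict the positivity of the entries of \<open>M\<close>.\<close>

lemma symmetric_positive_eigenvector:
  fixes M :: "'a \<Rightarrow> 'a \<Rightarrow> real"
  assumes fin: "finite L" and ne: "L \<noteq> {}"
    and pos: "\<And>u t. \<lbrakk>u \<in> L; t \<in> L\<rbrakk> \<Longrightarrow> 0 < M u t"
    and sym: "\<And>u t. \<lbrakk>u \<in> L; t \<in> L\<rbrakk> \<Longrightarrow> M u t = M t u"
  obtains v l where "\<And>u. u \<in> L \<Longrightarrow> 0 < v u"
    "\<And>u. u \<in> L \<Longrightarrow> (\<Sum>t\<in>L. M u t * v t) = l * v u"
proof -
  define q where "q v = (\<Sum>u\<in>L. \<Sum>t\<in>L. M u t * (v u * v t))" for v :: "'a \<Rightarrow> real"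
  define B where "B = (\<Pi>\<^sub>E i\<in>UNIV. if i \<in> L then {0..1::real} else {0})"
  define S where "S = B \<inter> {v. (\<Sum>t\<in>L. (v t)\<^sup>2) = 1}"
  have "compactin (product_topology (\<lambda>i. euclidean) UNIV) B"
    unfolding B_def by (subst compactin_PiE) auto
  then have "compact B" by (simp add: euclidean_product_topology)
  moreover have "closed {v :: 'a \<Rightarrow> real. (\<Sum>t\<in>L. (v t)\<^sup>2) = 1}"
    by (intro closed_Collect_eq continuous_intros continuous_on_product_coordinates)
  ultimately have comp: "compact S" unfolding S_def by (rule compact_Int_closed)
  obtain u0 where u0: "u0 \<in> L" using ne by blast
  have "(\<Sum>t\<in>L. (if t = u0 then 1::real else 0)\<^sup>2) = 1"
    using fin u0 by (simp add: if_distrib[of "\<lambda>x. x\<^sup>2"] sum.delta cong: if_cong)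
  then have "(\<lambda>t. if t = u0 then 1 else 0) \<in> S"
    using u0 by (auto simp: S_def B_def)
  then have neS: "S \<noteq> {}" by blast
  have "continuous_on S q" unfolding q_def
    by (intro continuous_intros continuous_on_subset[OF continuous_on_product_coordinates]) auto
  from continuous_attains_sup[OF comp neS this]
  obtain v where v: "v \<in> S" and vmax: "\<And>w. w \<in> S \<Longrightarrow> q w \<le> q v" by blast
  define l where "l = q v"
  have v0: "0 \<le> v u" if "u \<in> L" for u
    using v that by (auto simp: S_def B_def PiE_def Pi_def split: if_splits dest: spec[of _ u])
  have v1: "(\<Sum>t\<in>L. (v t)\<^sup>2) = 1" using v by (simp add: S_def)
  \<comment> \<open>By homogeneity, and since passing to absolute values does not decrease \<open>q\<close>.\<close>
  have bound: "q w \<le> l * (\<Sum>t\<in>L. (w t)\<^sup>2)" for w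
  proof (cases "(\<Sum>t\<in>L. (w t)\<^sup>2) = 0")
    case True
    then have "\<forall>t\<in>L. w t = 0" using fin by (simp add: sum_nonneg_eq_0_iff)
    then show ?thesis using True by (simp add: q_def)
  next
    case False
    define n where "n = sqrt (\<Sum>t\<in>L. (w t)\<^sup>2)"
    have n2: "n\<^sup>2 = (\<Sum>t\<in>L. (w t)\<^sup>2)" by (simp add: n_def sum_nonneg)
    have npos: "0 < n" using False by (simp add: n_def sum_nonneg order_less_le)
    define z where "z t = (if t \<in> L then \<bar>w t\<bar> / n else 0)" for t
    have sq: "(\<Sum>t\<in>L. (z t)\<^sup>2) = 1"
    proof -
      have "(\<Sum>t\<in>L. (z t)\<^sup>2) = (\<Sum>t\<in>L. (w t)\<^sup>2 / n\<^sup>2)"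
        by (rule sum.cong) (auto simp: z_def power_divide)
      also have "\<dots> = n\<^sup>2 / n\<^sup>2" by (simp only: n2 flip: sum_divide_distrib)
      finally show ?thesis using npos by simp
    qed
    have z1: "z t \<le> 1" if "t \<in> L" for t
    proof -
      have "(z t)\<^sup>2 \<le> (\<Sum>t\<in>L. (z t)\<^sup>2)" by (rule member_le_sum) (use that fin in auto)
      then have "(z t)\<^sup>2 \<le> 1\<^sup>2" using sq by simp
      then show ?thesis by (rule power2_le_imp_le) simp
    qed
    have "z \<in> S" using z1 sq npos by (auto simp: S_def B_def z_def)
    then have "q z \<le> l" unfolding l_def by (rule vmax)
    have "q w \<le> (\<Sum>u\<in>L. \<Sum>t\<in>L. M u t * (\<bar>w u\<bar> * \<bar>w t\<bar>))"
      unfolding q_def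
      by (intro sum_mono mult_left_mono) (auto simp: pos less_imp_le simp flip: abs_mult)
    also have "\<dots> = (\<Sum>u\<in>L. \<Sum>t\<in>L. n\<^sup>2 * (M u t * (z u * z t)))"
      using npos by (intro sum.cong refl) (simp add: z_def power2_eq_square)
    also have "\<dots> = n\<^sup>2 * q z" by (simp add: q_def sum_distrib_left)
    also have "\<dots> \<le> n\<^sup>2 * l" using \<open>q z \<le> l\<close> by (intro mult_left_mono) auto
    finally show ?thesis by (simp add: n2 mult.commute)
  qed
  have eig: "(\<Sum>t\<in>L. M u t * v t) = l * v u" if u: "u \<in> L" for u
  proof -
    define m where "m = (\<Sum>t\<in>L. M u t * v t)"
    have "s * (2 * (m - l * v u)) \<le> s\<^sup>2 * (l - M u u)" for s
    proof -
      define w where "w t = v t + (if t = u then s else 0)" for t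
      have A: "(\<Sum>r\<in>L. M r u * v r) = m"
        unfolding m_def by (rule sum.cong) (use sym u in auto)
      have "q w = (\<Sum>r\<in>L. (\<Sum>t\<in>L. M r t * (v r * v t))
          + (\<Sum>t\<in>L. if t = u then M r t * (v r * s) else 0)
          + (if r = u then s * (\<Sum>t\<in>L. M r t * v t) else 0)
          + (if r = u then \<Sum>t\<in>L. if t = u then M r t * s\<^sup>2 else 0 else 0))"
        unfolding q_def w_def sum_distrib_left
        by (intro sum.cong refl)
          (auto simp: algebra_simps power2_eq_square sum_distrib_left simp flip: sum.distrib
            intro!: sum.cong)
      also have "\<dots> = l + (\<Sum>r\<in>L. M r u * v r) * s + s * m + M u u * s\<^sup>2"
        using fin u
        by (simp add: sum.distrib q_def l_def sum.delta m_def sum_distrib_right mult.assoc)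
      also have "\<dots> = l + 2 * s * m + M u u * s\<^sup>2"
        using A by simp
      finally have qw: "q w = l + 2 * s * m + M u u * s\<^sup>2" .
      have "(\<Sum>t\<in>L. (w t)\<^sup>2) = (\<Sum>t\<in>L. (v t)\<^sup>2 + (if t = u then 2 * s * v t + s\<^sup>2 else 0))"
        by (intro sum.cong refl) (simp add: w_def power2_eq_square algebra_simps)
      also have "\<dots> = 1 + 2 * s * v u + s\<^sup>2" using fin u by (simp add: sum.distrib v1 sum.delta)
      finally have "q w \<le> l * (1 + 2 * s * v u + s\<^sup>2)" using bound[of w] by simp
      then show ?thesis unfolding qw by (simp add: algebra_simps)
    qed
    then have "2 * (m - l * v u) = 0" by (rule quadratic_le_imp_zero)
    then show ?thesis by (simp add: m_def)
  qed
  have "0 < v u" if u: "u \<in> L" for u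
  proof -
    obtain k where k: "k \<in> L" "v k \<noteq> 0"
      using v1 by (metis (no_types, lifting) sum.neutral zero_neq_one zero_power2)
    have "0 < M u k * v k" using k v0[OF k(1)] pos[OF u k(1)] by simp
    also have "\<dots> \<le> (\<Sum>t\<in>L. M u t * v t)"
      by (rule member_le_sum) (use k fin v0 pos u in \<open>auto simp: less_imp_le\<close>)
    finally have "v u \<noteq> 0" using eig[OF u] by auto
    then show ?thesis using v0[OF u] by simp
  qed
  then show thesis using eig that by blast
qed

text \<open>Subtract from \<open>w\<close> the largest multiple of \<open>v\<close> that leaves it nonnegative. The
  difference is an eigenvector with a zero coordinate, and positivity of the entries spreads
  this zero to all coordinates.\<close>

lemma positive_matrix_eigenvector_unique:
  fixes M :: "'a \<Rightarrow> 'a \<Rightarrow> real"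
  assumes fin: "finite L" and ne: "L \<noteq> {}"
    and pos: "\<And>u t. \<lbrakk>u \<in> L; t \<in> L\<rbrakk> \<Longrightarrow> 0 < M u t"
    and v: "\<And>u. u \<in> L \<Longrightarrow> 0 < v u" "\<And>u. u \<in> L \<Longrightarrow> (\<Sum>t\<in>L. M u t * v t) = l * v u"
    and w: "\<And>u. u \<in> L \<Longrightarrow> (\<Sum>t\<in>L. M u t * w t) = l * w u"
  obtains c where "\<And>u. u \<in> L \<Longrightarrow> w u = c * v u"
proof -
  define c where "c = Min ((\<lambda>u. w u / v u) ` L)"
  have "c \<in> (\<lambda>u. w u / v u) ` L" unfolding c_def using fin ne by (intro Min_in) auto
  then obtain k where k: "k \<in> L" "c = w k / v k" by blast
  define z where "z u = w u - c * v u" for u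
  have z0: "0 \<le> z u" if "u \<in> L" for u
  proof -
    have "c \<le> w u / v u" unfolding c_def using fin that by (intro Min_le) auto
    then show ?thesis using v(1)[OF that] by (simp add: z_def field_simps)
  qed
  have zk: "z k = 0" using k v(1)[OF k(1)] by (simp add: z_def)
  have "(\<Sum>t\<in>L. M k t * z t) = l * z k"
    using v(2)[OF k(1)] w[OF k(1)]
    by (simp add: z_def right_diff_distrib sum_subtractf mult.left_commute[of _ c] mult.left_commute[of l]
        flip: sum_distrib_left)
  then have "(\<Sum>t\<in>L. M k t * z t) = 0" by (simp add: zk)
  then have "\<forall>t\<in>L. M k t * z t = 0"
    by (subst (asm) sum_nonneg_eq_0_iff) (use fin z0 pos k in \<open>auto simp: less_imp_le\<close>)
  then have "z t = 0" if "t \<in> L" for t using pos[OF k(1) that] that by auto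
  then show thesis using that[of c] by (simp add: z_def)
qed

text \<open>Compare both sides of the eigenvalue equation at a coordinate where \<open>\<bar>w u\<bar> / v u\<close> is
  largest.\<close>

lemma eigenvalue_le_of_positive_eigenvector:
  fixes A :: "'a \<Rightarrow> 'a \<Rightarrow> real"
  assumes fin: "finite L"
    and nonneg: "\<And>u t. \<lbrakk>u \<in> L; t \<in> L\<rbrakk> \<Longrightarrow> 0 \<le> A u t"
    and v: "\<And>u. u \<in> L \<Longrightarrow> 0 < v u" "\<And>u. u \<in> L \<Longrightarrow> (\<Sum>t\<in>L. A u t * v t) = c * v u"
    and w: "s \<in> L" "w s \<noteq> 0" "\<And>u. u \<in> L \<Longrightarrow> (\<Sum>t\<in>L. A u t * w t) = a * w u"
  shows "a \<le> c"
proof -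
  define r where "r = Max ((\<lambda>u. \<bar>w u\<bar> / v u) ` L)"
  have "r \<in> (\<lambda>u. \<bar>w u\<bar> / v u) ` L" unfolding r_def using fin w(1) by (intro Max_in) auto
  then obtain k where k: "k \<in> L" "r = \<bar>w k\<bar> / v k" by blast
  have le: "\<bar>w u\<bar> \<le> r * v u" if "u \<in> L" for u
  proof -
    have "\<bar>w u\<bar> / v u \<le> r" unfolding r_def using fin that by (intro Max_ge) auto
    then show ?thesis using v(1)[OF that] by (simp add: field_simps)
  qed
  have wk: "\<bar>w k\<bar> = r * v k" using k v(1)[OF k(1)] by simp
  have "0 < r * v s" using le[OF w(1)] w(2) by linarith
  then have r: "0 < r" using v(1)[OF w(1)] by (simp add: zero_less_mult_iff)
  have "a * \<bar>w k\<bar> \<le> \<bar>a * w k\<bar>" by (simp add: abs_mult mult_right_mono)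
  also have "\<dots> = \<bar>\<Sum>t\<in>L. A k t * w t\<bar>" by (simp add: w(3)[OF k(1)])
  also have "\<dots> \<le> (\<Sum>t\<in>L. A k t * \<bar>w t\<bar>)"
    by (rule order_trans[OF sum_abs]) (simp add: abs_mult nonneg k(1) sum_mono)
  also have "\<dots> \<le> (\<Sum>t\<in>L. A k t * (r * v t))"
    by (intro sum_mono mult_left_mono le nonneg k(1))
  also have "\<dots> = r * (\<Sum>t\<in>L. A k t * v t)" by (simp add: sum_distrib_left algebra_simps)
  also have "\<dots> = c * (r * v k)" by (simp add: v(2)[OF k(1)])
  finally have "a * (r * v k) \<le> c * (r * v k)" by (simp add: wk)
  then show ?thesis using r v(1)[OF k(1)] by simp
qed

text \<open>The maximum in the definition of the Frobenius--Perron dimension is meaningful because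
  eigenvalues are roots of the characteristic polynomial.\<close>

lemma finite_eigenvalues:
  fixes A :: "'a \<Rightarrow> 'a \<Rightarrow> real"
  assumes fin: "finite L"
  shows "finite {a. \<exists>w. (\<exists>s\<in>L. w s \<noteq> 0) \<and> (\<forall>u\<in>L. (\<Sum>t\<in>L. A u t * w t) = a * w u)}"
    (is "finite ?E")
proof -
  obtain h where h: "bij_betw h {0..<card L} L" using ex_bij_betw_nat_finite[OF fin] by blast
  define n where "n = card L"
  define B where "B = mat n n (\<lambda>(i, j). A (h i) (h j))"
  have B: "B \<in> carrier_mat n n" by (simp add: B_def)
  have "?E \<subseteq> {a. poly (char_poly B) a = 0}"
  proof safe
    fix a w s
    assume s: "s \<in> L" "w s \<noteq> 0" and w: "\<forall>u\<in>L. (\<Sum>t\<in>L. A u t * w t) = a * w u"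
    define x where "x = vec n (\<lambda>i. w (h i))"
    obtain k where k: "k < n" "h k = s"
      using s(1) bij_betw_imp_surj_on[OF h] unfolding n_def by (metis atLeastLessThan_iff imageE)
    have "x \<noteq> 0\<^sub>v n" using k s(2) by (auto simp: x_def vec_eq_iff)
    moreover have "B *\<^sub>v x = a \<cdot>\<^sub>v x"
    proof (rule eq_vecI)
      fix i assume "i < dim_vec (a \<cdot>\<^sub>v x)"
      then have i: "i < n" by (simp add: x_def)
      then have hi: "h i \<in> L" using h by (auto simp: bij_betw_def n_def)
      have "(B *\<^sub>v x) $ i = (\<Sum>j = 0..<n. A (h i) (h j) * w (h j))"
        using i by (simp add: B_def x_def scalar_prod_def)
      also have "\<dots> = (\<Sum>t\<in>L. A (h i) t * w t)"
        using sum.reindex_bij_betw[OF h, of "\<lambda>t. A (h i) t * w t"] by (simp add: n_def)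
      also have "\<dots> = (a \<cdot>\<^sub>v x) $ i" using w hi i by (simp add: x_def)
      finally show "(B *\<^sub>v x) $ i = (a \<cdot>\<^sub>v x) $ i" .
    qed (simp add: B_def x_def)
    ultimately have "eigenvalue B a"
      unfolding eigenvalue_def eigenvector_def by (intro exI[of _ x]) (simp add: B_def x_def)
    then show "poly (char_poly B) a = 0" using eigenvalue_root_char_poly[OF B] by simp
  qed
  moreover have "char_poly B \<noteq> 0" using degree_monic_char_poly[OF B] by auto
  ultimately show ?thesis using poly_roots_finite finite_subset by blast
qed

section \<open>Fusion rings\<close>

text \<open>The multiplication table of a based ring over the basis \<open>L\<close>: the number \<open>N x y z\<close> is
  the coefficient of \<open>z\<close> in \<open>x y\<close>. Reciprocity says that multiplications by \<open>x\<close> and by \<open>d x\<close>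
  are transposes of one another.\<close>

locale fusion_ring =
  fixes L :: "'a set" and N :: "'a \<Rightarrow> 'a \<Rightarrow> 'a \<Rightarrow> real" and e :: 'a and d :: "'a \<Rightarrow> 'a"
  assumes finite_L: "finite L" and unit_L: "e \<in> L"
    and dual_L: "x \<in> L \<Longrightarrow> d x \<in> L"
    and nonneg: "\<lbrakk>x \<in> L; y \<in> L; z \<in> L\<rbrakk> \<Longrightarrow> 0 \<le> N x y z"
    and assoc: "\<lbrakk>x \<in> L; y \<in> L; z \<in> L; u \<in> L\<rbrakk>
      \<Longrightarrow> (\<Sum>w\<in>L. N x y w * N w z u) = (\<Sum>w\<in>L. N y z w * N x w u)"
    and unit_left: "\<lbrakk>y \<in> L; z \<in> L\<rbrakk> \<Longrightarrow> N e y z = (if y = z then 1 else 0)"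
    and unit_right: "\<lbrakk>y \<in> L; z \<in> L\<rbrakk> \<Longrightarrow> N y e z = (if y = z then 1 else 0)"
    and reciprocity_left: "\<lbrakk>x \<in> L; y \<in> L; z \<in> L\<rbrakk> \<Longrightarrow> N (d x) y z = N x z y"
    and reciprocity_right: "\<lbrakk>x \<in> L; y \<in> L; z \<in> L\<rbrakk> \<Longrightarrow> N y (d x) z = N z x y"
begin

lemma L_nonempty: "L \<noteq> {}"
  using unit_L by blast

lemma dual_pairing: assumes "x \<in> L" shows "N x (d x) e = 1" "N (d x) x e = 1"
  using reciprocity_left[OF assms unit_L dual_L[OF assms]]
    reciprocity_right[OF assms unit_L dual_L[OF assms]] assms
  by (simp_all add: unit_left unit_right unit_L dual_L)

lemma inj_dual: "inj_on d L"
proof (rule inj_onI)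
  fix x y assume x: "x \<in> L" and y: "y \<in> L" and eq: "d x = d y"
  have "N x e y = N (d x) y e" using reciprocity_left[OF x y unit_L] by simp
  also have "\<dots> = N y e y" using reciprocity_left[OF y y unit_L] eq by simp
  finally show "x = y" using unit_right x y by (auto split: if_splits)
qed

lemma dual_permutes: "bij_betw d L L"
  unfolding bij_betw_def using endo_inj_surj[OF finite_L _ inj_dual] inj_dual dual_L by blast

text \<open>The product \<open>u (d t) t\<close> contains \<open>u\<close>, since \<open>(d t) t\<close> contains the unit; so some
  constituent \<open>z\<close> of \<open>u (d t)\<close> does it.\<close>

lemma left_transitive: assumes t: "t \<in> L" and u: "u \<in> L" shows "\<exists>z\<in>L. 0 < N z t u"
proof (rule ccontr)
  assume *: "\<not> ?thesis"
  have "1 = N (d t) t e * N u e u" using t u by (simp add: dual_pairing unit_right)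
  also have "\<dots> \<le> (\<Sum>w\<in>L. N (d t) t w * N u w u)"
    by (rule member_le_sum) (use t u unit_L finite_L dual_L nonneg in auto)
  also have "\<dots> = (\<Sum>w\<in>L. N u (d t) w * N w t u)" using assoc t u dual_L by simp
  also have "\<dots> = 0"
  proof (rule sum.neutral, rule ballI)
    fix w assume "w \<in> L"
    then have "N w t u = 0" using * nonneg t u by (metis less_eq_real_def)
    then show "N u (d t) w * N w t u = 0" by simp
  qed
  finally show False by simp
qed

lemma right_transitive: assumes t: "t \<in> L" and u: "u \<in> L" shows "\<exists>y\<in>L. 0 < N t y u"
proof (rule ccontr)
  assume *: "\<not> ?thesis"
  have "1 = N t (d t) e * N e u u" using t u by (simp add: dual_pairing unit_left)
  also have "\<dots> \<le> (\<Sum>w\<in>L. N t (d t) w * N w u u)"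
    by (rule member_le_sum) (use t u unit_L finite_L dual_L nonneg in auto)
  also have "\<dots> = (\<Sum>w\<in>L. N (d t) u w * N t w u)" using assoc t u dual_L by simp
  also have "\<dots> = 0"
  proof (rule sum.neutral, rule ballI)
    fix w assume "w \<in> L"
    then have "N t w u = 0" using * nonneg t u by (metis less_eq_real_def)
    then show "N (d t) u w * N t w u = 0" by simp
  qed
  finally show False by simp
qed

text \<open>The sum \<open>M\<close> of all right multiplications is symmetric by reciprocity and has positive
  entries by transitivity. Left multiplications commute with it, so they preserve its
  one-dimensional eigenspace of positive vectors.\<close>

lemma common_positive_eigenvector:
  obtains v c where "\<And>u. u \<in> L \<Longrightarrow> 0 < v u"
    "\<And>x u. \<lbrakk>x \<in> L; u \<in> L\<rbrakk> \<Longrightarrow> (\<Sum>t\<in>L. N x t u * v t) = c x * v u"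
proof -
  define M where "M u t = (\<Sum>y\<in>L. N t y u)" for u t
  have Mpos: "0 < M u t" if u: "u \<in> L" and t: "t \<in> L" for u t
  proof -
    obtain y where y: "y \<in> L" "0 < N t y u" using right_transitive[OF t u] by blast
    show ?thesis unfolding M_def
      by (rule sum_pos2[OF finite_L y(1)]) (use y u t nonneg in auto)
  qed
  have Msym: "M u t = M t u" if "u \<in> L" "t \<in> L" for u t
  proof -
    have "M u t = (\<Sum>y\<in>L. N t (d y) u)"
      unfolding M_def by (rule sum.reindex_bij_betw[OF dual_permutes, symmetric])
    also have "\<dots> = M t u" unfolding M_def
      by (rule sum.cong) (use that reciprocity_right in auto)
    finally show ?thesis .
  qed
  obtain v l where v: "\<And>u. u \<in> L \<Longrightarrow> 0 < v u"
    and Mv: "\<And>u. u \<in> L \<Longrightarrow> (\<Sum>t\<in>L. M u t * v t) = l * v u"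
    using symmetric_positive_eigenvector[of L M, OF finite_L L_nonempty] Mpos Msym by blast
  have "\<exists>c. \<forall>u\<in>L. (\<Sum>t\<in>L. N x t u * v t) = c * v u" if x: "x \<in> L" for x
  proof -
    define w where "w u = (\<Sum>t\<in>L. N x t u * v t)" for u
    \<comment> \<open>By associativity left multiplication by \<open>x\<close> commutes with \<open>M\<close>.\<close>
    have "(\<Sum>r\<in>L. M u r * w r) = l * w u" if u: "u \<in> L" for u
    proof -
      have "(\<Sum>r\<in>L. M u r * w r) = (\<Sum>r\<in>L. \<Sum>y\<in>L. \<Sum>t\<in>L. N x t r * N r y u * v t)"
        unfolding M_def w_def sum_product by (intro sum.cong refl) simp
      also have "\<dots> = (\<Sum>t\<in>L. \<Sum>y\<in>L. \<Sum>r\<in>L. N x t r * N r y u * v t)"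
        by (subst sum.swap, subst sum.swap[of _ L L], rule sum.swap) 
      also have "\<dots> = (\<Sum>t\<in>L. \<Sum>y\<in>L. (\<Sum>r\<in>L. N x t r * N r y u) * v t)"
        by (simp add: sum_distrib_right)
      also have "\<dots> = (\<Sum>t\<in>L. \<Sum>y\<in>L. (\<Sum>r\<in>L. N t y r * N x r u) * v t)"
        by (intro sum.cong refl) (use assoc x u in auto)
      also have "\<dots> = (\<Sum>t\<in>L. \<Sum>y\<in>L. \<Sum>r\<in>L. N x r u * (N t y r * v t))"
        by (simp add: sum_distrib_right sum_distrib_left algebra_simps)
      also have "\<dots> = (\<Sum>r\<in>L. \<Sum>t\<in>L. \<Sum>y\<in>L. N x r u * (N t y r * v t))"
        by (subst sum.swap[of _ L L]) (subst sum.swap, rule refl)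
      also have "\<dots> = (\<Sum>r\<in>L. N x r u * (\<Sum>t\<in>L. M r t * v t))"
        by (simp add: M_def sum_distrib_left sum_distrib_right)
      also have "\<dots> = (\<Sum>r\<in>L. N x r u * (l * v r))"
        by (intro sum.cong refl) (simp add: Mv)
      also have "\<dots> = l * w u" by (simp add: w_def sum_distrib_left algebra_simps)
      finally show ?thesis .
    qed
    then obtain c where "\<And>u. u \<in> L \<Longrightarrow> w u = c * v u"
      using positive_matrix_eigenvector_unique[of L M v l w, OF finite_L L_nonempty] Mpos v Mv by blast
    then show ?thesis unfolding w_def by blast
  qed
  then obtain c where "\<forall>x\<in>L. \<forall>u\<in>L. (\<Sum>t\<in>L. N x t u * v t) = c x * v u"
    by metis
  then show thesis using v that by blast
qed

text \<open>The Frobenius--Perron dimension of a basis element.\<close>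

definition fp :: "'a \<Rightarrow> real" where
  "fp x = Max {a. 0 < a \<and> (\<exists>w. (\<exists>s\<in>L. w s \<noteq> 0) \<and>
      (\<forall>u\<in>L. (\<Sum>t\<in>L. N x t u * w t) = a * w u))}"

lemma fp_eqI:
  assumes x: "x \<in> L" and v: "\<And>u. u \<in> L \<Longrightarrow> 0 < v u"
    and eig: "\<And>u. u \<in> L \<Longrightarrow> (\<Sum>t\<in>L. N x t u * v t) = c * v u"
  shows "fp x = c" and "0 < c"
proof -
  obtain t where t: "t \<in> L" "0 < N x t e" using right_transitive[OF x unit_L] by blast
  have "0 < N x t e * v t" using t v by simp
  also have "\<dots> \<le> c * v e" unfolding eig[OF unit_L, symmetric]
    by (rule member_le_sum) (use t x finite_L nonneg unit_L v in \<open>auto simp: less_imp_le\<close>)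
  finally show c: "0 < c" using v[OF unit_L] by (simp add: zero_less_mult_iff)
  show "fp x = c" unfolding fp_def
  proof (rule Max_eqI)
    show "finite {a. 0 < a \<and> (\<exists>w. (\<exists>s\<in>L. w s \<noteq> 0) \<and>
        (\<forall>u\<in>L. (\<Sum>t\<in>L. N x t u * w t) = a * w u))}"
      by (rule finite_subset[OF _ finite_eigenvalues[OF finite_L, of "\<lambda>u t. N x t u"]]) blast
    show "c \<in> {a. 0 < a \<and> (\<exists>w. (\<exists>s\<in>L. w s \<noteq> 0) \<and>
        (\<forall>u\<in>L. (\<Sum>t\<in>L. N x t u * w t) = a * w u))}"
      using c eig v[OF unit_L] unit_L by (auto intro!: exI[of _ v] bexI[of _ e])
    fix a assume "a \<in> {a. 0 < a \<and> (\<exists>w. (\<exists>s\<in>L. w s \<noteq> 0) \<and>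
        (\<forall>u\<in>L. (\<Sum>t\<in>L. N x t u * w t) = a * w u))}"
    then obtain w s where w: "s \<in> L" "w s \<noteq> 0"
      "\<And>u. u \<in> L \<Longrightarrow> (\<Sum>t\<in>L. N x t u * w t) = a * w u" by blast
    show "a \<le> c"
      by (rule eigenvalue_le_of_positive_eigenvector[OF finite_L _ v eig w]) (use nonneg x in auto)
  qed
qed

lemma fp_eigenvector:
  obtains v where "\<And>u. u \<in> L \<Longrightarrow> 0 < v u"
    "\<And>x u. \<lbrakk>x \<in> L; u \<in> L\<rbrakk> \<Longrightarrow> (\<Sum>t\<in>L. N x t u * v t) = fp x * v u"
proof -
  obtain v c where v: "\<And>u. u \<in> L \<Longrightarrow> 0 < v u"
    and eig: "\<And>x u. \<lbrakk>x \<in> L; u \<in> L\<rbrakk> \<Longrightarrow> (\<Sum>t\<in>L. N x t u * v t) = c x * v u"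
    using common_positive_eigenvector by blast
  have "fp x = c x" if x: "x \<in> L" for x by (rule fp_eqI(1)[OF x v eig[OF x]])
  then have "\<And>x u. \<lbrakk>x \<in> L; u \<in> L\<rbrakk> \<Longrightarrow> (\<Sum>t\<in>L. N x t u * v t) = fp x * v u" by (simp add: eig)
  with v show thesis by (rule that)
qed

lemma fp_pos: assumes x: "x \<in> L" shows "0 < fp x"
proof -
  obtain v where v: "\<And>u. u \<in> L \<Longrightarrow> 0 < v u"
    and eig: "\<And>x u. \<lbrakk>x \<in> L; u \<in> L\<rbrakk> \<Longrightarrow> (\<Sum>t\<in>L. N x t u * v t) = fp x * v u"
    using fp_eigenvector by blast
  show ?thesis by (rule fp_eqI(2)[OF x v eig[OF x]])
qed

lemma fp_unit: "fp e = 1"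
  by (rule fp_eqI(1)[OF unit_L, of "\<lambda>_. 1"])
    (simp_all add: unit_left if_distrib[of "\<lambda>x. x * _"] sum.delta finite_L cong: if_cong)

text \<open>Both sides are the eigenvalue of the product \<open>x y\<close> on the common eigenvector.\<close>

lemma fp_mult:
  assumes x: "x \<in> L" and y: "y \<in> L"
  shows "(\<Sum>z\<in>L. N x y z * fp z) = fp x * fp y"
proof -
  obtain v where v: "\<And>u. u \<in> L \<Longrightarrow> 0 < v u"
    and eig: "\<And>x u. \<lbrakk>x \<in> L; u \<in> L\<rbrakk> \<Longrightarrow> (\<Sum>t\<in>L. N x t u * v t) = fp x * v u"
    using fp_eigenvector by blast
  have "(\<Sum>z\<in>L. N x y z * fp z) * v e = (\<Sum>z\<in>L. N x y z * (\<Sum>t\<in>L. N z t e * v t))"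
    by (simp add: sum_distrib_right mult.assoc eig unit_L)
  also have "\<dots> = (\<Sum>t\<in>L. (\<Sum>z\<in>L. N x y z * N z t e) * v t)"
    by (simp add: sum_distrib_left sum_distrib_right mult.assoc) (rule sum.swap)
  also have "\<dots> = (\<Sum>t\<in>L. (\<Sum>z\<in>L. N y t z * N x z e) * v t)"
    by (intro sum.cong refl) (simp add: assoc x y unit_L)
  also have "\<dots> = (\<Sum>z\<in>L. N x z e * (\<Sum>t\<in>L. N y t z * v t))"
    by (simp add: sum_distrib_left sum_distrib_right algebra_simps) (rule sum.swap)
  also have "\<dots> = (\<Sum>z\<in>L. N x z e * (fp y * v z))"
    by (intro sum.cong refl) (simp add: eig y)
  also have "\<dots> = fp y * (\<Sum>z\<in>L. N x z e * v z)" by (simp add: sum_distrib_left algebra_simps)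
  also have "\<dots> = fp x * fp y * v e" by (simp add: eig x unit_L)
  finally show ?thesis using v[OF unit_L] by simp
qed

text \<open>Left multiplications by \<open>x\<close> and \<open>d x\<close> are transposes, so they give the same value when
  paired on both sides with the common eigenvector.\<close>

lemma fp_dual: assumes x: "x \<in> L" shows "fp (d x) = fp x"
proof -
  obtain v where v: "\<And>u. u \<in> L \<Longrightarrow> 0 < v u"
    and eig: "\<And>x u. \<lbrakk>x \<in> L; u \<in> L\<rbrakk> \<Longrightarrow> (\<Sum>t\<in>L. N x t u * v t) = fp x * v u"
    using fp_eigenvector by blast
  have "fp (d x) * (\<Sum>u\<in>L. (v u)\<^sup>2) = (\<Sum>u\<in>L. v u * (fp (d x) * v u))"
    by (simp add: sum_distrib_left power2_eq_square algebra_simps)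
  also have "\<dots> = (\<Sum>u\<in>L. v u * (\<Sum>t\<in>L. N (d x) t u * v t))"
    by (intro sum.cong refl) (simp add: eig dual_L x)
  also have "\<dots> = (\<Sum>u\<in>L. \<Sum>t\<in>L. v t * (N x u t * v u))"
    unfolding sum_distrib_left by (intro sum.cong refl) (simp add: reciprocity_left x)
  also have "\<dots> = (\<Sum>t\<in>L. v t * (\<Sum>u\<in>L. N x u t * v u))"
    unfolding sum_distrib_left by (rule sum.swap)
  also have "\<dots> = (\<Sum>t\<in>L. v t * (fp x * v t))"
    by (intro sum.cong refl) (simp add: eig x)
  also have "\<dots> = fp x * (\<Sum>u\<in>L. (v u)\<^sup>2)"
    by (simp add: sum_distrib_left power2_eq_square algebra_simps)
  finally have "fp (d x) * (\<Sum>u\<in>L. (v u)\<^sup>2) = fp x * (\<Sum>u\<in>L. (v u)\<^sup>2)" .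
  moreover have "0 < (\<Sum>u\<in>L. (v u)\<^sup>2)"
    by (rule sum_pos) (simp_all add: finite_L L_nonempty v zero_less_power
        del: zero_less_power2 zero_less_power_eq_numeral)
  ultimately show ?thesis by simp
qed

text \<open>In other words, the regular element \<open>(\<Sum>t\<in>L. fp t t)\<close> is a common eigenvector of all
  left multiplications. Reciprocity turns this into multiplicativity for the dual of \<open>x\<close>.\<close>

lemma fp_regular:
  assumes x: "x \<in> L" and u: "u \<in> L"
  shows "(\<Sum>t\<in>L. N x t u * fp t) = fp x * fp u"
proof -
  have "(\<Sum>t\<in>L. N x t u * fp t) = (\<Sum>t\<in>L. N (d x) u t * fp t)"
    by (intro sum.cong refl) (simp add: reciprocity_left x u)
  then show ?thesis by (simp add: fp_mult dual_L x u fp_dual)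
qed

definition total :: real where "total = (\<Sum>x\<in>L. (fp x)\<^sup>2)"

lemma total_pos: "0 < total"
  unfolding total_def by (rule sum_pos) (simp_all add: finite_L L_nonempty fp_pos zero_less_power
      del: zero_less_power_eq_numeral zero_less_power2)

end

locale fusion_ring_hom = A: fusion_ring L N e d + B: fusion_ring L' N' e' d'
  for L :: "'a set" and N e d and L' :: "'b set" and N' e' d' +
  fixes n :: "'b \<Rightarrow> 'a \<Rightarrow> real"
  assumes n_nonneg: "\<lbrakk>y \<in> L'; x \<in> L\<rbrakk> \<Longrightarrow> 0 \<le> n y x"
    and n_unit: "y \<in> L' \<Longrightarrow> n y e = (if y = e' then 1 else 0)"
    and n_mult: "\<lbrakk>x \<in> L; x' \<in> L; u \<in> L'\<rbrakk> \<Longrightarrow> (\<Sum>z\<in>L. N x x' z * n u z)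
        = (\<Sum>y\<in>L'. \<Sum>y'\<in>L'. n y x * n y' x' * N' y y' u)"
begin

text \<open>The function \<open>f\<close> below is a second character of the source ring. Evaluating it on \<open>x\<close>
  times the regular element in two ways gives \<open>f x\<close> and \<open>fp x\<close> as the same eigenvalue.\<close>

lemma fp_image: assumes x: "x \<in> L" shows "(\<Sum>y\<in>L'. n y x * B.fp y) = A.fp x"
proof -
  define f where "f x = (\<Sum>y\<in>L'. n y x * B.fp y)" for x
  have f_mult: "(\<Sum>z\<in>L. N x x' z * f z) = f x * f x'" if "x \<in> L" "x' \<in> L" for x x'
  proof -
    have "(\<Sum>z\<in>L. N x x' z * f z) = (\<Sum>u\<in>L'. (\<Sum>z\<in>L. N x x' z * n u z) * B.fp u)"
      by (simp add: f_def sum_distrib_left sum_distrib_right mult.assoc) (rule sum.swap)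
    also have "\<dots> = (\<Sum>u\<in>L'. (\<Sum>y\<in>L'. \<Sum>y'\<in>L'. n y x * n y' x' * N' y y' u) * B.fp u)"
      by (intro sum.cong refl) (simp add: n_mult that)
    also have "\<dots> = (\<Sum>u\<in>L'. \<Sum>y\<in>L'. \<Sum>y'\<in>L'. n y x * n y' x' * (N' y y' u * B.fp u))"
      by (simp add: sum_distrib_right mult.assoc)
    also have "\<dots> = (\<Sum>y\<in>L'. \<Sum>u\<in>L'. \<Sum>y'\<in>L'. n y x * n y' x' * (N' y y' u * B.fp u))"
      by (rule sum.swap)
    also have "\<dots> = (\<Sum>y\<in>L'. \<Sum>y'\<in>L'. \<Sum>u\<in>L'. n y x * n y' x' * (N' y y' u * B.fp u))"
      by (intro sum.cong refl sum.swap)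
    also have "\<dots> = (\<Sum>y\<in>L'. \<Sum>y'\<in>L'. n y x * n y' x' * (B.fp y * B.fp y'))"
      by (intro sum.cong refl) (simp add: B.fp_mult flip: sum_distrib_left)
    also have "\<dots> = f x * f x'"
      unfolding f_def sum_product by (intro sum.cong refl) simp
    finally show ?thesis .
  qed
  have f0: "0 \<le> f z" if "z \<in> L" for z
    unfolding f_def by (intro sum_nonneg mult_nonneg_nonneg)
      (use that n_nonneg B.fp_pos in \<open>auto simp: less_imp_le\<close>)
  have fe: "f e = 1"
    unfolding f_def by (simp add: n_unit if_distrib[of "\<lambda>x. x * _"] sum.delta B.finite_L
        B.unit_L B.fp_unit cong: if_cong)
  \<comment> \<open>Two characters pair equally with the regular element.\<close>
  have "f x * (\<Sum>t\<in>L. f t * A.fp t) = (\<Sum>t\<in>L. (\<Sum>z\<in>L. N x t z * f z) * A.fp t)"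
    by (simp add: f_mult x sum_distrib_left mult.assoc)
  also have "\<dots> = (\<Sum>z\<in>L. f z * (\<Sum>t\<in>L. N x t z * A.fp t))"
    by (simp add: sum_distrib_left sum_distrib_right algebra_simps) (rule sum.swap)
  also have "\<dots> = (\<Sum>z\<in>L. f z * (A.fp x * A.fp z))"
    by (intro sum.cong refl) (simp add: A.fp_regular x)
  also have "\<dots> = A.fp x * (\<Sum>t\<in>L. f t * A.fp t)"
    by (simp add: sum_distrib_left algebra_simps)
  finally have "f x * (\<Sum>t\<in>L. f t * A.fp t) = A.fp x * (\<Sum>t\<in>L. f t * A.fp t)" .
  moreover have "0 < (\<Sum>t\<in>L. f t * A.fp t)"
    by (rule sum_pos2[OF A.finite_L A.unit_L])
      (use fe A.fp_pos[OF A.unit_L] f0 A.fp_pos in \<open>auto simp: less_imp_le\<close>)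
  ultimately show ?thesis by (simp add: f_def)
qed

text \<open>Let \<open>w\<close> be the image of the regular element, and \<open>G\<close> the left multiplication by the
  image of the sum of all basis elements. Both \<open>w\<close> and the regular element of the target are
  eigenvectors of \<open>G\<close> for the eigenvalue \<open>g\<close>. Dominance makes the entries of \<open>G\<close> positive, so
  the two are proportional.\<close>

theorem regular_image:
  assumes dominant: "\<And>y. y \<in> L' \<Longrightarrow> \<exists>x\<in>L. 0 < n y x" and y: "y \<in> L'"
  shows "(\<Sum>x\<in>L. n y x * A.fp x) = A.total / B.total * B.fp y"
proof -
  define w where "w y = (\<Sum>x\<in>L. n y x * A.fp x)" for y
  define h where "h y = (\<Sum>x\<in>L. n y x)" for y
  define G where "G u t = (\<Sum>y\<in>L'. h y * N' y t u)" for u t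
  define g where "g = (\<Sum>x\<in>L. A.fp x)"
  have hpos: "0 < h y" if y: "y \<in> L'" for y
  proof -
    obtain x where x: "x \<in> L" "0 < n y x" using dominant[OF y] by blast
    show ?thesis unfolding h_def by (rule sum_pos2[OF A.finite_L x(1)]) (use x n_nonneg y in auto)
  qed
  have Gpos: "0 < G u t" if u: "u \<in> L'" and t: "t \<in> L'" for u t
  proof -
    obtain y where y: "y \<in> L'" "0 < N' y t u" using B.left_transitive[OF t u] by blast
    show ?thesis unfolding G_def
      by (rule sum_pos2[OF B.finite_L y(1)])
        (use y hpos t u B.nonneg in \<open>auto simp: less_imp_le\<close>)
  qed
  have Gfp: "(\<Sum>t\<in>L'. G u t * B.fp t) = g * B.fp u" if u: "u \<in> L'" for u
  proof -
    have "(\<Sum>t\<in>L'. G u t * B.fp t) = (\<Sum>y\<in>L'. h y * (\<Sum>t\<in>L'. N' y t u * B.fp t))"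
      by (simp add: G_def sum_distrib_left sum_distrib_right mult.assoc) (rule sum.swap)
    also have "\<dots> = (\<Sum>y\<in>L'. h y * B.fp y) * B.fp u"
      by (simp add: B.fp_regular u sum_distrib_right mult.assoc)
    also have "(\<Sum>y\<in>L'. h y * B.fp y) = (\<Sum>x\<in>L. \<Sum>y\<in>L'. n y x * B.fp y)"
      unfolding h_def sum_distrib_right by (rule sum.swap)
    also have "\<dots> = g" unfolding g_def by (intro sum.cong refl fp_image)
    finally show ?thesis .
  qed
  have Gw: "(\<Sum>t\<in>L'. G u t * w t) = g * w u" if u: "u \<in> L'" for u
  proof -
    have "(\<Sum>t\<in>L'. G u t * w t) = (\<Sum>t\<in>L'. \<Sum>y\<in>L'. \<Sum>x\<in>L. \<Sum>x'\<in>L. n y x * n t x' * N' y t u * A.fp x')"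
      unfolding G_def h_def sum_distrib_right
      by (simp add: w_def sum_distrib_left mult_ac)
    also have "\<dots> = (\<Sum>y\<in>L'. \<Sum>t\<in>L'. \<Sum>x\<in>L. \<Sum>x'\<in>L. n y x * n t x' * N' y t u * A.fp x')"
      by (rule sum.swap)
    also have "\<dots> = (\<Sum>y\<in>L'. \<Sum>x\<in>L. \<Sum>t\<in>L'. \<Sum>x'\<in>L. n y x * n t x' * N' y t u * A.fp x')"
      by (intro sum.cong refl sum.swap)
    also have "\<dots> = (\<Sum>y\<in>L'. \<Sum>x\<in>L. \<Sum>x'\<in>L. \<Sum>t\<in>L'. n y x * n t x' * N' y t u * A.fp x')"
      by (intro sum.cong refl sum.swap)
    also have "\<dots> = (\<Sum>x\<in>L. \<Sum>y\<in>L'. \<Sum>x'\<in>L. \<Sum>t\<in>L'. n y x * n t x' * N' y t u * A.fp x')"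
      by (rule sum.swap)
    also have "\<dots> = (\<Sum>x\<in>L. \<Sum>x'\<in>L. \<Sum>y\<in>L'. \<Sum>t\<in>L'. n y x * n t x' * N' y t u * A.fp x')"
      by (intro sum.cong refl sum.swap)
    also have "\<dots> = (\<Sum>x\<in>L. \<Sum>x'\<in>L. (\<Sum>z\<in>L. N x x' z * n u z) * A.fp x')"
      by (simp add: n_mult u sum_distrib_right)
    also have "\<dots> = (\<Sum>x\<in>L. \<Sum>z\<in>L. \<Sum>x'\<in>L. n u z * (N x x' z * A.fp x'))"
      by (rule sum.cong[OF refl], subst sum.swap)
        (simp add: sum_distrib_left sum_distrib_right algebra_simps)
    also have "\<dots> = (\<Sum>x\<in>L. \<Sum>z\<in>L. n u z * (A.fp x * A.fp z))"
      by (intro sum.cong refl) (simp add: A.fp_regular flip: sum_distrib_left)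
    also have "\<dots> = g * w u"
      unfolding g_def w_def sum_product by (intro sum.cong refl) simp
    finally show ?thesis .
  qed
  obtain c where c: "\<And>u. u \<in> L' \<Longrightarrow> w u = c * B.fp u"
    using positive_matrix_eigenvector_unique[of L' G B.fp g w, OF B.finite_L B.L_nonempty]
      Gpos B.fp_pos Gfp Gw by blast
  \<comment> \<open>The scalar is found by taking dimensions.\<close>
  have "A.total = (\<Sum>x\<in>L. A.fp x * (\<Sum>y\<in>L'. n y x * B.fp y))"
    unfolding A.total_def by (intro sum.cong refl) (simp add: fp_image power2_eq_square)
  also have "\<dots> = (\<Sum>y\<in>L'. w y * B.fp y)"
    by (simp add: w_def sum_distrib_left sum_distrib_right algebra_simps) (rule sum.swap)
  also have "\<dots> = c * B.total"
    by (simp add: c B.total_def sum_distrib_left power2_eq_square mult.assoc)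
  finally have "c = A.total / B.total" using B.total_pos by simp
  then show ?thesis using c[OF y] by (simp add: w_def)
qed

end

section \<open>Dimensions of vector spaces\<close>

lemma module_hom_finsum:
  assumes "Module.module K V" "Module.module K W" "T \<in> module_hom K V W"
    and "finite I" "f \<in> I \<rightarrow> carrier V"
  shows "T (finsum V f I) = finsum W (\<lambda>i. T (f i)) I"
proof -
  interpret T: mod_hom K V W T using assms(1-3) by (simp add: mod_hom_def mod_hom_axioms_def)
  show ?thesis
    using assms(4,5)
  proof (induction I rule: finite_induct)
    case (insert i I)
    then have "f i \<in> carrier V" "f \<in> I \<rightarrow> carrier V" by auto
    moreover then have "(\<lambda>i. T (f i)) \<in> I \<rightarrow> carrier W" by auto
    ultimately show ?case using insert by simp
  qed simp
qed

lemma module_hom_zero: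
  assumes "Module.module K V" "Module.module K W" "T \<in> module_hom K V W"
  shows "T \<zero>\<^bsub>V\<^esub> = \<zero>\<^bsub>W\<^esub>"
proof -
  interpret T: mod_hom K V W T using assms by (simp add: mod_hom_def mod_hom_axioms_def)
  show ?thesis by (rule T.f0_is_0)
qed

lemma module_hom_injI:
  assumes "Module.module K V" "Module.module K W" "T \<in> module_hom K V W"
    and ker: "\<And>v. \<lbrakk>v \<in> carrier V; T v = \<zero>\<^bsub>W\<^esub>\<rbrakk> \<Longrightarrow> v = \<zero>\<^bsub>V\<^esub>"
  shows "inj_on T (carrier V)"
proof (rule inj_onI)
  interpret V: Module.module K V by (rule assms(1))
  interpret W: Module.module K W by (rule assms(2))
  interpret T: mod_hom K V W T using assms(1-3) by (simp add: mod_hom_def mod_hom_axioms_def)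
  fix x y assume x: "x \<in> carrier V" and y: "y \<in> carrier V" and "T x = T y"
  then have "T (x \<ominus>\<^bsub>V\<^esub> y) = \<zero>\<^bsub>W\<^esub>" using W.r_neg[of "T y"] by (simp add: a_minus_def)
  then have "x \<ominus>\<^bsub>V\<^esub> y = \<zero>\<^bsub>V\<^esub>" using V.minus_closed[OF x y] by (intro ker)
  then have "x \<oplus>\<^bsub>V\<^esub> \<ominus>\<^bsub>V\<^esub> y = \<zero>\<^bsub>V\<^esub>" by (simp add: a_minus_def)
  then have "\<ominus>\<^bsub>V\<^esub> (\<ominus>\<^bsub>V\<^esub> y) = x" using x y by (intro V.minus_equality V.a_inv_closed) auto
  then show "x = y" using V.minus_minus[OF y] by simp
qed

context
  fixes K :: "'k ring" and V :: "('k, 'v) module"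
  assumes vs: "vectorspace K V"
begin

interpretation vectorspace K V by (rule vs)

text \<open>Bases described by unique coordinates are the independent generating sets, whose
  cardinality is known to be the dimension.\<close>

lemma is_basis_iff: "is_basis K V B \<longleftrightarrow> finite B \<and> B \<subseteq> carrier V \<and> basis B"
proof (cases "finite B \<and> B \<subseteq> carrier V")
  case True
  have "(v = (\<Oplus>\<^bsub>V\<^esub>b\<in>B. c b \<odot>\<^bsub>V\<^esub> b)) = (lincomb c B = v)" for v c
    unfolding lincomb_def by (rule eq_commute)
  then show ?thesis using True basis_criterion[of B] by (simp add: is_basis_def Ball_def)
qed (auto simp: is_basis_def)

lemma vdim_is_basis: assumes "is_basis K V B" shows "vdim K V = card B"
proof -
  have *: "dim = card B" if "is_basis K V B" for B
    using that unfolding is_basis_iff by (intro dim_basis) auto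
  have "is_basis K V (SOME B. is_basis K V B)" using assms by (rule someI)
  from *[OF this] *[OF assms] show ?thesis by (simp add: vdim_def)
qed

lemma finite_dim_imp: assumes "finite_dim K V" shows "fin_dim" and "vdim K V = dim"
proof -
  obtain B where B: "is_basis K V B" using assms by (auto simp: finite_dim_def)
  then have B': "finite B" "B \<subseteq> carrier V" "basis B" by (simp_all add: is_basis_iff)
  show "vdim K V = dim" using vdim_is_basis[OF B] dim_basis[OF B'(1,3)] by simp
  have "gen_set B" using B'(3) by (simp add: basis_def)
  then show "fin_dim" unfolding fin_dim_def using B'(1,2) by (intro exI[of _ B]) simp
qed

lemma vdim_zero_imp: assumes fd: "finite_dim K V" and "vdim K V = 0" and v: "v \<in> carrier V"
  shows "v = \<zero>\<^bsub>V\<^esub>"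
proof -
  obtain B where B: "is_basis K V B" using fd by (auto simp: finite_dim_def)
  then have "B = {}" using vdim_is_basis assms(2) by (auto simp: is_basis_def)
  then show ?thesis using B v by (auto simp: is_basis_def)
qed

lemma vdim_zeroI: assumes "carrier V = {\<zero>\<^bsub>V\<^esub>}" shows "vdim K V = 0"
proof -
  have "is_basis K V {}" using assms by (auto simp: is_basis_def)
  from vdim_is_basis[OF this] show ?thesis by simp
qed

lemma vdim_oneI:
  assumes fd: "finite_dim K V" and v: "v \<in> carrier V" "v \<noteq> \<zero>\<^bsub>V\<^esub>"
    and span: "\<And>w. w \<in> carrier V \<Longrightarrow> \<exists>a\<in>carrier K. w = a \<odot>\<^bsub>V\<^esub> v"
  shows "vdim K V = 1"
proof -
  have "w \<in> span {v}" if w: "w \<in> carrier V" for w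
  proof -
    obtain a where a: "a \<in> carrier K" "w = a \<odot>\<^bsub>V\<^esub> v" using span[OF w] by blast
    have "lincomb (\<lambda>_. a) {v} = w" using a v(1) by (simp add: lincomb_def)
    moreover have "(\<lambda>_. a) \<in> {v} \<rightarrow> carrier K" using a(1) by simp
    ultimately show ?thesis unfolding span_def by blast
  qed
  moreover have "span {v} \<subseteq> carrier V" using v(1) by (intro span_is_subset2) simp
  ultimately have "gen_set {v}" by blast
  then have "dim = 1" using v(2,1) by (rule dim1I)
  then show ?thesis using finite_dim_imp(2)[OF fd] by simp
qed

end

lemma vdim_le_of_injective:
  fixes K :: "'k ring" and V :: "('k, 'v) module" and W :: "('k, 'w) module"
  assumes V: "vectorspace K V" "finite_dim K V" and W: "vectorspace K W" "finite_dim K W"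
    and T: "T \<in> module_hom K V W" and inj: "inj_on T (carrier V)"
  shows "vdim K V \<le> vdim K W"
proof -
  interpret V: vectorspace K V by (rule V(1))
  interpret W: vectorspace K W by (rule W(1))
  interpret T: linear_map K V W T
    using T V.module_axioms W.module_axioms V(1) W(1)
    by (intro linear_map.intro mod_hom.intro mod_hom_axioms.intro)
  obtain B where B: "is_basis K V B" using V(2) by (auto simp: finite_dim_def)
  then have B': "finite B" "B \<subseteq> carrier V" "V.basis B" by (auto simp: is_basis_iff[OF V(1)])
  have inj_B: "inj_on T B" using inj B'(2) by (rule inj_on_subset)
  have TB: "T ` B \<subseteq> carrier W" using B'(2) by auto
  have "W.lin_indpt (T ` B)"
  proof (rule W.finite_lin_indpt2)
    show "finite (T ` B)" "T ` B \<subseteq> carrier W" using B' by auto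
    fix a assume a: "a \<in> T ` B \<rightarrow> carrier K" and "W.lincomb a (T ` B) = \<zero>\<^bsub>W\<^esub>"
    then have "T (V.lincomb (a \<circ> T) B) = T \<zero>\<^bsub>V\<^esub>"
      using T.lincomb_linear_image[OF inj B'(2) a B'(1)] by simp
    moreover have aT: "a \<circ> T \<in> B \<rightarrow> carrier K" using a by auto
    ultimately have "V.lincomb (a \<circ> T) B = \<zero>\<^bsub>V\<^esub>"
      using inj B'(2) V.lincomb_closed by (meson V.M.zero_closed inj_onD)
    then have "a \<circ> T \<in> B \<rightarrow> {\<zero>\<^bsub>K\<^esub>}"
      using V.not_lindepD[OF _ B'(1) order_refl aT] B'(3) by (simp add: V.basis_def)
    then show "\<forall>v\<in>T ` B. a v = \<zero>\<^bsub>K\<^esub>" by auto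
  qed
  then have "card (T ` B) \<le> W.dim"
    by (rule W.li_le_dim(2)[OF finite_dim_imp(1)[OF W] TB])
  then show ?thesis
    using vdim_is_basis[OF V(1) B] finite_dim_imp(2)[OF W] card_image[OF inj_B] by simp
qed

text \<open>The images under the injections \<open>\<iota> i\<close> of bases of the summands form a basis:
  coordinates exist since the vectors \<open>\<iota> i (\<pi> i v)\<close> sum to \<open>v\<close>, and they are unique since the
  projections \<open>\<pi> i\<close> recover the blocks.\<close>

lemma vdim_direct_sum:
  fixes n :: nat and K :: "'k ring" and V :: "('k, 'v) module" and W :: "nat \<Rightarrow> ('k, 'w) module"
  assumes V: "vectorspace K V" and W: "\<And>i. i < n \<Longrightarrow> vectorspace K (W i)"
    and fd: "\<And>i. i < n \<Longrightarrow> finite_dim K (W i)"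
    and \<iota>: "\<And>i. i < n \<Longrightarrow> \<iota> i \<in> module_hom K (W i) V"
    and \<pi>: "\<And>i. i < n \<Longrightarrow> \<pi> i \<in> module_hom K V (W i)"
    and \<pi>\<iota>: "\<And>i j x. \<lbrakk>i < n; j < n; x \<in> carrier (W i)\<rbrakk>
          \<Longrightarrow> \<pi> j (\<iota> i x) = (if i = j then x else \<zero>\<^bsub>W j\<^esub>)"
    and sum: "\<And>v. v \<in> carrier V \<Longrightarrow> v = (\<Oplus>\<^bsub>V\<^esub>i\<in>{..<n}. \<iota> i (\<pi> i v))"
  shows "vdim K V = (\<Sum>i<n. vdim K (W i))"
proof -
  interpret V: vectorspace K V by (rule V)
  have mV: "Module.module K V" by (rule V.module_axioms)
  have mW: "Module.module K (W i)" if "i < n" for i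
    using W[OF that] by (simp add: vectorspace_def)
  obtain B where B: "\<And>i. i < n \<Longrightarrow> is_basis K (W i) (B i)"
    using fd unfolding finite_dim_def by metis
  have Bfin: "finite (B i)" and BW: "B i \<subseteq> carrier (W i)"
    and Bex: "\<And>w. w \<in> carrier (W i) \<Longrightarrow>
      \<exists>!c. c \<in> B i \<rightarrow>\<^sub>E carrier K \<and> w = (\<Oplus>\<^bsub>W i\<^esub>b\<in>B i. c b \<odot>\<^bsub>W i\<^esub> b)" if "i < n" for i
    using B[OF that] by (auto simp: is_basis_def)
  have \<iota>V: "\<iota> i x \<in> carrier V" if "i < n" "x \<in> carrier (W i)" for i x
    using module_hom_closed[OF \<iota>[OF that(1)]] that by auto
  have \<pi>W: "\<pi> i x \<in> carrier (W i)" if "i < n" "x \<in> carrier V" for i x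
    using module_hom_closed[OF \<pi>[OF that(1)]] that by auto
  have nz: "x \<noteq> \<zero>\<^bsub>W i\<^esub>" if "i < n" "x \<in> B i" for i x
  proof -
    interpret Wi: vectorspace K "W i" by (rule W[OF that(1)])
    have "Wi.lin_indpt (B i)" using B[OF that(1)] by (simp add: is_basis_iff[OF W[OF that(1)]] Wi.basis_def)
    then show ?thesis using Wi.vs_zero_lin_dep[OF BW[OF that(1)]] that(2) by auto
  qed
  define A where "A i = \<iota> i ` B i" for i
  have inj: "inj_on (\<iota> i) (B i)" if "i < n" for i
    by (rule inj_on_inverseI[of _ "\<pi> i"]) (use \<pi>\<iota> that BW[OF that] in auto)
  have disj: "i = j" if i: "i < n" and j: "j < n" and x: "x \<in> A i" "x \<in> A j" for i j x
  proof (rule ccontr)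
    assume ne: "i \<noteq> j"
    obtain b b' where b: "b \<in> B i" "x = \<iota> i b" and b': "b' \<in> B j" "x = \<iota> j b'"
      using x by (auto simp: A_def)
    have "b = \<pi> i x" using \<pi>\<iota>[OF i i] b BW[OF i] by auto
    also have "\<dots> = \<zero>\<^bsub>W i\<^esub>" using \<pi>\<iota>[OF j i] b' BW[OF j] ne by auto
    finally show False using nz[OF i b(1)] by simp
  qed
  define U where "U = (\<Union>i\<in>{..<n}. A i)"
  have UV: "U \<subseteq> carrier V" using BW \<iota>V by (auto simp: U_def A_def)
  have finU: "finite U" using Bfin by (auto simp: U_def A_def)
  \<comment> \<open>A linear combination over the union is the sum of its blocks.\<close>
  have comb: "(\<Oplus>\<^bsub>V\<^esub>x\<in>U. c x \<odot>\<^bsub>V\<^esub> x)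
      = (\<Oplus>\<^bsub>V\<^esub>i\<in>{..<n}. \<iota> i (\<Oplus>\<^bsub>W i\<^esub>b\<in>B i. c (\<iota> i b) \<odot>\<^bsub>W i\<^esub> b))"
    if c: "c \<in> U \<rightarrow> carrier K" for c
  proof -
    have cA: "c x \<odot>\<^bsub>V\<^esub> x \<in> carrier V" if "i < n" "x \<in> A i" for i x
      using c that UV by (auto simp: U_def)
    have "(\<Oplus>\<^bsub>V\<^esub>x\<in>U. c x \<odot>\<^bsub>V\<^esub> x) = (\<Oplus>\<^bsub>V\<^esub>i\<in>{..<n}. \<Oplus>\<^bsub>V\<^esub>x\<in>A i. c x \<odot>\<^bsub>V\<^esub> x)"
      unfolding U_def
    proof (rule V.add.finprod_UN_disjoint)
      show "pairwise (\<lambda>i j. disjnt (A i) (A j)) {..<n}"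
        using disj by (auto simp: pairwise_def disjnt_def)
    qed (use cA Bfin in \<open>auto simp: A_def\<close>)
    also have "\<dots> = (\<Oplus>\<^bsub>V\<^esub>i\<in>{..<n}. \<iota> i (\<Oplus>\<^bsub>W i\<^esub>b\<in>B i. c (\<iota> i b) \<odot>\<^bsub>W i\<^esub> b))"
    proof (rule V.finsum_cong')
      fix i assume "i \<in> {..<n}"
      then have i: "i < n" by simp
      interpret Wi: Module.module K "W i" by (rule mW[OF i])
      have cK: "c (\<iota> i b) \<in> carrier K" if "b \<in> B i" for b using c that i by (auto simp: U_def A_def)
      have bW: "b \<in> carrier (W i)" if "b \<in> B i" for b using BW[OF i] that by auto
      have "(\<Oplus>\<^bsub>V\<^esub>x\<in>A i. c x \<odot>\<^bsub>V\<^esub> x) = (\<Oplus>\<^bsub>V\<^esub>b\<in>B i. c (\<iota> i b) \<odot>\<^bsub>V\<^esub> \<iota> i b)"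
        unfolding A_def using cA[OF i] inj[OF i] by (intro V.finsum_reindex) (auto simp: A_def)
      also have "\<dots> = (\<Oplus>\<^bsub>V\<^esub>b\<in>B i. \<iota> i (c (\<iota> i b) \<odot>\<^bsub>W i\<^esub> b))"
        by (rule V.finsum_cong') (auto simp: module_hom_smult[OF \<iota>[OF i]] cK bW intro!: \<iota>V[OF i])
      also have "\<dots> = \<iota> i (\<Oplus>\<^bsub>W i\<^esub>b\<in>B i. c (\<iota> i b) \<odot>\<^bsub>W i\<^esub> b)"
        by (rule module_hom_finsum[OF mW[OF i] mV \<iota>[OF i] Bfin[OF i], symmetric])
          (auto simp: cK bW)
      finally show "(\<Oplus>\<^bsub>V\<^esub>x\<in>A i. c x \<odot>\<^bsub>V\<^esub> x) = \<iota> i (\<Oplus>\<^bsub>W i\<^esub>b\<in>B i. c (\<iota> i b) \<odot>\<^bsub>W i\<^esub> b)" .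
    next
      show "(\<lambda>i. \<iota> i (\<Oplus>\<^bsub>W i\<^esub>b\<in>B i. c (\<iota> i b) \<odot>\<^bsub>W i\<^esub> b)) \<in> {..<n} \<rightarrow> carrier V"
      proof (rule funcsetI)
        fix i assume "i \<in> {..<n}"
        then have i: "i < n" by simp
        interpret Wi: Module.module K "W i" by (rule mW[OF i])
        show "\<iota> i (\<Oplus>\<^bsub>W i\<^esub>b\<in>B i. c (\<iota> i b) \<odot>\<^bsub>W i\<^esub> b) \<in> carrier V"
          using c i BW[OF i] by (intro \<iota>V[OF i] Wi.finsum_closed) (auto simp: U_def A_def)
      qed
    qed simp
    finally show ?thesis .
  qed
  have proj: "\<pi> j (\<Oplus>\<^bsub>V\<^esub>i\<in>{..<n}. \<iota> i (w i)) = w j"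
    if j: "j < n" and w: "\<And>i. i < n \<Longrightarrow> w i \<in> carrier (W i)" for j w
  proof -
    interpret Wj: Module.module K "W j" by (rule mW[OF j])
    have "\<pi> j (\<Oplus>\<^bsub>V\<^esub>i\<in>{..<n}. \<iota> i (w i)) = (\<Oplus>\<^bsub>W j\<^esub>i\<in>{..<n}. \<pi> j (\<iota> i (w i)))"
      by (rule module_hom_finsum[OF mV mW[OF j] \<pi>[OF j]]) (auto intro: \<iota>V w)
    also have "\<dots> = (\<Oplus>\<^bsub>W j\<^esub>i\<in>{..<n}. if j = i then w j else \<zero>\<^bsub>W j\<^esub>)"
      by (rule Wj.finsum_cong') (auto simp: \<pi>\<iota> j w)
    also have "\<dots> = w j"
      using j w by (intro Wj.finsum_singleton[of j "{..<n}" "\<lambda>_. w j"]) auto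
    finally show ?thesis .
  qed
  have "is_basis K V U" unfolding is_basis_def
  proof (intro conjI ballI)
    fix v assume v: "v \<in> carrier V"
    define c where "c i = (THE c. c \<in> B i \<rightarrow>\<^sub>E carrier K \<and> \<pi> i v = (\<Oplus>\<^bsub>W i\<^esub>b\<in>B i. c b \<odot>\<^bsub>W i\<^esub> b))" for i
    have c: "c i \<in> B i \<rightarrow>\<^sub>E carrier K" "\<pi> i v = (\<Oplus>\<^bsub>W i\<^esub>b\<in>B i. c i b \<odot>\<^bsub>W i\<^esub> b)"
      if "i < n" for i
      using theI'[OF Bex[OF that \<pi>W[OF that v]]] unfolding c_def by (rule conjunct1, rule conjunct2)
    define ix where "ix x = (THE i. i < n \<and> x \<in> A i)" for x
    have ix: "ix x = i" if i: "i < n" and x: "x \<in> A i" for i x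
      unfolding ix_def
    proof (rule the_equality)
      fix j assume "j < n \<and> x \<in> A j"
      then show "j = i" using disj[of j i x] i x by simp
    qed (simp add: i x)
    define C where "C = (\<lambda>x\<in>U. c (ix x) (\<pi> (ix x) x))"
    have C\<iota>: "C (\<iota> i b) = c i b" if i: "i < n" and b: "b \<in> B i" for i b
    proof -
      have x: "\<iota> i b \<in> A i" "\<iota> i b \<in> U" using i b by (auto simp: A_def U_def)
      have "\<pi> i (\<iota> i b) = b" using \<pi>\<iota>[of i i b] i b BW[OF i] by auto
      then show ?thesis using x ix[OF i x(1)] by (simp add: C_def)
    qed
    have CK: "C x \<in> carrier K" if x: "x \<in> U" for x
    proof -
      obtain i b where "i < n" "b \<in> B i" "x = \<iota> i b" using x by (auto simp: U_def A_def)
      then show ?thesis using C\<iota> c(1)[of i] by auto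
    qed
    show "\<exists>!c. c \<in> U \<rightarrow>\<^sub>E carrier K \<and> v = (\<Oplus>\<^bsub>V\<^esub>x\<in>U. c x \<odot>\<^bsub>V\<^esub> x)"
    proof (rule ex1I[of _ C])
      have "C \<in> extensional U" by (simp add: C_def)
      then have Cfun: "C \<in> U \<rightarrow>\<^sub>E carrier K" using CK by (simp add: PiE_def)
      have "v = (\<Oplus>\<^bsub>V\<^esub>i\<in>{..<n}. \<iota> i (\<pi> i v))" by (rule sum[OF v])
      also have "\<dots> = (\<Oplus>\<^bsub>V\<^esub>i\<in>{..<n}. \<iota> i (\<Oplus>\<^bsub>W i\<^esub>b\<in>B i. C (\<iota> i b) \<odot>\<^bsub>W i\<^esub> b))"
      proof (rule V.finsum_cong'[OF refl])
        show eq: "\<iota> i (\<pi> i v) = \<iota> i (\<Oplus>\<^bsub>W i\<^esub>b\<in>B i. C (\<iota> i b) \<odot>\<^bsub>W i\<^esub> b)" if "i \<in> {..<n}" for i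
        proof -
          from that have i: "i < n" by simp
          interpret Wi: Module.module K "W i" by (rule mW[OF i])
          have "(\<Oplus>\<^bsub>W i\<^esub>b\<in>B i. c i b \<odot>\<^bsub>W i\<^esub> b) = (\<Oplus>\<^bsub>W i\<^esub>b\<in>B i. C (\<iota> i b) \<odot>\<^bsub>W i\<^esub> b)"
            using c(1)[OF i] BW[OF i] by (intro Wi.finsum_cong') (auto simp: C\<iota> i PiE_iff)
          then show ?thesis using c(2)[OF i] by simp
        qed
        show "(\<lambda>i. \<iota> i (\<Oplus>\<^bsub>W i\<^esub>b\<in>B i. C (\<iota> i b) \<odot>\<^bsub>W i\<^esub> b)) \<in> {..<n} \<rightarrow> carrier V"
        proof (rule funcsetI)
          fix i assume i: "i \<in> {..<n}"
          then have "\<iota> i (\<pi> i v) \<in> carrier V" using \<iota>V \<pi>W v by simp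
          then show "\<iota> i (\<Oplus>\<^bsub>W i\<^esub>b\<in>B i. C (\<iota> i b) \<odot>\<^bsub>W i\<^esub> b) \<in> carrier V"
            by (simp only: eq[OF i])
        qed
      qed
      also have "\<dots> = (\<Oplus>\<^bsub>V\<^esub>x\<in>U. C x \<odot>\<^bsub>V\<^esub> x)" by (rule comb[of C, symmetric]) (use CK in auto)
      finally show "C \<in> U \<rightarrow>\<^sub>E carrier K \<and> v = (\<Oplus>\<^bsub>V\<^esub>x\<in>U. C x \<odot>\<^bsub>V\<^esub> x)" using Cfun by blast
      fix D assume D: "D \<in> U \<rightarrow>\<^sub>E carrier K \<and> v = (\<Oplus>\<^bsub>V\<^esub>x\<in>U. D x \<odot>\<^bsub>V\<^esub> x)"
      then have D1: "D \<in> U \<rightarrow>\<^sub>E carrier K" and D2: "v = (\<Oplus>\<^bsub>V\<^esub>x\<in>U. D x \<odot>\<^bsub>V\<^esub> x)"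
        by (rule conjunct1, rule conjunct2)
      have D3: "D \<in> U \<rightarrow> carrier K" using D1 by (simp add: PiE_def)
      have "D (\<iota> j b) = c j b" if j: "j < n" and b: "b \<in> B j" for j b
      proof -
        define w where "w i = (\<Oplus>\<^bsub>W i\<^esub>b\<in>B i. D (\<iota> i b) \<odot>\<^bsub>W i\<^esub> b)" for i
        have DK: "D (\<iota> i b) \<in> carrier K" if "i < n" "b \<in> B i" for i b
          by (rule funcset_mem[OF D3]) (use that in \<open>auto simp: U_def A_def\<close>)
        have w: "w i \<in> carrier (W i)" if i: "i < n" for i
        proof -
          interpret Wi: Module.module K "W i" by (rule mW[OF i])
          show ?thesis unfolding w_def
            using BW[OF i] DK[OF i] by (intro Wi.finsum_closed) auto
        qed
        have "v = (\<Oplus>\<^bsub>V\<^esub>i\<in>{..<n}. \<iota> i (w i))"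
          unfolding w_def using D2 comb[of D, OF D3] by (rule trans)
        then have "\<pi> j v = w j" using proj[OF j w] by simp
        also have "w j = (\<Oplus>\<^bsub>W j\<^esub>b\<in>B j. (\<lambda>b\<in>B j. D (\<iota> j b)) b \<odot>\<^bsub>W j\<^esub> b)"
        proof -
          interpret Wj: Module.module K "W j" by (rule mW[OF j])
          show ?thesis unfolding w_def using BW[OF j] DK[OF j] by (intro Wj.finsum_cong') auto
        qed
        finally have "\<pi> j v = (\<Oplus>\<^bsub>W j\<^esub>b\<in>B j. (\<lambda>b\<in>B j. D (\<iota> j b)) b \<odot>\<^bsub>W j\<^esub> b)" .
        moreover have "(\<lambda>b\<in>B j. D (\<iota> j b)) \<in> B j \<rightarrow>\<^sub>E carrier K" using DK[OF j] by auto
        ultimately have "c j = (\<lambda>b\<in>B j. D (\<iota> j b))"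
          unfolding c_def by (intro the1_equality[OF Bex[OF j \<pi>W[OF j v]]] conjI)
        then show ?thesis using b by simp
      qed
      then have DC: "D x = C x" if "x \<in> U" for x
        using that C\<iota> by (auto simp: U_def A_def)
      show "D = C" by (rule PiE_ext[OF D1 Cfun DC])
    qed
  qed (use UV finU in auto)
  then have "vdim K V = card U" by (rule vdim_is_basis[OF V])
  also have "\<dots> = (\<Sum>i<n. card (A i))" unfolding U_def
  proof (rule card_UN_disjoint)
    show "\<forall>i\<in>{..<n}. \<forall>j\<in>{..<n}. i \<noteq> j \<longrightarrow> A i \<inter> A j = {}" using disj by blast
  qed (use Bfin in \<open>auto simp: A_def\<close>)
  also have "\<dots> = (\<Sum>i<n. vdim K (W i))"
  proof (rule sum.cong[OF refl])
    fix i assume "i \<in> {..<n}"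
    then have i: "i < n" by simp
    interpret Wi: vectorspace K "W i" by (rule W[OF i])
    show "card (A i) = vdim K (W i)"
      using card_image[OF inj[OF i]] vdim_is_basis[OF W[OF i] B[OF i]] by (simp add: A_def)
  qed
  finally show ?thesis .
qed

section \<open>Linear and abelian categories\<close>

context category begin

lemma HomI: "\<lbrakk>f \<in> Arr C; Src C f = X; Trg C f = Y\<rbrakk> \<Longrightarrow> f \<in> Hom C X Y"
  by (simp add: Hom_def)

lemma in_Hom: assumes "f \<in> Hom C X Y"
  shows "f \<in> Arr C" "Src C f = X" "Trg C f = Y" "X \<in> Obj C" "Y \<in> Obj C"
  using assms src_closed trg_closed by (auto simp: Hom_def)

lemma comp_arr:
  assumes "f \<in> Arr C" "g \<in> Arr C" "Src C g = Trg C f"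
  shows "g \<cdot> f \<in> Arr C" "Src C (g \<cdot> f) = Src C f" "Trg C (g \<cdot> f) = Trg C g"
  using comp_hom[of f "Src C f" "Src C g" g "Trg C g"] assms by (auto simp: Hom_def)

text \<open>With side conditions on sources and targets instead of hom sets, rewriting can
  rebracket composites by itself.\<close>

lemma comp_assoc_arr:
  assumes "f \<in> Arr C" "g \<in> Arr C" "h \<in> Arr C" "Src C g = Trg C f" "Src C h = Trg C g"
  shows "(h \<cdot> g) \<cdot> f = h \<cdot> g \<cdot> f"
  using comp_assoc[of f "Src C f" "Src C g" g "Trg C g" h "Trg C h"] assms by (auto simp: Hom_def)

lemma ident_arr: assumes "X \<in> Obj C"
  shows "Ident C X \<in> Arr C" "Src C (Ident C X) = X" "Trg C (Ident C X) = X"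
  using ident_hom[OF assms] by (auto simp: Hom_def)

lemma comp_ident_arr: assumes "f \<in> Arr C"
  shows "f \<cdot> Ident C (Src C f) = f" "Ident C (Trg C f) \<cdot> f = f"
  using comp_ident_right[of f "Src C f" "Trg C f"] comp_ident_left[of f "Src C f" "Trg C f"] assms
  by (auto simp: Hom_def)

lemma iso_arrI:
  assumes "f \<in> Hom C X Y" "g \<in> Hom C Y X" "g \<cdot> f = Ident C X" "f \<cdot> g = Ident C Y"
  shows "iso_arr C f"
  unfolding iso_arr_def inverse_arrs_def using assms in_Hom[OF assms(1)] by auto

lemma iso_arrE:
  assumes "iso_arr C f" "f \<in> Hom C X Y"
  obtains g where "g \<in> Hom C Y X" "g \<cdot> f = Ident C X" "f \<cdot> g = Ident C Y"
  using assms in_Hom[OF assms(2)] unfolding iso_arr_def inverse_arrs_def by auto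

lemma inv_arr:
  assumes "iso_arr C f" "f \<in> Hom C X Y"
  shows "inv_arr C f \<in> Hom C Y X" "inv_arr C f \<cdot> f = Ident C X" "f \<cdot> inv_arr C f = Ident C Y"
proof -
  obtain g where g: "g \<in> Hom C Y X" "g \<cdot> f = Ident C X" "f \<cdot> g = Ident C Y"
    using iso_arrE[OF assms] by blast
  have "inv_arr C f = g" unfolding inv_arr_def
  proof (rule the_equality)
    show "inverse_arrs C f g" using g in_Hom[OF assms(2)] by (simp add: inverse_arrs_def)
    fix h assume "inverse_arrs C f h"
    then have h: "h \<in> Hom C Y X" "h \<cdot> f = Ident C X"
      using in_Hom[OF assms(2)] by (auto simp: inverse_arrs_def)
    have "h = h \<cdot> f \<cdot> g" using g(3) comp_ident_right[OF h(1)] by simp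
    also have "\<dots> = (h \<cdot> f) \<cdot> g" using comp_assoc[OF g(1) assms(2) h(1)] by simp
    also have "\<dots> = g" using h(2) comp_ident_left[OF g(1)] by simp
    finally show "h = g" .
  qed
  then show "inv_arr C f \<in> Hom C Y X" "inv_arr C f \<cdot> f = Ident C X" "f \<cdot> inv_arr C f = Ident C Y"
    using g by auto
qed

lemma iso_inv_arr: assumes "iso_arr C f" "f \<in> Hom C X Y" shows "iso_arr C (inv_arr C f)"
  by (rule iso_arrI[OF inv_arr(1)[OF assms] assms(2) inv_arr(3)[OF assms] inv_arr(2)[OF assms]])

lemma iso_ident: "X \<in> Obj C \<Longrightarrow> iso_arr C (Ident C X)"
  by (rule iso_arrI[of _ X X "Ident C X"]) (auto intro: ident_hom comp_ident_left)

lemma iso_comp: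
  assumes "iso_arr C f" "f \<in> Hom C X Y" "iso_arr C g" "g \<in> Hom C Y Z"
  shows "iso_arr C (g \<cdot> f)"
proof -
  obtain f' where f': "f' \<in> Hom C Y X" "f' \<cdot> f = Ident C X" "f \<cdot> f' = Ident C Y"
    using iso_arrE[OF assms(1,2)] by blast
  obtain g' where g': "g' \<in> Hom C Z Y" "g' \<cdot> g = Ident C Y" "g \<cdot> g' = Ident C Z"
    using iso_arrE[OF assms(3,4)] by blast
  note arrs = in_Hom[OF assms(2)] in_Hom[OF assms(4)] in_Hom[OF f'(1)] in_Hom[OF g'(1)]
  have "(f' \<cdot> g') \<cdot> (g \<cdot> f) = f' \<cdot> (g' \<cdot> g) \<cdot> f" by (simp add: comp_assoc_arr comp_arr arrs)
  also have "\<dots> = Ident C X" using f' comp_ident_left[OF assms(2)] g' by simp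
  finally have 1: "(f' \<cdot> g') \<cdot> (g \<cdot> f) = Ident C X" .
  have "(g \<cdot> f) \<cdot> (f' \<cdot> g') = g \<cdot> (f \<cdot> f') \<cdot> g'" by (simp add: comp_assoc_arr comp_arr arrs)
  also have "\<dots> = Ident C Z" using f' comp_ident_left[OF g'(1)] g' by simp
  finally show ?thesis
    using iso_arrI[OF comp_hom[OF assms(2,4)] comp_hom[OF g'(1) f'(1)] 1] by blast
qed

lemma iso_cancel_left:
  assumes "iso_arr C f" "f \<in> Hom C Y Z" "g \<in> Hom C X Y" "h \<in> Hom C X Y" "f \<cdot> g = f \<cdot> h"
  shows "g = h"
proof -
  obtain f' where f': "f' \<in> Hom C Z Y" "f' \<cdot> f = Ident C Y" using iso_arrE[OF assms(1,2)] by blast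
  have "g = (f' \<cdot> f) \<cdot> g" using f' comp_ident_left[OF assms(3)] by simp
  also have "\<dots> = (f' \<cdot> f) \<cdot> h"
    using comp_assoc[OF assms(3,2) f'(1)] comp_assoc[OF assms(4,2) f'(1)] assms(5) by simp
  also have "\<dots> = h" using f' comp_ident_left[OF assms(4)] by simp
  finally show ?thesis .
qed

lemma iso_cancel_right:
  assumes "iso_arr C f" "f \<in> Hom C X Y" "g \<in> Hom C Y Z" "h \<in> Hom C Y Z" "g \<cdot> f = h \<cdot> f"
  shows "g = h"
proof -
  obtain f' where f': "f' \<in> Hom C Y X" "f \<cdot> f' = Ident C Y" using iso_arrE[OF assms(1,2)] by blast
  have "g = g \<cdot> f \<cdot> f'" using f' comp_ident_right[OF assms(3)] by simp
  also have "\<dots> = h \<cdot> f \<cdot> f'"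
    using comp_assoc[OF f'(1) assms(2,3)] comp_assoc[OF f'(1) assms(2,4)] assms(5) by simp
  also have "\<dots> = h" using f' comp_ident_right[OF assms(4)] by simp
  finally show ?thesis .
qed

lemma isomorphicI: "\<lbrakk>f \<in> Hom C X Y; iso_arr C f\<rbrakk> \<Longrightarrow> isomorphic C X Y"
  by (auto simp: isomorphic_def)

lemma isomorphic_obj: assumes "isomorphic C X Y" shows "X \<in> Obj C" "Y \<in> Obj C"
  using assms in_Hom by (auto simp: isomorphic_def)

lemma isomorphic_refl: "X \<in> Obj C \<Longrightarrow> isomorphic C X X"
  using isomorphicI[OF ident_hom iso_ident] .

lemma isomorphic_sym: assumes "isomorphic C X Y" shows "isomorphic C Y X"
proof -
  obtain f where f: "iso_arr C f" "f \<in> Hom C X Y" using assms by (auto simp: isomorphic_def)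
  show ?thesis by (rule isomorphicI[OF inv_arr(1)[OF f] iso_inv_arr[OF f]])
qed

lemma isomorphic_trans:
  assumes "isomorphic C X Y" "isomorphic C Y Z" shows "isomorphic C X Z"
proof -
  obtain f where f: "iso_arr C f" "f \<in> Hom C X Y" using assms by (auto simp: isomorphic_def)
  obtain g where g: "iso_arr C g" "g \<in> Hom C Y Z" using assms by (auto simp: isomorphic_def)
  show ?thesis by (rule isomorphicI[OF comp_hom[OF f(2) g(2)] iso_comp[OF f g]])
qed

lemma iso_class_eq_iff:
  assumes "X \<in> Obj C" "Y \<in> Obj C"
  shows "iso_class C X = iso_class C Y \<longleftrightarrow> isomorphic C X Y"
proof
  assume "iso_class C X = iso_class C Y"
  then show "isomorphic C X Y"
    using isomorphic_refl[OF assms(2)] assms(2) by (auto simp: iso_class_def)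
next
  assume *: "isomorphic C X Y"
  show "iso_class C X = iso_class C Y"
    using isomorphic_trans[OF *] isomorphic_trans[OF isomorphic_sym[OF *]] by (auto simp: iso_class_def)
qed

lemma split_mono:
  assumes "u \<in> Hom C X Y" "r \<in> Hom C Y X" "r \<cdot> u = Ident C X"
  shows "mono_arr C u"
  unfolding mono_arr_def
proof (intro conjI allI ballI impI)
  fix W g h assume gh: "g \<in> Hom C W (Src C u)" "h \<in> Hom C W (Src C u)" "u \<cdot> g = u \<cdot> h"
  then have g: "g \<in> Hom C W X" and h: "h \<in> Hom C W X" using in_Hom[OF assms(1)] by auto
  have "(r \<cdot> u) \<cdot> g = (r \<cdot> u) \<cdot> h"
    using comp_assoc[OF g assms(1,2)] comp_assoc[OF h assms(1,2)] gh(3) by simp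
  then show "g = h" using assms(3) comp_ident_left[OF g] comp_ident_left[OF h] by simp
qed (use in_Hom[OF assms(1)] in simp)

end

context linear_category begin

lemma hom_space_simps [simp]:
  "carrier (hom_space C X Y) = Hom C X Y" "\<zero>\<^bsub>hom_space C X Y\<^esub> = ZeroArr C X Y"
  "(\<oplus>\<^bsub>hom_space C X Y\<^esub>) = PlusArr C" "(\<odot>\<^bsub>hom_space C X Y\<^esub>) = Scale C"
  by (simp_all add: hom_space_def)

lemma hom_vectorspace: "\<lbrakk>X \<in> Obj C; Y \<in> Obj C\<rbrakk> \<Longrightarrow> vectorspace K (hom_space C X Y)"
  by (simp add: vectorspace_def hom_module field_axioms)

lemma hom_group: assumes "X \<in> Obj C" "Y \<in> Obj C" shows "abelian_group (hom_space C X Y)"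
  using hom_module[OF assms] by (simp add: module_def)

lemma zero_hom: assumes "X \<in> Obj C" "Y \<in> Obj C" shows "ZeroArr C X Y \<in> Hom C X Y"
proof -
  interpret H: abelian_group "hom_space C X Y" by (rule hom_group[OF assms])
  show ?thesis using H.zero_closed by simp
qed

lemma scale_one: assumes "f \<in> Hom C X Y" shows "Scale C \<one>\<^bsub>K\<^esub> f = f"
proof -
  interpret H: Module.module K "hom_space C X Y" by (rule hom_module[OF in_Hom(4,5)[OF assms(1)]])
  show ?thesis using H.smult_one[of f] assms by simp
qed

lemma scale_zero: assumes "f \<in> Hom C X Y" shows "Scale C \<zero>\<^bsub>K\<^esub> f = ZeroArr C X Y"
proof -
  interpret H: Module.module K "hom_space C X Y" by (rule hom_module[OF in_Hom(4,5)[OF assms(1)]])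
  show ?thesis using H.smult_l_null[of f] assms by simp
qed

lemma post_comp_module_hom: assumes X: "X \<in> Obj C" and h: "h \<in> Hom C Y Z"
  shows "(\<lambda>f. h \<cdot> f) \<in> module_hom K (hom_space C X Y) (hom_space C X Z)"
  unfolding module_hom_def
  by (auto intro: comp_hom[OF _ h] comp_plus_right[OF _ _ h] comp_scale_right[OF _ _ h])

lemma pre_comp_module_hom: assumes Z: "Z \<in> Obj C" and h: "h \<in> Hom C X Y"
  shows "(\<lambda>f. f \<cdot> h) \<in> module_hom K (hom_space C Y Z) (hom_space C X Z)"
  unfolding module_hom_def
  by (auto intro: comp_hom[OF h] comp_plus_left[OF h] comp_scale_left[OF _ h])

lemma comp_zero_right: assumes "h \<in> Hom C Y Z" "X \<in> Obj C"
  shows "h \<cdot> ZeroArr C X Y = ZeroArr C X Z"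
  using module_hom_zero[OF hom_module hom_module post_comp_module_hom[OF assms(2,1)]]
    in_Hom[OF assms(1)] assms(2) by simp

lemma comp_zero_left: assumes "h \<in> Hom C X Y" "Z \<in> Obj C"
  shows "ZeroArr C Y Z \<cdot> h = ZeroArr C X Z"
  using module_hom_zero[OF hom_module hom_module pre_comp_module_hom[OF assms(2,1)]]
    in_Hom[OF assms(1)] assms(2) by simp

lemma comp_finsum_right:
  assumes h: "h \<in> Hom C Y Z" and X: "X \<in> Obj C" and I: "finite I"
    and f: "\<And>i. i \<in> I \<Longrightarrow> f i \<in> Hom C X Y"
  shows "h \<cdot> finsum (hom_space C X Y) f I = finsum (hom_space C X Z) (\<lambda>i. h \<cdot> f i) I"
  by (rule module_hom_finsum[OF _ _ post_comp_module_hom[OF X h] I])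
    (use X in_Hom[OF h] f in \<open>auto intro: hom_module\<close>)

lemma comp_finsum_left:
  assumes h: "h \<in> Hom C X Y" and Z: "Z \<in> Obj C" and I: "finite I"
    and f: "\<And>i. i \<in> I \<Longrightarrow> f i \<in> Hom C Y Z"
  shows "finsum (hom_space C Y Z) f I \<cdot> h = finsum (hom_space C X Z) (\<lambda>i. f i \<cdot> h) I"
  by (rule module_hom_finsum[OF _ _ pre_comp_module_hom[OF Z h] I])
    (use Z in_Hom[OF h] f in \<open>auto intro: hom_module\<close>)

lemma finsum_hom:
  assumes "X \<in> Obj C" "Y \<in> Obj C" "\<And>i. i \<in> I \<Longrightarrow> f i \<in> Hom C X Y"
  shows "finsum (hom_space C X Y) f I \<in> Hom C X Y"
proof -
  interpret H: abelian_group "hom_space C X Y" by (rule hom_group[OF assms(1,2)])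
  show ?thesis using H.finsum_closed[of f I] assms(3) by simp
qed

lemma finsum_hom_cong:
  assumes "X \<in> Obj C" "Y \<in> Obj C" "\<And>i. i \<in> I \<Longrightarrow> g i \<in> Hom C X Y"
    "\<And>i. i \<in> I \<Longrightarrow> f i = g i"
  shows "finsum (hom_space C X Y) f I = finsum (hom_space C X Y) g I"
proof -
  interpret H: abelian_group "hom_space C X Y" by (rule hom_group[OF assms(1,2)])
  show ?thesis by (rule H.finsum_cong') (use assms in auto)
qed

lemma zero_object_iff: assumes "X \<in> Obj C"
  shows "zero_object C X \<longleftrightarrow> Ident C X = ZeroArr C X X"
proof
  assume "zero_object C X"
  then show "Ident C X = ZeroArr C X X"
    using ident_hom[OF assms] zero_hom[OF assms assms] assms unfolding zero_object_def by blast
next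
  assume *: "Ident C X = ZeroArr C X X"
  have 1: "f = ZeroArr C X Y" if "f \<in> Hom C X Y" for f Y
    using comp_ident_right[OF that] comp_zero_right[OF that assms] * by simp
  have 2: "f = ZeroArr C Y X" if "f \<in> Hom C Y X" for f Y
    using comp_ident_left[OF that] comp_zero_left[OF that assms] * by simp
  show "zero_object C X" unfolding zero_object_def
    using assms 1 2 zero_hom by blast
qed

lemma zero_object_hom:
  assumes "zero_object C X"
  shows "f \<in> Hom C X Y \<Longrightarrow> f = ZeroArr C X Y" "g \<in> Hom C Y X \<Longrightarrow> g = ZeroArr C Y X"
proof -
  have X: "X \<in> Obj C" and z: "Ident C X = ZeroArr C X X"
    using assms zero_object_iff by (auto simp: zero_object_def)
  show "f = ZeroArr C X Y" if "f \<in> Hom C X Y"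
    using comp_ident_right[OF that] comp_zero_right[OF that X] z by simp
  show "g = ZeroArr C Y X" if "g \<in> Hom C Y X"
    using comp_ident_left[OF that] comp_zero_left[OF that X] z by simp
qed

lemma zero_object_retract:
  assumes "u \<in> Hom C X Y" "r \<in> Hom C Y X" "r \<cdot> u = Ident C X" "zero_object C Y"
  shows "zero_object C X"
proof -
  have X: "X \<in> Obj C" using in_Hom[OF assms(1)] by simp
  have "Ident C X = r \<cdot> ZeroArr C X Y"
    using assms(3) zero_object_hom(2)[OF assms(4,1)] by simp
  also have "\<dots> = ZeroArr C X X" by (rule comp_zero_right[OF assms(2) X])
  finally show ?thesis using zero_object_iff[OF X] by simp
qed

lemma zero_object_isomorphic:
  assumes "isomorphic C X Y" "zero_object C Y" shows "zero_object C X"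
  using assms zero_object_retract iso_arrE unfolding isomorphic_def by metis

lemma biproductD:
  assumes "is_biproduct C Xs B inc prj"
  shows "B \<in> Obj C" "\<And>i. i < length Xs \<Longrightarrow> Xs ! i \<in> Obj C"
    "\<And>i. i < length Xs \<Longrightarrow> inc i \<in> Hom C (Xs ! i) B" "\<And>i. i < length Xs \<Longrightarrow> prj i \<in> Hom C B (Xs ! i)"
    "\<And>i j. \<lbrakk>i < length Xs; j < length Xs\<rbrakk> \<Longrightarrow> prj j \<cdot> inc i =
        (if i = j then Ident C (Xs ! i) else ZeroArr C (Xs ! i) (Xs ! j))"
    "finsum (hom_space C B B) (\<lambda>i. inc i \<cdot> prj i) {..<length Xs} = Ident C B"
  using assms by (auto simp: is_biproduct_def dest: nth_mem)

lemma singleton_biproduct: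
  assumes f: "f \<in> Hom C X Y" and g: "g \<in> Hom C Y X"
    and "g \<cdot> f = Ident C X" "f \<cdot> g = Ident C Y"
  shows "is_biproduct C [X] Y (\<lambda>_. f) (\<lambda>_. g)"
proof -
  interpret H: abelian_group "hom_space C Y Y" by (rule hom_group) (use in_Hom[OF f] in auto)
  have "finsum (hom_space C Y Y) (\<lambda>i. f \<cdot> g) {..<Suc 0} = f \<cdot> g"
    using comp_hom[OF g f] H.r_zero[of "f \<cdot> g"] by (simp add: lessThan_Suc)
  then show ?thesis using assms in_Hom[OF f] by (simp add: is_biproduct_def)
qed

lemma isomorphic_direct_sum: assumes "isomorphic C X Y" shows "is_direct_sum C [X] Y"
proof -
  obtain f where f: "iso_arr C f" "f \<in> Hom C X Y" using assms by (auto simp: isomorphic_def)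
  show ?thesis unfolding is_direct_sum_def
    using singleton_biproduct[OF f(2) inv_arr(1)[OF f] inv_arr(2,3)[OF f]] by blast
qed

lemma biproduct_expansion:
  assumes bp: "is_biproduct C Xs B inc prj"
  shows "h \<in> Hom C Y B \<Longrightarrow> h = finsum (hom_space C Y B) (\<lambda>i. inc i \<cdot> prj i \<cdot> h) {..<length Xs}"
    "g \<in> Hom C B Y \<Longrightarrow> g = finsum (hom_space C B Y) (\<lambda>i. (g \<cdot> inc i) \<cdot> prj i) {..<length Xs}"
proof -
  note b = biproductD[OF bp]
  assume h: "h \<in> Hom C Y B"
  have "h = finsum (hom_space C B B) (\<lambda>i. inc i \<cdot> prj i) {..<length Xs} \<cdot> h"
    using b(6) comp_ident_left[OF h] by simp
  also have "\<dots> = finsum (hom_space C Y B) (\<lambda>i. (inc i \<cdot> prj i) \<cdot> h) {..<length Xs}"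
    by (rule comp_finsum_left[OF h b(1)]) (auto intro: comp_hom b)
  also have "\<dots> = finsum (hom_space C Y B) (\<lambda>i. inc i \<cdot> prj i \<cdot> h) {..<length Xs}"
    by (rule finsum_hom_cong[OF in_Hom(4)[OF h] b(1)])
      (auto simp: comp_assoc[OF h b(4) b(3)] intro: comp_hom h b)
  finally show "h = finsum (hom_space C Y B) (\<lambda>i. inc i \<cdot> prj i \<cdot> h) {..<length Xs}" .
next
  note b = biproductD[OF bp]
  assume g: "g \<in> Hom C B Y"
  have "g = g \<cdot> finsum (hom_space C B B) (\<lambda>i. inc i \<cdot> prj i) {..<length Xs}"
    using b(6) comp_ident_right[OF g] by simp
  also have "\<dots> = finsum (hom_space C B Y) (\<lambda>i. g \<cdot> inc i \<cdot> prj i) {..<length Xs}"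
    by (rule comp_finsum_right[OF g b(1)]) (auto intro: comp_hom b)
  also have "\<dots> = finsum (hom_space C B Y) (\<lambda>i. (g \<cdot> inc i) \<cdot> prj i) {..<length Xs}"
    by (rule finsum_hom_cong[OF b(1) in_Hom(5)[OF g]])
      (auto simp: comp_assoc[OF b(4) b(3) g] intro: comp_hom g b)
  finally show "g = finsum (hom_space C B Y) (\<lambda>i. (g \<cdot> inc i) \<cdot> prj i) {..<length Xs}" .
qed

lemma components_eqI:
  assumes bp: "is_biproduct C Xs B inc prj" and f: "f \<in> Hom C Y B" and g: "g \<in> Hom C Y B"
    and eq: "\<And>i. i < length Xs \<Longrightarrow> prj i \<cdot> f = prj i \<cdot> g"
  shows "f = g"
proof -
  note b = biproductD[OF bp]
  have "f = finsum (hom_space C Y B) (\<lambda>i. inc i \<cdot> prj i \<cdot> f) {..<length Xs}"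
    by (rule biproduct_expansion(1)[OF bp f])
  also have "\<dots> = finsum (hom_space C Y B) (\<lambda>i. inc i \<cdot> prj i \<cdot> g) {..<length Xs}"
    by (rule finsum_hom_cong[OF in_Hom(4)[OF f] b(1)])
      (auto simp: eq intro: comp_hom[OF comp_hom[OF g b(4)] b(3)])
  also have "\<dots> = g" by (rule biproduct_expansion(1)[OF bp g, symmetric])
  finally show ?thesis .
qed

lemma cocomponents_eqI:
  assumes bp: "is_biproduct C Xs B inc prj" and f: "f \<in> Hom C B Y" and g: "g \<in> Hom C B Y"
    and eq: "\<And>i. i < length Xs \<Longrightarrow> f \<cdot> inc i = g \<cdot> inc i"
  shows "f = g"
proof -
  note b = biproductD[OF bp]
  have "f = finsum (hom_space C B Y) (\<lambda>i. (f \<cdot> inc i) \<cdot> prj i) {..<length Xs}"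
    by (rule biproduct_expansion(2)[OF bp f])
  also have "\<dots> = finsum (hom_space C B Y) (\<lambda>i. (g \<cdot> inc i) \<cdot> prj i) {..<length Xs}"
    by (rule finsum_hom_cong[OF b(1) in_Hom(5)[OF f]])
      (auto simp: eq intro: comp_hom[OF b(4) comp_hom[OF b(3) g]])
  also have "\<dots> = g" by (rule biproduct_expansion(2)[OF bp g, symmetric])
  finally show ?thesis .
qed

lemma biproduct_arrow:
  assumes bp: "is_biproduct C Xs B inc prj" and Y: "Y \<in> Obj C"
    and f: "\<And>i. i < length Xs \<Longrightarrow> f i \<in> Hom C Y (Xs ! i)"
  obtains h where "h \<in> Hom C Y B" "\<And>i. i < length Xs \<Longrightarrow> prj i \<cdot> h = f i"
proof
  note b = biproductD[OF bp]
  let ?h = "finsum (hom_space C Y B) (\<lambda>i. inc i \<cdot> f i) {..<length Xs}"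
  show "?h \<in> Hom C Y B" by (rule finsum_hom[OF Y b(1)]) (auto intro: comp_hom f b)
  fix j assume j: "j < length Xs"
  interpret H: abelian_group "hom_space C Y (Xs ! j)" by (rule hom_group[OF Y b(2)[OF j]])
  have "prj j \<cdot> ?h = finsum (hom_space C Y (Xs ! j)) (\<lambda>i. prj j \<cdot> inc i \<cdot> f i) {..<length Xs}"
    by (rule comp_finsum_right[OF b(4)[OF j] Y]) (auto intro: comp_hom f b)
  also have "\<dots> = finsum (hom_space C Y (Xs ! j))
      (\<lambda>i. if j = i then f j else \<zero>\<^bsub>hom_space C Y (Xs ! j)\<^esub>) {..<length Xs}"
  proof (rule finsum_hom_cong[OF Y b(2)[OF j]])
    fix i assume "i \<in> {..<length Xs}"
    then have i: "i < length Xs" by simp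
    show "(if j = i then f j else \<zero>\<^bsub>hom_space C Y (Xs ! j)\<^esub>) \<in> Hom C Y (Xs ! j)"
      using f[OF j] zero_hom[OF Y b(2)[OF j]] by (cases "j = i") simp_all
    show "prj j \<cdot> inc i \<cdot> f i = (if j = i then f j else \<zero>\<^bsub>hom_space C Y (Xs ! j)\<^esub>)"
      using comp_assoc[OF f[OF i] b(3)[OF i] b(4)[OF j]] b(5)[OF i j] comp_ident_left[OF f[OF i]]
        comp_zero_left[OF f[OF i] b(2)[OF j]] by (cases "i = j") auto
  qed
  also have "\<dots> = f j" using j f[OF j] by (intro H.finsum_singleton[of j "{..<length Xs}" "\<lambda>_. f j"]) auto
  finally show "prj j \<cdot> ?h = f j" .
qed

lemma direct_sum_unique:
  assumes "is_direct_sum C Xs A" "is_direct_sum C Xs B"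
  shows "isomorphic C A B"
proof -
  obtain inc prj where A: "is_biproduct C Xs A inc prj" using assms(1) by (auto simp: is_direct_sum_def)
  obtain inc' prj' where B: "is_biproduct C Xs B inc' prj'" using assms(2) by (auto simp: is_direct_sum_def)
  note a = biproductD[OF A] and b = biproductD[OF B]
  obtain f where f: "f \<in> Hom C A B" "\<And>i. i < length Xs \<Longrightarrow> prj' i \<cdot> f = prj i"
    using biproduct_arrow[OF B a(1), of prj] a(4) by blast
  obtain g where g: "g \<in> Hom C B A" "\<And>i. i < length Xs \<Longrightarrow> prj i \<cdot> g = prj' i"
    using biproduct_arrow[OF A b(1), of prj'] b(4) by blast
  have "g \<cdot> f = Ident C A"
  proof (rule components_eqI[OF A comp_hom[OF f(1) g(1)] ident_hom[OF a(1)]])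
    fix i assume i: "i < length Xs"
    show "prj i \<cdot> g \<cdot> f = prj i \<cdot> Ident C A"
      using comp_assoc[OF f(1) g(1) a(4)[OF i]] f(2)[OF i] g(2)[OF i] comp_ident_right[OF a(4)[OF i]] by simp
  qed
  moreover have "f \<cdot> g = Ident C B"
  proof (rule components_eqI[OF B comp_hom[OF g(1) f(1)] ident_hom[OF b(1)]])
    fix i assume i: "i < length Xs"
    show "prj' i \<cdot> f \<cdot> g = prj' i \<cdot> Ident C B"
      using comp_assoc[OF g(1) f(1) b(4)[OF i]] f(2)[OF i] g(2)[OF i] comp_ident_right[OF b(4)[OF i]] by simp
  qed
  ultimately show ?thesis using isomorphicI[OF f(1) iso_arrI[OF f(1) g(1)]] by blast
qed

lemma direct_sum_cong:
  assumes "is_direct_sum C Xs B" and len: "length Ys = length Xs"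
    and iso: "\<And>i. i < length Xs \<Longrightarrow> isomorphic C (Ys ! i) (Xs ! i)"
  shows "is_direct_sum C Ys B"
proof -
  obtain inc prj where bp: "is_biproduct C Xs B inc prj" using assms(1) by (auto simp: is_direct_sum_def)
  note b = biproductD[OF bp]
  have "\<forall>i<length Xs. \<exists>f. f \<in> Hom C (Ys ! i) (Xs ! i) \<and> iso_arr C f"
    using iso by (auto simp: isomorphic_def)
  then obtain f where f: "\<And>i. i < length Xs \<Longrightarrow> f i \<in> Hom C (Ys ! i) (Xs ! i)"
    and fi: "\<And>i. i < length Xs \<Longrightarrow> iso_arr C (f i)" by metis
  define g where "g i = inv_arr C (f i)" for i
  note g = inv_arr[OF fi f, folded g_def]
  have Y: "Ys ! i \<in> Obj C" if "i < length Xs" for i using in_Hom[OF f[OF that]] by simp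
  have fg: "(inc i \<cdot> f i) \<cdot> (g i \<cdot> prj i) = inc i \<cdot> prj i" if i: "i < length Xs" for i
  proof -
    have "(inc i \<cdot> f i) \<cdot> (g i \<cdot> prj i) = inc i \<cdot> f i \<cdot> g i \<cdot> prj i"
      by (rule comp_assoc[OF comp_hom[OF b(4)[OF i] g(1)[OF i i]] f[OF i] b(3)[OF i]])
    also have "f i \<cdot> g i \<cdot> prj i = prj i"
      using comp_assoc[OF b(4)[OF i] g(1)[OF i i] f[OF i]] g(3)[OF i i] comp_ident_left[OF b(4)[OF i]] by simp
    finally show ?thesis .
  qed
  have gf: "(g j \<cdot> prj j) \<cdot> (inc i \<cdot> f i) =
      (if i = j then Ident C (Ys ! i) else ZeroArr C (Ys ! i) (Ys ! j))"
    if i: "i < length Xs" and j: "j < length Xs" for i j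
  proof -
    have "(g j \<cdot> prj j) \<cdot> (inc i \<cdot> f i) = g j \<cdot> prj j \<cdot> inc i \<cdot> f i"
      by (rule comp_assoc[OF comp_hom[OF f[OF i] b(3)[OF i]] b(4)[OF j] g(1)[OF j j]])
    also have "prj j \<cdot> inc i \<cdot> f i = (prj j \<cdot> inc i) \<cdot> f i"
      by (rule comp_assoc[OF f[OF i] b(3)[OF i] b(4)[OF j], symmetric])
    finally show ?thesis
      using b(5)[OF i j] comp_ident_left[OF f[OF i]] g(2)[OF i i] comp_zero_left[OF f[OF i] b(2)[OF j]]
        comp_zero_right[OF g(1)[OF j j] Y[OF i]] by (cases "i = j") auto
  qed
  have "finsum (hom_space C B B) (\<lambda>i. (inc i \<cdot> f i) \<cdot> (g i \<cdot> prj i)) {..<length Ys} = Ident C B"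
    unfolding len b(6)[symmetric]
    by (rule finsum_hom_cong[OF b(1,1)]) (auto simp: fg intro: comp_hom b)
  moreover have "set Ys \<subseteq> Obj C" using Y len by (auto simp: in_set_conv_nth)
  ultimately have "is_biproduct C Ys B (\<lambda>i. inc i \<cdot> f i) (\<lambda>i. g i \<cdot> prj i)"
    unfolding is_biproduct_def using gf b(1) len
    by (auto intro: comp_hom[OF f b(3)] comp_hom[OF b(4) g(1)])
  then show ?thesis by (auto simp: is_direct_sum_def)
qed

end

context abelian_category begin

lemma kernel_mono: assumes "is_kernel C k f" shows "mono_arr C k"
  unfolding mono_arr_def
proof (intro conjI allI ballI impI)
  show kA: "k \<in> Arr C" using assms by (simp add: is_kernel_def)
  have fA: "f \<in> Hom C (Src C f) (Trg C f)" and kH: "k \<in> Hom C (Src C k) (Src C f)"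
    using assms by (auto simp: is_kernel_def Hom_def)
  fix W g h assume g: "g \<in> Hom C W (Src C k)" and h: "h \<in> Hom C W (Src C k)" and eq: "k \<cdot> g = k \<cdot> h"
  have W: "W \<in> Obj C" using in_Hom[OF g] by simp
  have "f \<cdot> k \<cdot> g = ZeroArr C W (Trg C f)"
    using comp_assoc[OF g kH fA] comp_zero_left[OF g in_Hom(5)[OF fA]] assms
    by (simp add: is_kernel_def)
  then have "\<exists>!u. u \<in> Hom C W (Src C k) \<and> k \<cdot> u = k \<cdot> g"
    using assms comp_hom[OF g kH] by (simp add: is_kernel_def)
  then show "g = h" using g h eq by auto
qed

text \<open>The kernel of \<open>f\<close> is a subobject of the simple object \<open>S\<close>. It is not all of \<open>S\<close>, so it
  is zero.\<close>

lemma simple_nonzero_mono: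
  assumes S: "simple_object C S" and f: "f \<in> Hom C S X" and nz: "f \<noteq> ZeroArr C S X"
  shows "mono_arr C f"
proof -
  note fA = in_Hom[OF f]
  obtain k where k: "is_kernel C k f" using has_kernels[OF fA(1)] by blast
  define Z where "Z = Src C k"
  have kH: "k \<in> Hom C Z S" using k fA by (auto simp: is_kernel_def Hom_def Z_def)
  have fk: "f \<cdot> k = ZeroArr C Z X" using k fA by (simp add: is_kernel_def Z_def)
  have zero: "zero_object C Z"
  proof (rule ccontr)
    assume "\<not> zero_object C Z"
    then have iso: "iso_arr C k" using S kernel_mono[OF k] kH by (auto simp: simple_object_def)
    have "f \<cdot> k = ZeroArr C S X \<cdot> k" using fk comp_zero_left[OF kH fA(5)] by simp
    then show False
      using iso_cancel_right[OF iso kH f zero_hom[OF fA(4,5)]] nz by blast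
  qed
  show ?thesis unfolding mono_arr_def
  proof (intro conjI allI ballI impI)
    show "f \<in> Arr C" by (rule fA(1))
    fix W g h assume "g \<in> Hom C W (Src C f)" "h \<in> Hom C W (Src C f)" and eq: "f \<cdot> g = f \<cdot> h"
    then have g: "g \<in> Hom C W S" and h: "h \<in> Hom C W S" using fA by auto
    have W: "W \<in> Obj C" using in_Hom[OF g] by simp
    have "inj_on (\<lambda>g. f \<cdot> g) (carrier (hom_space C W S))"
    proof (rule module_hom_injI[OF hom_module[OF W fA(4)] hom_module[OF W fA(5)] post_comp_module_hom[OF W f]])
      fix d assume "d \<in> carrier (hom_space C W S)" and "f \<cdot> d = \<zero>\<^bsub>hom_space C W X\<^esub>"
      then have "d \<in> Hom C W (Src C f)" "f \<cdot> d = ZeroArr C W (Trg C f)" using fA by simp_all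
      then obtain u where u: "u \<in> Hom C W Z" "k \<cdot> u = d" using k unfolding is_kernel_def Z_def by blast
      then show "d = \<zero>\<^bsub>hom_space C W S\<^esub>"
        using zero_object_hom(2)[OF zero u(1)] comp_zero_right[OF kH W] by simp
    qed
    then show "g = h" using g h eq by (simp add: inj_on_def)
  qed
qed

lemma schur:
  assumes "simple_object C S" "simple_object C T" "f \<in> Hom C S T" "f \<noteq> ZeroArr C S T"
  shows "iso_arr C f"
  using simple_nonzero_mono[OF assms(1,3,4)] assms by (auto simp: simple_object_def)

lemma simple_obj: assumes "simple_object C S" shows "S \<in> Obj C" "Ident C S \<noteq> ZeroArr C S S"
  using assms zero_object_iff by (auto simp: simple_object_def)

lemma simple_isomorphic:
  assumes S: "simple_object C S" and iso: "isomorphic C S T" shows "simple_object C T"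
proof -
  obtain f where f: "iso_arr C f" "f \<in> Hom C T S"
    using isomorphic_sym[OF iso] by (auto simp: isomorphic_def)
  have nz: "\<not> zero_object C T"
    using S zero_object_isomorphic[OF iso] by (auto simp: simple_object_def)
  have "iso_arr C u" if u: "u \<in> Hom C Y T" and m: "mono_arr C u" and Y: "\<not> zero_object C Y" for u Y
  proof -
    have fu: "f \<cdot> u \<in> Hom C Y S" by (rule comp_hom[OF u f(2)])
    have "mono_arr C (f \<cdot> u)" unfolding mono_arr_def
    proof (intro conjI allI ballI impI)
      show "f \<cdot> u \<in> Arr C" using in_Hom[OF fu] by simp
      fix W g h assume "g \<in> Hom C W (Src C (f \<cdot> u))" "h \<in> Hom C W (Src C (f \<cdot> u))"
        and eq: "(f \<cdot> u) \<cdot> g = (f \<cdot> u) \<cdot> h"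
      then have g: "g \<in> Hom C W Y" and h: "h \<in> Hom C W Y" using in_Hom[OF fu] by auto
      have "f \<cdot> u \<cdot> g = f \<cdot> u \<cdot> h" using eq comp_assoc[OF g u f(2)] comp_assoc[OF h u f(2)] by simp
      then have "u \<cdot> g = u \<cdot> h" by (rule iso_cancel_left[OF f comp_hom[OF g u] comp_hom[OF h u]])
      then show "g = h" using m g h in_Hom[OF u] by (auto simp: mono_arr_def)
    qed
    then have i: "iso_arr C (f \<cdot> u)" using S fu Y by (auto simp: simple_object_def)
    have "u = inv_arr C f \<cdot> f \<cdot> u"
      using comp_assoc[OF u f(2) inv_arr(1)[OF f]] inv_arr(2)[OF f] comp_ident_left[OF u] by simp
    then show ?thesis using iso_comp[OF i fu iso_inv_arr[OF f] inv_arr(1)[OF f]] by simp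
  qed
  then show ?thesis using nz isomorphic_obj[OF iso] by (auto simp: simple_object_def)
qed

text \<open>A summand \<open>X\<close> is added to a direct sum \<open>A\<close> by composing its injections and projections
  with those of the biproduct of \<open>X\<close> and \<open>A\<close>.\<close>

lemma direct_sum_exists:
  assumes "set Xs \<subseteq> Obj C" shows "\<exists>B. is_direct_sum C Xs B"
  using assms
proof (induction Xs)
  case Nil
  obtain Z where Z: "zero_object C Z" using has_zero by blast
  then have Zo: "Z \<in> Obj C" by (simp add: zero_object_def)
  interpret H: abelian_group "hom_space C Z Z" by (rule hom_group[OF Zo Zo])
  have "is_biproduct C [] Z undefined undefined"
    using Z zero_object_iff[OF Zo] Zo by (simp add: is_biproduct_def)
  then show ?case by (auto simp: is_direct_sum_def)
next
  case (Cons X Xs)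
  then obtain A where "is_direct_sum C Xs A" by auto
  then obtain inc prj where bp: "is_biproduct C Xs A inc prj" by (auto simp: is_direct_sum_def)
  note b = biproductD[OF bp]
  have X: "X \<in> Obj C" using Cons.prems by simp
  obtain B inc2 prj2 where bp2: "is_biproduct C [X, A] B inc2 prj2"
    using has_biproducts[OF X b(1)] by (auto simp: is_direct_sum_def)
  note c = biproductD[OF bp2]
  define j0 where "j0 = inc2 0" define j1 where "j1 = inc2 1"
  define p0 where "p0 = prj2 0" define p1 where "p1 = prj2 1"
  have j0: "j0 \<in> Hom C X B" and j1: "j1 \<in> Hom C A B" and p0: "p0 \<in> Hom C B X" and p1: "p1 \<in> Hom C B A"
    using c(3)[of 0] c(3)[of 1] c(4)[of 0] c(4)[of 1] by (simp_all add: j0_def j1_def p0_def p1_def)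
  have pj: "p0 \<cdot> j0 = Ident C X" "p1 \<cdot> j1 = Ident C A" "p1 \<cdot> j0 = ZeroArr C X A" "p0 \<cdot> j1 = ZeroArr C A X"
    using c(5)[of 0 0] c(5)[of 1 1] c(5)[of 0 1] c(5)[of 1 0] by (simp_all add: j0_def j1_def p0_def p1_def)
  note B = c(1)
  interpret H: abelian_group "hom_space C B B" by (rule hom_group[OF B B])
  have h0: "j0 \<cdot> p0 \<in> Hom C B B" and h1: "j1 \<cdot> p1 \<in> Hom C B B" by (rule comp_hom[OF p0 j0], rule comp_hom[OF p1 j1])
  have sum2: "PlusArr C (j0 \<cdot> p0) (j1 \<cdot> p1) = Ident C B"
  proof -
    have "{..<length [X, A]} = insert 0 {1}" by auto
    then have "Ident C B = finsum (hom_space C B B) (\<lambda>i. inc2 i \<cdot> prj2 i) (insert 0 {1})" using c(6) by simp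
    also have "\<dots> = PlusArr C (j0 \<cdot> p0) (j1 \<cdot> p1)"
      using h0 h1 H.finsum_insert[of "{1::nat}" 0 "\<lambda>i. inc2 i \<cdot> prj2 i"]
        H.finsum_insert[of "{}" "1::nat" "\<lambda>i. inc2 i \<cdot> prj2 i"] H.r_zero[of "j1 \<cdot> p1"]
      by (simp add: j0_def j1_def p0_def p1_def)
    finally show ?thesis by simp
  qed
  define J where "J i = (case i of 0 \<Rightarrow> j0 | Suc k \<Rightarrow> j1 \<cdot> inc k)" for i
  define P where "P i = (case i of 0 \<Rightarrow> p0 | Suc k \<Rightarrow> prj k \<cdot> p1)" for i
  have JP: "J i \<in> Hom C ((X # Xs) ! i) B" "P i \<in> Hom C B ((X # Xs) ! i)" if "i < length (X # Xs)" for i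
    using that j0 p0 comp_hom[OF b(3) j1] comp_hom[OF p1 b(4)]
    by (auto simp: J_def P_def nth_Cons split: nat.splits)
  have inner: "P k \<cdot> J i = (if i = k then Ident C ((X # Xs) ! i) else ZeroArr C ((X # Xs) ! i) ((X # Xs) ! k))"
    if i: "i < length (X # Xs)" and k: "k < length (X # Xs)" for i k
  proof (cases i; cases k)
    assume "i = 0" "k = 0" then show ?thesis using pj by (simp add: J_def P_def)
  next
    fix k' assume [simp]: "i = 0" "k = Suc k'"
    then have k': "k' < length Xs" using k by simp
    show ?thesis using comp_assoc[OF j0 p1 b(4)[OF k']] pj comp_zero_right[OF b(4)[OF k'] X]
      by (simp add: J_def P_def)
  next
    fix i' assume [simp]: "i = Suc i'" "k = 0"
    then have i': "i' < length Xs" using i by simp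
    show ?thesis using comp_assoc[OF b(3)[OF i'] j1 p0] pj comp_zero_left[OF b(3)[OF i'] X]
      by (simp add: J_def P_def)
  next
    fix i' k' assume [simp]: "i = Suc i'" "k = Suc k'"
    then have i': "i' < length Xs" and k': "k' < length Xs" using i k by simp_all
    have "(prj k' \<cdot> p1) \<cdot> (j1 \<cdot> inc i') = prj k' \<cdot> (p1 \<cdot> j1) \<cdot> inc i'"
      using comp_assoc[OF comp_hom[OF b(3)[OF i'] j1] p1 b(4)[OF k']] comp_assoc[OF b(3)[OF i'] j1 p1] by simp
    also have "\<dots> = prj k' \<cdot> inc i'" using pj comp_ident_left[OF b(3)[OF i']] by simp
    finally show ?thesis using b(5)[OF i' k'] by (simp add: J_def P_def)
  qed
  have "{..<length (X # Xs)} = insert 0 (Suc ` {..<length Xs})" by (auto simp: image_iff less_Suc_eq_0_disj)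
  then have "finsum (hom_space C B B) (\<lambda>i. J i \<cdot> P i) {..<length (X # Xs)}
      = finsum (hom_space C B B) (\<lambda>i. J i \<cdot> P i) (insert 0 (Suc ` {..<length Xs}))" by simp
  also have "\<dots> = PlusArr C (j0 \<cdot> p0) (finsum (hom_space C B B) (\<lambda>i. J i \<cdot> P i) (Suc ` {..<length Xs}))"
  proof -
    have JPH: "J i \<cdot> P i \<in> Hom C B B" if "i < length (X # Xs)" for i
      by (rule comp_hom[OF JP(2)[OF that] JP(1)[OF that]])
    have "finsum (hom_space C B B) (\<lambda>i. J i \<cdot> P i) (insert 0 (Suc ` {..<length Xs}))
        = (J 0 \<cdot> P 0) \<oplus>\<^bsub>hom_space C B B\<^esub> finsum (hom_space C B B) (\<lambda>i. J i \<cdot> P i) (Suc ` {..<length Xs})"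
      by (rule H.finsum_insert) (use JPH in auto)
    then show ?thesis by (simp add: J_def P_def)
  qed
  also have "finsum (hom_space C B B) (\<lambda>i. J i \<cdot> P i) (Suc ` {..<length Xs})
      = finsum (hom_space C B B) (\<lambda>i. J (Suc i) \<cdot> P (Suc i)) {..<length Xs}"
    by (rule H.finsum_reindex) (use comp_hom[OF JP(2,1)] in auto)
  also have "\<dots> = finsum (hom_space C B B) (\<lambda>i. j1 \<cdot> (inc i \<cdot> prj i) \<cdot> p1) {..<length Xs}"
  proof (rule finsum_hom_cong[OF B B])
    fix i assume "i \<in> {..<length Xs}"
    then have i: "i < length Xs" by simp
    note e = comp_hom[OF b(4)[OF i] b(3)[OF i]]
    show "j1 \<cdot> (inc i \<cdot> prj i) \<cdot> p1 \<in> Hom C B B" by (rule comp_hom[OF comp_hom[OF p1 e] j1])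
    show "J (Suc i) \<cdot> P (Suc i) = j1 \<cdot> (inc i \<cdot> prj i) \<cdot> p1"
      using comp_assoc[OF comp_hom[OF p1 b(4)[OF i]] b(3)[OF i] j1] comp_assoc[OF p1 b(4)[OF i] b(3)[OF i]]
      by (simp add: J_def P_def)
  qed
  also have "\<dots> = j1 \<cdot> finsum (hom_space C B A) (\<lambda>i. (inc i \<cdot> prj i) \<cdot> p1) {..<length Xs}"
    by (rule comp_finsum_right[OF j1 B, symmetric]) (auto intro: comp_hom[OF p1 comp_hom[OF b(4) b(3)]])
  also have "finsum (hom_space C B A) (\<lambda>i. (inc i \<cdot> prj i) \<cdot> p1) {..<length Xs} = Ident C A \<cdot> p1"
    unfolding b(6)[symmetric]
    by (rule comp_finsum_left[OF p1 b(1), symmetric]) (auto intro: comp_hom[OF b(4) b(3)])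
  finally have "finsum (hom_space C B B) (\<lambda>i. J i \<cdot> P i) {..<length (X # Xs)} = Ident C B"
    using sum2 comp_ident_left[OF p1] by simp
  then have "is_biproduct C (X # Xs) B J P"
    unfolding is_biproduct_def using JP inner B Cons.prems by blast
  then show ?case by (auto simp: is_direct_sum_def)
qed

end

locale additive_functor = A: linear_category K C + B: linear_category K D
  for K :: "'k ring"
    and C :: "('o1, 'm1, 'k, 'z1) lincat_scheme"
    and D :: "('o2, 'm2, 'k, 'z2) lincat_scheme" +
  fixes G :: "'o1 \<Rightarrow> 'o2" and g :: "'m1 \<Rightarrow> 'm2"
  assumes G_obj: "X \<in> Obj C \<Longrightarrow> G X \<in> Obj D"
    and g_hom: "f \<in> Hom C X Y \<Longrightarrow> g f \<in> Hom D (G X) (G Y)"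
    and g_ident: "X \<in> Obj C \<Longrightarrow> g (Ident C X) = Ident D (G X)"
    and g_comp: "\<lbrakk>f \<in> Hom C X Y; h \<in> Hom C Y Z\<rbrakk> \<Longrightarrow> g (h \<cdot>\<^bsub>C\<^esub> f) = g h \<cdot>\<^bsub>D\<^esub> g f"
    and g_plus: "\<lbrakk>f \<in> Hom C X Y; h \<in> Hom C X Y\<rbrakk> \<Longrightarrow> g (PlusArr C f h) = PlusArr D (g f) (g h)"
begin

lemma g_zero: assumes X: "X \<in> Obj C" and Y: "Y \<in> Obj C"
  shows "g (ZeroArr C X Y) = ZeroArr D (G X) (G Y)"
proof -
  interpret H: abelian_group "hom_space C X Y" by (rule A.hom_group[OF X Y])
  interpret H': abelian_group "hom_space D (G X) (G Y)" by (rule B.hom_group[OF G_obj[OF X] G_obj[OF Y]])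
  let ?z = "ZeroArr C X Y"
  have z: "?z \<in> Hom C X Y" by (rule A.zero_hom[OF X Y])
  have gz: "g ?z \<in> carrier (hom_space D (G X) (G Y))" using g_hom[OF z] by simp
  have "PlusArr C ?z ?z = ?z" using H.r_zero[of ?z] z by simp
  then have "g ?z \<oplus>\<^bsub>hom_space D (G X) (G Y)\<^esub> g ?z = g ?z" using g_plus[OF z z] by simp
  then show ?thesis using H'.add.r_cancel_one[OF gz gz] by simp
qed

lemma g_finsum:
  assumes X: "X \<in> Obj C" and Y: "Y \<in> Obj C" and I: "finite I"
    and f: "\<And>i. i \<in> I \<Longrightarrow> f i \<in> Hom C X Y"
  shows "g (finsum (hom_space C X Y) f I) = finsum (hom_space D (G X) (G Y)) (\<lambda>i. g (f i)) I"
proof -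
  interpret H: abelian_group "hom_space C X Y" by (rule A.hom_group[OF X Y])
  interpret H': abelian_group "hom_space D (G X) (G Y)" by (rule B.hom_group[OF G_obj[OF X] G_obj[OF Y]])
  show ?thesis using I f
  proof (induction I rule: finite_induct)
    case empty
    then show ?case using g_zero[OF X Y] by simp
  next
    case (insert i I)
    have fi: "f i \<in> Hom C X Y" "\<And>j. j \<in> I \<Longrightarrow> f j \<in> Hom C X Y" using insert.prems by auto
    have S: "finsum (hom_space C X Y) f I \<in> Hom C X Y"
      by (rule A.finsum_hom[OF X Y]) (use fi in auto)
    have "finsum (hom_space C X Y) f (insert i I) = PlusArr C (f i) (finsum (hom_space C X Y) f I)"
      using H.finsum_insert[OF insert.hyps, of f] fi by auto
    moreover have "finsum (hom_space D (G X) (G Y)) (\<lambda>i. g (f i)) (insert i I)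
        = PlusArr D (g (f i)) (finsum (hom_space D (G X) (G Y)) (\<lambda>i. g (f i)) I)"
      using H'.finsum_insert[OF insert.hyps, of "\<lambda>i. g (f i)"] fi g_hom by auto
    ultimately show ?case using g_plus[OF fi(1) S] insert.IH fi by simp
  qed
qed

lemma biproduct_image:
  assumes bp: "is_biproduct C Xs X inc prj"
  shows "is_biproduct D (map G Xs) (G X) (\<lambda>i. g (inc i)) (\<lambda>i. g (prj i))"
proof -
  note b = A.biproductD[OF bp]
  have c: "g (prj j) \<cdot>\<^bsub>D\<^esub> g (inc i) =
      (if i = j then Ident D (G (Xs ! i)) else ZeroArr D (G (Xs ! i)) (G (Xs ! j)))"
    if i: "i < length Xs" and j: "j < length Xs" for i j
    using g_comp[OF b(3)[OF i] b(4)[OF j], symmetric] b(5)[OF i j] g_ident[OF b(2)[OF i]]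
      g_zero[OF b(2)[OF i] b(2)[OF j]] by (cases "i = j") auto
  have "finsum (hom_space D (G X) (G X)) (\<lambda>i. g (inc i) \<cdot>\<^bsub>D\<^esub> g (prj i)) {..<length Xs}
      = finsum (hom_space D (G X) (G X)) (\<lambda>i. g (inc i \<cdot>\<^bsub>C\<^esub> prj i)) {..<length Xs}"
  proof (rule B.finsum_hom_cong)
    fix i assume "i \<in> {..<length Xs}"
    then have i: "i < length Xs" by simp
    show "g (inc i) \<cdot>\<^bsub>D\<^esub> g (prj i) = g (inc i \<cdot>\<^bsub>C\<^esub> prj i)"
      using g_comp[OF b(4)[OF i] b(3)[OF i]] by simp
    show "g (inc i \<cdot>\<^bsub>C\<^esub> prj i) \<in> Hom D (G X) (G X)"
      by (rule g_hom[OF A.comp_hom[OF b(4)[OF i] b(3)[OF i]]])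
  qed (use G_obj b in auto)
  also have "\<dots> = g (finsum (hom_space C X X) (\<lambda>i. inc i \<cdot>\<^bsub>C\<^esub> prj i) {..<length Xs})"
    by (rule g_finsum[symmetric]) (auto intro: A.comp_hom[OF b(4) b(3)] b(1))
  also have "\<dots> = Ident D (G X)" using b(6) g_ident[OF b(1)] by simp
  finally have "finsum (hom_space D (G X) (G X)) (\<lambda>i. g (inc i) \<cdot>\<^bsub>D\<^esub> g (prj i)) {..<length Xs}
      = Ident D (G X)" .
  moreover have "set (map G Xs) \<subseteq> Obj D" using G_obj bp by (auto simp: is_biproduct_def)
  ultimately show ?thesis
    using b(1) G_obj g_hom[OF b(3)] g_hom[OF b(4)] c by (simp add: is_biproduct_def)
qed

lemma direct_sum_image: "is_direct_sum C Xs X \<Longrightarrow> is_direct_sum D (map G Xs) (G X)"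
  using biproduct_image unfolding is_direct_sum_def by blast

lemma iso_image: assumes "iso_arr C f" "f \<in> Hom C X Y" shows "iso_arr D (g f)"
proof -
  note i = A.inv_arr[OF assms] and o = A.in_Hom[OF assms(2)]
  show ?thesis
  proof (rule B.iso_arrI[OF g_hom[OF assms(2)] g_hom[OF i(1)]])
    show "g (inv_arr C f) \<cdot>\<^bsub>D\<^esub> g f = Ident D (G X)"
      using g_comp[OF assms(2) i(1)] i(2) g_ident o by simp
    show "g f \<cdot>\<^bsub>D\<^esub> g (inv_arr C f) = Ident D (G Y)"
      using g_comp[OF i(1) assms(2)] i(3) g_ident o by simp
  qed
qed

lemma isomorphic_image: assumes "isomorphic C X Y" shows "isomorphic D (G X) (G Y)"
proof -
  obtain f where f: "iso_arr C f" "f \<in> Hom C X Y" using assms by (auto simp: isomorphic_def)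
  show ?thesis by (rule B.isomorphicI[OF g_hom[OF f(2)] iso_image[OF f]])
qed

lemma zero_object_image: assumes "zero_object C X" shows "zero_object D (G X)"
proof -
  have X: "X \<in> Obj C" using assms by (simp add: zero_object_def)
  have "g (Ident C X) = g (ZeroArr C X X)" using assms A.zero_object_iff[OF X] by simp
  then show ?thesis
    using g_ident[OF X] g_zero[OF X X] B.zero_object_iff[OF G_obj[OF X]] by simp
qed

end

section \<open>Dimensions of hom spaces\<close>

context tensor_category begin

abbreviation "hdim \<equiv> simple_multiplicity K C"

lemma hdim_biproduct_right:
  assumes bp: "is_biproduct C Xs B inc prj" and Y: "Y \<in> Obj C"
  shows "hdim Y B = (\<Sum>i<length Xs. hdim Y (Xs ! i))"
  unfolding simple_multiplicity_def
proof (rule vdim_direct_sum[where \<iota> = "\<lambda>i f. inc i \<cdot> f" and \<pi> = "\<lambda>i f. prj i \<cdot> f"])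
  note b = biproductD[OF bp]
  show "vectorspace K (hom_space C Y B)" by (rule hom_vectorspace[OF Y b(1)])
  fix i assume i: "i < length Xs"
  show "vectorspace K (hom_space C Y (Xs ! i))" by (rule hom_vectorspace[OF Y b(2)[OF i]])
  show "finite_dim K (hom_space C Y (Xs ! i))" by (rule hom_finite_dim[OF Y b(2)[OF i]])
  show "(\<lambda>f. inc i \<cdot> f) \<in> module_hom K (hom_space C Y (Xs ! i)) (hom_space C Y B)"
    by (rule post_comp_module_hom[OF Y b(3)[OF i]])
  show "(\<lambda>f. prj i \<cdot> f) \<in> module_hom K (hom_space C Y B) (hom_space C Y (Xs ! i))"
    by (rule post_comp_module_hom[OF Y b(4)[OF i]])
  fix j x assume j: "j < length Xs" and "x \<in> carrier (hom_space C Y (Xs ! i))"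
  then have x: "x \<in> Hom C Y (Xs ! i)" by simp
  show "prj j \<cdot> inc i \<cdot> x = (if i = j then x else \<zero>\<^bsub>hom_space C Y (Xs ! j)\<^esub>)"
    using comp_assoc[OF x b(3)[OF i] b(4)[OF j]] b(5)[OF i j] comp_ident_left[OF x]
      comp_zero_left[OF x b(2)[OF j]] by (cases "i = j") auto
qed (use biproduct_expansion(1)[OF bp] in simp)

lemma hdim_biproduct_left:
  assumes bp: "is_biproduct C Xs B inc prj" and Y: "Y \<in> Obj C"
  shows "hdim B Y = (\<Sum>i<length Xs. hdim (Xs ! i) Y)"
  unfolding simple_multiplicity_def
proof (rule vdim_direct_sum[where \<iota> = "\<lambda>i f. f \<cdot> prj i" and \<pi> = "\<lambda>i f. f \<cdot> inc i"])
  note b = biproductD[OF bp]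
  show "vectorspace K (hom_space C B Y)" by (rule hom_vectorspace[OF b(1) Y])
  fix i assume i: "i < length Xs"
  show "vectorspace K (hom_space C (Xs ! i) Y)" by (rule hom_vectorspace[OF b(2)[OF i] Y])
  show "finite_dim K (hom_space C (Xs ! i) Y)" by (rule hom_finite_dim[OF b(2)[OF i] Y])
  show "(\<lambda>f. f \<cdot> prj i) \<in> module_hom K (hom_space C (Xs ! i) Y) (hom_space C B Y)"
    by (rule pre_comp_module_hom[OF Y b(4)[OF i]])
  show "(\<lambda>f. f \<cdot> inc i) \<in> module_hom K (hom_space C B Y) (hom_space C (Xs ! i) Y)"
    by (rule pre_comp_module_hom[OF Y b(3)[OF i]])
  fix j x assume j: "j < length Xs" and "x \<in> carrier (hom_space C (Xs ! i) Y)"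
  then have x: "x \<in> Hom C (Xs ! i) Y" by simp
  show "(x \<cdot> prj i) \<cdot> inc j = (if i = j then x else \<zero>\<^bsub>hom_space C (Xs ! j) Y\<^esub>)"
    using comp_assoc[OF b(3)[OF j] b(4)[OF i] x] b(5)[OF j i] comp_ident_right[OF x]
      comp_zero_right[OF x b(2)[OF j]] by (cases "i = j") auto
qed (use biproduct_expansion(2)[OF bp] in simp)

lemma hdim_isomorphic_right: assumes "isomorphic C X X'" "Y \<in> Obj C" shows "hdim Y X = hdim Y X'"
proof -
  obtain inc prj where bp: "is_biproduct C [X] X' inc prj"
    using isomorphic_direct_sum[OF assms(1)] by (auto simp: is_direct_sum_def)
  show ?thesis using hdim_biproduct_right[OF bp assms(2)] by simp
qed

lemma hdim_isomorphic_left: assumes "isomorphic C X X'" "Y \<in> Obj C" shows "hdim X Y = hdim X' Y"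
proof -
  obtain inc prj where bp: "is_biproduct C [X] X' inc prj"
    using isomorphic_direct_sum[OF assms(1)] by (auto simp: is_direct_sum_def)
  show ?thesis using hdim_biproduct_left[OF bp assms(2)] by simp
qed

lemma hdim_zero_iff:
  assumes X: "X \<in> Obj C" and Y: "Y \<in> Obj C"
  shows "hdim X Y = 0 \<longleftrightarrow> Hom C X Y = {ZeroArr C X Y}"
proof
  assume "hdim X Y = 0"
  then have "vdim K (hom_space C X Y) = 0" by (simp add: simple_multiplicity_def)
  then have "f = ZeroArr C X Y" if "f \<in> Hom C X Y" for f
    using vdim_zero_imp[OF hom_vectorspace[OF X Y] hom_finite_dim[OF X Y], of f] that by simp
  then show "Hom C X Y = {ZeroArr C X Y}" using zero_hom[OF X Y] by blast
next
  assume "Hom C X Y = {ZeroArr C X Y}"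
  then show "hdim X Y = 0"
    using vdim_zeroI[OF hom_vectorspace[OF X Y]] by (simp add: simple_multiplicity_def)
qed

lemma hdim_pos_if_nonzero:
  assumes "f \<in> Hom C X Y" "f \<noteq> ZeroArr C X Y" shows "0 < hdim X Y"
proof (rule ccontr)
  assume "\<not> 0 < hdim X Y"
  then have "Hom C X Y = {ZeroArr C X Y}" using hdim_zero_iff[OF in_Hom(4,5)[OF assms(1)]] by simp
  then show False using assms by simp
qed

lemma nonzero_if_hdim_pos:
  assumes X: "X \<in> Obj C" and Y: "Y \<in> Obj C" and pos: "0 < hdim X Y"
  obtains f where "f \<in> Hom C X Y" "f \<noteq> ZeroArr C X Y"
proof (rule ccontr)
  assume no: "\<not> thesis"
  have "f = ZeroArr C X Y" if "f \<in> Hom C X Y" for f using that no \<open>\<And>f. \<lbrakk>f \<in> Hom C X Y; f \<noteq> ZeroArr C X Y\<rbrakk> \<Longrightarrow> thesis\<close> by blast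
  then have "Hom C X Y = {ZeroArr C X Y}" using zero_hom[OF X Y] by blast
  then show False using hdim_zero_iff[OF X Y] pos by simp
qed

lemma hdim_le_of_injective:
  assumes X: "X \<in> Obj C" and Y: "Y \<in> Obj C" and X': "X' \<in> Obj C" and Y': "Y' \<in> Obj C"
    and "T \<in> module_hom K (hom_space C X Y) (hom_space C X' Y')" "inj_on T (Hom C X Y)"
  shows "hdim X Y \<le> hdim X' Y'"
  unfolding simple_multiplicity_def
  by (rule vdim_le_of_injective[OF hom_vectorspace[OF X Y] hom_finite_dim[OF X Y]
        hom_vectorspace[OF X' Y'] hom_finite_dim[OF X' Y']]) (use assms in auto)

lemma tensor_left_additive: assumes X: "X \<in> Obj C"
  shows "additive_functor K C C (\<lambda>Y. X \<otimes>\<^sub>o Y) (\<lambda>f. Ident C X \<otimes>\<^sub>a f)"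
proof
  note iX = ident_hom[OF X]
  fix f h Y Z W
  show "Y \<in> Obj C \<Longrightarrow> X \<otimes>\<^sub>o Y \<in> Obj C" by (rule tensor_obj[OF X])
  show "f \<in> Hom C Y Z \<Longrightarrow> Ident C X \<otimes>\<^sub>a f \<in> Hom C (X \<otimes>\<^sub>o Y) (X \<otimes>\<^sub>o Z)" by (rule tensor_hom[OF iX])
  show "Y \<in> Obj C \<Longrightarrow> Ident C X \<otimes>\<^sub>a Ident C Y = Ident C (X \<otimes>\<^sub>o Y)" by (rule tensor_ident[OF X])
  show "f \<in> Hom C Y Z \<Longrightarrow> h \<in> Hom C Z W \<Longrightarrow>
      Ident C X \<otimes>\<^sub>a (h \<cdot> f) = (Ident C X \<otimes>\<^sub>a h) \<cdot> (Ident C X \<otimes>\<^sub>a f)"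
    using tensor_comp[OF iX iX] comp_ident_left[OF iX] by simp
  show "f \<in> Hom C Y Z \<Longrightarrow> h \<in> Hom C Y Z \<Longrightarrow>
      Ident C X \<otimes>\<^sub>a PlusArr C f h = PlusArr C (Ident C X \<otimes>\<^sub>a f) (Ident C X \<otimes>\<^sub>a h)"
    by (rule tensor_plus_right[OF iX])
qed

lemma tensor_right_additive: assumes X: "X \<in> Obj C"
  shows "additive_functor K C C (\<lambda>Y. Y \<otimes>\<^sub>o X) (\<lambda>f. f \<otimes>\<^sub>a Ident C X)"
proof
  note iX = ident_hom[OF X]
  fix f h Y Z W
  show "Y \<in> Obj C \<Longrightarrow> Y \<otimes>\<^sub>o X \<in> Obj C" by (rule tensor_obj[OF _ X])
  show "f \<in> Hom C Y Z \<Longrightarrow> f \<otimes>\<^sub>a Ident C X \<in> Hom C (Y \<otimes>\<^sub>o X) (Z \<otimes>\<^sub>o X)" by (rule tensor_hom[OF _ iX])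
  show "Y \<in> Obj C \<Longrightarrow> Ident C Y \<otimes>\<^sub>a Ident C X = Ident C (Y \<otimes>\<^sub>o X)" by (rule tensor_ident[OF _ X])
  show "f \<in> Hom C Y Z \<Longrightarrow> h \<in> Hom C Z W \<Longrightarrow>
      (h \<cdot> f) \<otimes>\<^sub>a Ident C X = (h \<otimes>\<^sub>a Ident C X) \<cdot> (f \<otimes>\<^sub>a Ident C X)"
    using tensor_comp[OF _ _ iX iX] comp_ident_left[OF iX] by simp
  show "f \<in> Hom C Y Z \<Longrightarrow> h \<in> Hom C Y Z \<Longrightarrow>
      PlusArr C f h \<otimes>\<^sub>a Ident C X = PlusArr C (f \<otimes>\<^sub>a Ident C X) (h \<otimes>\<^sub>a Ident C X)"
    by (rule tensor_plus_left[OF _ _ iX])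
qed

lemma tensor_isomorphic:
  assumes "isomorphic C X X'" "isomorphic C Y Y'"
  shows "isomorphic C (X \<otimes>\<^sub>o Y) (X' \<otimes>\<^sub>o Y')"
proof (rule isomorphic_trans)
  show "isomorphic C (X \<otimes>\<^sub>o Y) (X' \<otimes>\<^sub>o Y)"
    by (rule additive_functor.isomorphic_image[OF tensor_right_additive assms(1)])
      (rule isomorphic_obj(1)[OF assms(2)])
  show "isomorphic C (X' \<otimes>\<^sub>o Y) (X' \<otimes>\<^sub>o Y')"
    by (rule additive_functor.isomorphic_image[OF tensor_left_additive assms(2)])
      (rule isomorphic_obj(2)[OF assms(1)])
qed

lemma assoc_isomorphic:
  assumes "X \<in> Obj C" "Y \<in> Obj C" "Z \<in> Obj C"
  shows "isomorphic C ((X \<otimes>\<^sub>o Y) \<otimes>\<^sub>o Z) (X \<otimes>\<^sub>o (Y \<otimes>\<^sub>o Z))"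
  by (rule isomorphicI[OF assoc_hom assoc_iso]) (use assms in auto)

lemma unit_isomorphic: assumes "X \<in> Obj C"
  shows "isomorphic C (\<one>\<^sub>o \<otimes>\<^sub>o X) X" "isomorphic C (X \<otimes>\<^sub>o \<one>\<^sub>o) X"
  by (rule isomorphicI[OF lunit_hom lunit_iso] isomorphicI[OF runit_hom runit_iso], rule assms, rule assms)+

end

section \<open>Simple objects and multiplicities in a fusion category\<close>

context fusion_category begin

lemma scalar_End_nonzero:
  assumes X: "X \<in> Obj C" and s: "scalar_End K C X" shows "Ident C X \<noteq> ZeroArr C X X"
proof
  assume "Ident C X = ZeroArr C X X"
  then have "Scale C \<one>\<^bsub>K\<^esub> (Ident C X) = Scale C \<zero>\<^bsub>K\<^esub> (Ident C X)"
    using scale_one[OF ident_hom[OF X]] scale_zero[OF ident_hom[OF X]] by simp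
  then have "\<one>\<^bsub>K\<^esub> = \<zero>\<^bsub>K\<^esub>"
    using s unfolding scalar_End_def bij_betw_def inj_on_def by blast
  then show False by simp
qed

text \<open>Each simple summand of \<open>X\<close> contributes a nonzero map to \<open>X\<close>, and hence at least one to
  the dimension of \<open>End(X)\<close>. So there is exactly one summand.\<close>

lemma simple_if_hdim_le_one:
  assumes X: "X \<in> Obj C" and nz: "\<not> zero_object C X" and le: "hdim X X \<le> 1"
  shows "simple_object C X"
proof -
  obtain Ss inc prj where Ss: "\<And>S. S \<in> set Ss \<Longrightarrow> simple_object C S"
    and bp: "is_biproduct C Ss X inc prj"
    using semisimple[OF X] by (auto simp: is_direct_sum_def)
  note b = biproductD[OF bp]
  interpret H: abelian_group "hom_space C X X" by (rule hom_group[OF X X])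
  have simple: "simple_object C (Ss ! i)" if "i < length Ss" for i using Ss that by simp
  have "1 \<le> hdim (Ss ! i) X" if i: "i < length Ss" for i
  proof -
    have "prj i \<cdot> inc i \<noteq> ZeroArr C (Ss ! i) (Ss ! i)" using b(5)[OF i i] simple_obj(2)[OF simple[OF i]] by simp
    then have "inc i \<noteq> ZeroArr C (Ss ! i) X" using comp_zero_right[OF b(4)[OF i] b(2)[OF i]] by metis
    then show ?thesis using hdim_pos_if_nonzero[OF b(3)[OF i]] by simp
  qed
  then have "(\<Sum>i<length Ss. 1) \<le> (\<Sum>i<length Ss. hdim (Ss ! i) X)" by (intro sum_mono) simp
  then have "length Ss \<le> 1" using hdim_biproduct_left[OF bp X] le by simp
  moreover have "length Ss \<noteq> 0"
  proof
    assume "length Ss = 0"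
    then have "{..<length Ss} = {}" by simp
    then have "Ident C X = finsum (hom_space C X X) (\<lambda>i. inc i \<cdot> prj i) {}" using b(6) by simp
    then show False using nz zero_object_iff[OF X] by simp
  qed
  ultimately have len: "length Ss = Suc 0" by linarith
  then have 0: "0 < length Ss" by simp
  have e: "inc 0 \<cdot> prj 0 \<in> Hom C X X" by (rule comp_hom[OF b(4)[OF 0] b(3)[OF 0]])
  have "inc 0 \<cdot> prj 0 = Ident C X"
    using b(6) len e H.r_zero[of "inc 0 \<cdot> prj 0"] by (simp add: lessThan_Suc)
  moreover have "prj 0 \<cdot> inc 0 = Ident C (Ss ! 0)" using b(5)[OF 0 0] by simp
  ultimately have "iso_arr C (inc 0)" by (intro iso_arrI[OF b(3)[OF 0] b(4)[OF 0]])
  then show ?thesis using simple_isomorphic[OF simple[OF 0]] isomorphicI[OF b(3)[OF 0]] by blast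
qed

lemma hdim_eq_one_if_scalar:
  assumes X: "X \<in> Obj C" and nz: "Ident C X \<noteq> ZeroArr C X X"
    and sc: "\<And>f. f \<in> Hom C X X \<Longrightarrow> \<exists>a\<in>carrier K. f = Scale C a (Ident C X)"
  shows "hdim X X = 1"
  unfolding simple_multiplicity_def
  by (rule vdim_oneI[OF hom_vectorspace[OF X X] hom_finite_dim[OF X X], of "Ident C X"]) (use ident_hom[OF X] nz sc in auto)

lemma scalar_endomorphisms_imp_simple:
  assumes X: "X \<in> Obj C" and nz: "Ident C X \<noteq> ZeroArr C X X"
    and sc: "\<And>f. f \<in> Hom C X X \<Longrightarrow> \<exists>a\<in>carrier K. f = Scale C a (Ident C X)"
  shows "simple_object C X"
  using simple_if_hdim_le_one[OF X] hdim_eq_one_if_scalar[OF X nz sc] zero_object_iff[OF X] nz by simp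

lemma unit_simple: "simple_object C \<one>\<^sub>o"
proof (rule scalar_endomorphisms_imp_simple[OF unit_obj scalar_End_nonzero[OF unit_obj End_unit]])
  fix f assume "f \<in> Hom C \<one>\<^sub>o \<one>\<^sub>o"
  then show "\<exists>a\<in>carrier K. f = Scale C a (Ident C \<one>\<^sub>o)"
    using End_unit unfolding scalar_End_def bij_betw_def by blast
qed

lemma hdim_simple:
  assumes S: "simple_object C S" and T: "simple_object C T"
  shows "hdim S T = (if isomorphic C S T then 1 else 0)"
proof (cases "isomorphic C S T")
  case True
  have So: "S \<in> Obj C" using simple_obj[OF S] by simp
  have "hdim S S = 1"
    by (rule hdim_eq_one_if_scalar[OF So simple_obj(2)[OF S]])
      (use split_simple[OF S] in \<open>auto simp: scalar_End_def bij_betw_def\<close>)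
  then show ?thesis using True hdim_isomorphic_right[OF True So] by simp
next
  case False
  have "f = ZeroArr C S T" if f: "f \<in> Hom C S T" for f
  proof (rule ccontr)
    assume "f \<noteq> ZeroArr C S T"
    then show False using schur[OF S T f] isomorphicI[OF f] False by blast
  qed
  then have "hdim S T = 0"
    using hdim_zero_iff simple_obj(1)[OF S] simple_obj(1)[OF T] zero_hom by blast
  then show ?thesis using False by simp
qed

abbreviation "\<Lambda> \<equiv> simple_classes C"

lemma rep_simple: assumes "s \<in> \<Lambda>"
  shows "simple_object C (rep_obj s)" "iso_class C (rep_obj s) = s" "rep_obj s \<in> Obj C"
proof -
  obtain X where X: "simple_object C X" "s = iso_class C X" using assms by (auto simp: simple_classes_def)
  have Xo: "X \<in> Obj C" using simple_obj[OF X(1)] by simp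
  have "X \<in> s" using X Xo isomorphic_refl by (auto simp: iso_class_def)
  then have "rep_obj s \<in> s" unfolding rep_obj_def by (rule someI)
  then have i: "isomorphic C X (rep_obj s)" and o: "rep_obj s \<in> Obj C" using X by (auto simp: iso_class_def)
  show "simple_object C (rep_obj s)" by (rule simple_isomorphic[OF X(1) i])
  show "iso_class C (rep_obj s) = s" using iso_class_eq_iff[OF Xo o] i X by simp
  show "rep_obj s \<in> Obj C" by (rule o)
qed

lemma iso_class_simple: "simple_object C X \<Longrightarrow> iso_class C X \<in> \<Lambda>"
  by (auto simp: simple_classes_def)

lemma rep_iso_class: assumes "simple_object C X" shows "isomorphic C (rep_obj (iso_class C X)) X"
  using iso_class_eq_iff rep_simple[OF iso_class_simple[OF assms]] simple_obj(1)[OF assms] by blast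

lemma hdim_rep: assumes "s \<in> \<Lambda>" "simple_object C X"
  shows "hdim (rep_obj s) X = (if s = iso_class C X then 1 else 0)"
  using hdim_simple[OF rep_simple(1)[OF assms(1)] assms(2)] rep_simple[OF assms(1)]
    iso_class_eq_iff[OF _ simple_obj(1)[OF assms(2)], of "rep_obj s"] by simp

lemma hdim_rep_rep: assumes "s \<in> \<Lambda>" "t \<in> \<Lambda>"
  shows "hdim (rep_obj s) (rep_obj t) = (if s = t then 1 else 0)"
  using hdim_rep[OF assms(1) rep_simple(1)[OF assms(2)]] rep_simple(2)[OF assms(2)] by simp

text \<open>An additive function on objects is determined by its values on simple objects. This is
  how all multiplicities in tensor products and in images of functors are computed.\<close>

lemma additive_expansion:
  fixes \<phi> :: "'o \<Rightarrow> nat"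
  assumes add: "\<And>Xs B. is_direct_sum C Xs B \<Longrightarrow> \<phi> B = (\<Sum>i<length Xs. \<phi> (Xs ! i))"
    and X: "X \<in> Obj C"
  shows "\<phi> X = (\<Sum>s\<in>\<Lambda>. hdim (rep_obj s) X * \<phi> (rep_obj s))"
proof -
  obtain Ss inc prj where Ss: "\<And>S. S \<in> set Ss \<Longrightarrow> simple_object C S"
    and bp: "is_biproduct C Ss X inc prj"
    using semisimple[OF X] by (auto simp: is_direct_sum_def)
  have simple: "simple_object C (Ss ! i)" if "i < length Ss" for i using Ss that by simp
  have \<phi>_iso: "\<phi> Z = \<phi> Y" if "isomorphic C Z Y" for Y Z
    using add[OF isomorphic_direct_sum[OF that]] by simp
  have "(\<Sum>s\<in>\<Lambda>. hdim (rep_obj s) X * \<phi> (rep_obj s))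
      = (\<Sum>s\<in>\<Lambda>. \<Sum>i<length Ss. hdim (rep_obj s) (Ss ! i) * \<phi> (rep_obj s))"
    by (rule sum.cong[OF refl]) (simp add: hdim_biproduct_right[OF bp] rep_simple sum_distrib_right)
  also have "\<dots> = (\<Sum>i<length Ss. \<Sum>s\<in>\<Lambda>. hdim (rep_obj s) (Ss ! i) * \<phi> (rep_obj s))"
    by (rule sum.swap)
  also have "\<dots> = (\<Sum>i<length Ss. \<Sum>s\<in>\<Lambda>. if s = iso_class C (Ss ! i) then \<phi> (rep_obj s) else 0)"
    by (intro sum.cong refl) (simp add: hdim_rep simple)
  also have "\<dots> = (\<Sum>i<length Ss. \<phi> (rep_obj (iso_class C (Ss ! i))))"
    by (intro sum.cong refl) (simp add: finite_simples iso_class_simple simple)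
  also have "\<dots> = (\<Sum>i<length Ss. \<phi> (Ss ! i))"
    by (intro sum.cong refl \<phi>_iso rep_iso_class) (simp add: simple)
  also have "\<dots> = \<phi> X"
  proof -
    have "is_direct_sum C Ss X" using bp by (auto simp: is_direct_sum_def)
    then show ?thesis by (rule add[symmetric])
  qed
  finally show ?thesis by simp
qed

text \<open>Both sides count the summands of \<open>X\<close> that are isomorphic to \<open>T\<close>.\<close>

lemma hdim_symmetric: assumes X: "X \<in> Obj C" and T: "simple_object C T"
  shows "hdim X T = hdim T X"
proof -
  note To = simple_obj(1)[OF T]
  have "hdim X T = (\<Sum>s\<in>\<Lambda>. hdim (rep_obj s) X * hdim (rep_obj s) T)"
    by (rule additive_expansion[OF _ X]) (auto simp: is_direct_sum_def hdim_biproduct_left To)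
  also have "\<dots> = (\<Sum>s\<in>\<Lambda>. if s = iso_class C T then hdim (rep_obj s) X else 0)"
    by (intro sum.cong refl) (simp add: hdim_rep T)
  also have "\<dots> = hdim (rep_obj (iso_class C T)) X"
    by (simp add: finite_simples iso_class_simple T)
  also have "\<dots> = hdim T X" by (rule hdim_isomorphic_left[OF rep_iso_class[OF T] X])
  finally show ?thesis .
qed

end

section \<open>Duality\<close>

context tensor_category begin

text \<open>The adjunction arguments below use one of the two snake identities, and only through
  the fact that its composite is invertible. This avoids the coherence of the unit constraints
  with the associator.\<close>

lemma dual_snake:
  assumes "is_dual C Y X"
  obtains ev coev where "ev \<in> Hom C (Y \<otimes>\<^sub>o X) \<one>\<^sub>o" "coev \<in> Hom C \<one>\<^sub>o (X \<otimes>\<^sub>o Y)"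
    "(ev \<otimes>\<^sub>a Ident C Y) \<cdot> inv_arr C (Assoc C Y X Y) \<cdot> (Ident C Y \<otimes>\<^sub>a coev) \<in> Hom C (Y \<otimes>\<^sub>o \<one>\<^sub>o) (\<one>\<^sub>o \<otimes>\<^sub>o Y)"
    "iso_arr C ((ev \<otimes>\<^sub>a Ident C Y) \<cdot> inv_arr C (Assoc C Y X Y) \<cdot> (Ident C Y \<otimes>\<^sub>a coev))"
proof -
  have X: "X \<in> Obj C" and Y: "Y \<in> Obj C" using assms by (auto simp: is_dual_def)
  obtain ev coev where ev: "ev \<in> Hom C (Y \<otimes>\<^sub>o X) \<one>\<^sub>o" and coev: "coev \<in> Hom C \<one>\<^sub>o (X \<otimes>\<^sub>o Y)"
    and snake: "LUnit C Y \<cdot> (ev \<otimes>\<^sub>a Ident C Y) \<cdot> inv_arr C (Assoc C Y X Y) \<cdot> (Ident C Y \<otimes>\<^sub>a coev) = RUnit C Y"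
    using assms unfolding is_dual_def by blast
  define s where "s = (ev \<otimes>\<^sub>a Ident C Y) \<cdot> inv_arr C (Assoc C Y X Y) \<cdot> (Ident C Y \<otimes>\<^sub>a coev)"
  note iY = ident_hom[OF Y]
  note a = inv_arr(1)[OF assoc_iso[OF Y X Y] assoc_hom[OF Y X Y]]
  have s: "s \<in> Hom C (Y \<otimes>\<^sub>o \<one>\<^sub>o) (\<one>\<^sub>o \<otimes>\<^sub>o Y)" unfolding s_def
    by (rule comp_hom[OF comp_hom[OF tensor_hom[OF iY coev] a] tensor_hom[OF ev iY]])
  note L = lunit_iso[OF Y] lunit_hom[OF Y]
  have "LUnit C Y \<cdot> s = RUnit C Y" using snake by (simp add: s_def)
  then have "inv_arr C (LUnit C Y) \<cdot> RUnit C Y = (inv_arr C (LUnit C Y) \<cdot> LUnit C Y) \<cdot> s"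
    using comp_assoc[OF s L(2) inv_arr(1)[OF L]] by simp
  then have "s = inv_arr C (LUnit C Y) \<cdot> RUnit C Y"
    using inv_arr(2)[OF L] comp_ident_left[OF s] by simp
  then have "iso_arr C s"
    using iso_comp[OF runit_iso[OF Y] runit_hom[OF Y] iso_inv_arr[OF L] inv_arr(1)[OF L]] by simp
  then show thesis using that[OF ev coev] s by (simp add: s_def)
qed

lemma inv_arr_natural:
  assumes "iso_arr C a" "a \<in> Hom C X X'" "iso_arr C b" "b \<in> Hom C Y Y'"
    and "f \<in> Hom C X Y" "g \<in> Hom C X' Y'" "b \<cdot> f = g \<cdot> a"
  shows "inv_arr C b \<cdot> g = f \<cdot> inv_arr C a"
proof -
  note ia = inv_arr[OF assms(1,2)] and ib = inv_arr[OF assms(3,4)]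
  have "(b \<cdot> f) \<cdot> inv_arr C a = g"
    using assms(7) comp_assoc[OF ia(1) assms(2,6)] ia(3) comp_ident_right[OF assms(6)] by simp
  then have "g = b \<cdot> f \<cdot> inv_arr C a" using comp_assoc[OF ia(1) assms(5,4)] by simp
  then show ?thesis
    using comp_assoc[OF comp_hom[OF ia(1) assms(5)] assms(4) ib(1)] ib(2)
      comp_ident_left[OF comp_hom[OF ia(1) assms(5)]] by simp
qed

lemma inv_assoc_natural:
  assumes "f \<in> Hom C X X'" "g \<in> Hom C Y Y'" "h \<in> Hom C Z Z'"
  shows "inv_arr C (Assoc C X' Y' Z') \<cdot> (f \<otimes>\<^sub>a (g \<otimes>\<^sub>a h)) = ((f \<otimes>\<^sub>a g) \<otimes>\<^sub>a h) \<cdot> inv_arr C (Assoc C X Y Z)"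
proof -
  note o = in_Hom[OF assms(1)] in_Hom[OF assms(2)] in_Hom[OF assms(3)]
  show ?thesis
    by (rule inv_arr_natural[OF assoc_iso assoc_hom assoc_iso assoc_hom
          tensor_hom[OF tensor_hom[OF assms(1,2)] assms(3)] tensor_hom[OF assms(1) tensor_hom[OF assms(2,3)]]
          assoc_natural[OF assms]]) (use o in auto)
qed

lemma tensor_interchange:
  assumes f: "f \<in> Hom C X X'" and g: "g \<in> Hom C Y Y'"
  shows "(f \<otimes>\<^sub>a Ident C Y') \<cdot> (Ident C X \<otimes>\<^sub>a g) = f \<otimes>\<^sub>a g"
    "(Ident C X' \<otimes>\<^sub>a g) \<cdot> (f \<otimes>\<^sub>a Ident C Y) = f \<otimes>\<^sub>a g"
  using tensor_comp[OF ident_hom f g ident_hom] tensor_comp[OF f ident_hom ident_hom g]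
    in_Hom[OF f] in_Hom[OF g] comp_ident_right[OF f] comp_ident_left[OF f]
    comp_ident_right[OF g] comp_ident_left[OF g] by simp_all

lemma tensor_left_comp:
  assumes "X \<in> Obj C" "f \<in> Hom C A B" "g \<in> Hom C B D"
  shows "Ident C X \<otimes>\<^sub>a (g \<cdot> f) = (Ident C X \<otimes>\<^sub>a g) \<cdot> (Ident C X \<otimes>\<^sub>a f)"
  by (rule additive_functor.g_comp[OF tensor_left_additive[OF assms(1)] assms(2,3)])

lemma tensor_right_comp:
  assumes "X \<in> Obj C" "f \<in> Hom C A B" "g \<in> Hom C B D"
  shows "(g \<cdot> f) \<otimes>\<^sub>a Ident C X = (g \<otimes>\<^sub>a Ident C X) \<cdot> (f \<otimes>\<^sub>a Ident C X)"
  by (rule additive_functor.g_comp[OF tensor_right_additive[OF assms(1)] assms(2,3)])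

lemma iso_tensor_left: "\<lbrakk>X \<in> Obj C; iso_arr C f; f \<in> Hom C A B\<rbrakk> \<Longrightarrow> iso_arr C (Ident C X \<otimes>\<^sub>a f)"
  by (rule additive_functor.iso_image[OF tensor_left_additive])

lemma iso_tensor_right: "\<lbrakk>X \<in> Obj C; iso_arr C f; f \<in> Hom C A B\<rbrakk> \<Longrightarrow> iso_arr C (f \<otimes>\<^sub>a Ident C X)"
  by (rule additive_functor.iso_image[OF tensor_right_additive])

lemma unit_tensor_faithful:
  assumes f: "f \<in> Hom C X Y" and g: "g \<in> Hom C X Y"
  shows "Ident C \<one>\<^sub>o \<otimes>\<^sub>a f = Ident C \<one>\<^sub>o \<otimes>\<^sub>a g \<Longrightarrow> f = g"
    "f \<otimes>\<^sub>a Ident C \<one>\<^sub>o = g \<otimes>\<^sub>a Ident C \<one>\<^sub>o \<Longrightarrow> f = g"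
proof -
  have X: "X \<in> Obj C" using in_Hom[OF f] by simp
  show "f = g" if "Ident C \<one>\<^sub>o \<otimes>\<^sub>a f = Ident C \<one>\<^sub>o \<otimes>\<^sub>a g"
    by (rule iso_cancel_right[OF lunit_iso[OF X] lunit_hom[OF X] f g])
      (use lunit_natural[OF f] lunit_natural[OF g] that in simp)
  show "f = g" if "f \<otimes>\<^sub>a Ident C \<one>\<^sub>o = g \<otimes>\<^sub>a Ident C \<one>\<^sub>o"
    by (rule iso_cancel_right[OF runit_iso[OF X] runit_hom[OF X] f g])
      (use runit_natural[OF f] runit_natural[OF g] that in simp)
qed

lemma tensor_arr:
  assumes "f \<in> Arr C" "g \<in> Arr C"
  shows "f \<otimes>\<^sub>a g \<in> Arr C" "Src C (f \<otimes>\<^sub>a g) = Src C f \<otimes>\<^sub>o Src C g"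
    "Trg C (f \<otimes>\<^sub>a g) = Trg C f \<otimes>\<^sub>o Trg C g"
  using tensor_hom[of f "Src C f" "Trg C f" g "Src C g" "Trg C g"] assms by (auto simp: Hom_def)

lemma assoc_arr:
  assumes "X \<in> Obj C" "Y \<in> Obj C" "Z \<in> Obj C"
  shows "Assoc C X Y Z \<in> Arr C" "Src C (Assoc C X Y Z) = (X \<otimes>\<^sub>o Y) \<otimes>\<^sub>o Z"
    "Trg C (Assoc C X Y Z) = X \<otimes>\<^sub>o (Y \<otimes>\<^sub>o Z)"
    "inv_arr C (Assoc C X Y Z) \<in> Arr C" "Src C (inv_arr C (Assoc C X Y Z)) = X \<otimes>\<^sub>o (Y \<otimes>\<^sub>o Z)"
    "Trg C (inv_arr C (Assoc C X Y Z)) = (X \<otimes>\<^sub>o Y) \<otimes>\<^sub>o Z"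
  using in_Hom[OF assoc_hom[OF assms]] in_Hom[OF inv_arr(1)[OF assoc_iso[OF assms] assoc_hom[OF assms]]]
  by simp_all

lemma inv_assoc:
  assumes "X \<in> Obj C" "Y \<in> Obj C" "Z \<in> Obj C"
  shows "inv_arr C (Assoc C X Y Z) \<in> Hom C (X \<otimes>\<^sub>o (Y \<otimes>\<^sub>o Z)) ((X \<otimes>\<^sub>o Y) \<otimes>\<^sub>o Z)"
    "inv_arr C (Assoc C X Y Z) \<cdot> Assoc C X Y Z = Ident C ((X \<otimes>\<^sub>o Y) \<otimes>\<^sub>o Z)"
    "Assoc C X Y Z \<cdot> inv_arr C (Assoc C X Y Z) = Ident C (X \<otimes>\<^sub>o (Y \<otimes>\<^sub>o Z))"
    "iso_arr C (inv_arr C (Assoc C X Y Z))"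
  using inv_arr[OF assoc_iso[OF assms] assoc_hom[OF assms]]
    iso_inv_arr[OF assoc_iso[OF assms] assoc_hom[OF assms]] by simp_all

text \<open>Sending \<open>f\<close> to its mate \<open>(X \<otimes> f) \<circ> a \<circ> (coev \<otimes> A)\<close> is injective. Indeed, tensoring the
  mate with \<open>Y\<close> and applying the evaluation yields \<open>(1 \<otimes> f) \<circ> \<theta>\<close> for an arrow \<open>\<theta>\<close> that does
  not depend on \<open>f\<close>, and by the pentagon \<open>\<theta>\<close> is the snake composite of \<open>Y\<close> tensored with \<open>A\<close>,
  up to associators; so it is invertible.\<close>

lemma hdim_dual_left:
  assumes dual: "is_dual C Y X" and A: "A \<in> Obj C" and B: "B \<in> Obj C"
  shows "hdim (Y \<otimes>\<^sub>o A) B \<le> hdim A (X \<otimes>\<^sub>o B)"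
proof -
  have X: "X \<in> Obj C" and Y: "Y \<in> Obj C" using dual by (auto simp: is_dual_def)
  let ?a = "Assoc C" and ?i = "Ident C" and ?b = "\<lambda>U V W. inv_arr C (Assoc C U V W)"
  obtain ev coev where ev: "ev \<in> Hom C (Y \<otimes>\<^sub>o X) \<one>\<^sub>o" and coev: "coev \<in> Hom C \<one>\<^sub>o (X \<otimes>\<^sub>o Y)"
    and s: "(ev \<otimes>\<^sub>a ?i Y) \<cdot> ?b Y X Y \<cdot> (?i Y \<otimes>\<^sub>a coev) \<in> Hom C (Y \<otimes>\<^sub>o \<one>\<^sub>o) (\<one>\<^sub>o \<otimes>\<^sub>o Y)"
      "iso_arr C ((ev \<otimes>\<^sub>a ?i Y) \<cdot> ?b Y X Y \<cdot> (?i Y \<otimes>\<^sub>a coev))"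
    by (rule dual_snake[OF dual])
  note iX = ident_hom[OF X] and iY = ident_hom[OF Y] and iA = ident_hom[OF A]
    and i1 = ident_hom[OF unit_obj]
  have YA: "Y \<otimes>\<^sub>o A \<in> Obj C" and XY: "X \<otimes>\<^sub>o Y \<in> Obj C" by (intro tensor_obj X Y A)+
  note typing = comp_assoc_arr comp_arr tensor_arr assoc_arr ident_arr in_Hom[OF ev] in_Hom[OF coev]
    X Y A B unit_obj tensor_obj
  define k where "k = ?a X Y A \<cdot> (coev \<otimes>\<^sub>a ?i A)"
  have k: "k \<in> Hom C (\<one>\<^sub>o \<otimes>\<^sub>o A) (X \<otimes>\<^sub>o (Y \<otimes>\<^sub>o A))"
    unfolding k_def by (rule comp_hom[OF tensor_hom[OF coev iA] assoc_hom[OF X Y A]])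
  define \<Phi> where "\<Phi> f = (?i X \<otimes>\<^sub>a f) \<cdot> k" for f
  have lin: "\<Phi> \<in> module_hom K (hom_space C (Y \<otimes>\<^sub>o A) B) (hom_space C (\<one>\<^sub>o \<otimes>\<^sub>o A) (X \<otimes>\<^sub>o B))"
    unfolding module_hom_def \<Phi>_def
    by (auto simp: tensor_plus_right[OF iX] tensor_scale_right[OF _ iX]
          comp_plus_left[OF k tensor_hom[OF iX] tensor_hom[OF iX]] comp_scale_left[OF _ k tensor_hom[OF iX]]
        intro: comp_hom[OF k tensor_hom[OF iX]])
  define p where "p = ev \<otimes>\<^sub>a ?i (Y \<otimes>\<^sub>o A)"
  define q where "q = ?b Y X (Y \<otimes>\<^sub>o A)"
  define r where "r = ?i Y \<otimes>\<^sub>a ?a X Y A"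
  define t where "t = ?i Y \<otimes>\<^sub>a (coev \<otimes>\<^sub>a ?i A)"
  define \<theta> where "\<theta> = p \<cdot> q \<cdot> r \<cdot> t"
  have \<theta>_hom: "\<theta> \<in> Hom C (Y \<otimes>\<^sub>o (\<one>\<^sub>o \<otimes>\<^sub>o A)) (\<one>\<^sub>o \<otimes>\<^sub>o (Y \<otimes>\<^sub>o A))"
    unfolding \<theta>_def p_def q_def r_def t_def
    by (rule comp_hom[OF comp_hom[OF comp_hom[OF tensor_hom[OF iY tensor_hom[OF coev iA]]
            tensor_hom[OF iY assoc_hom[OF X Y A]]] inv_assoc(1)[OF Y X YA]] tensor_hom[OF ev ident_hom[OF YA]]])
  have \<Phi>_\<theta>: "(ev \<otimes>\<^sub>a ?i B) \<cdot> ?b Y X B \<cdot> (?i Y \<otimes>\<^sub>a \<Phi> f) = (?i \<one>\<^sub>o \<otimes>\<^sub>a f) \<cdot> \<theta>"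
    if f: "f \<in> Hom C (Y \<otimes>\<^sub>o A) B" for f
  proof -
    note typing = typing in_Hom[OF f]
    have 1: "?i Y \<otimes>\<^sub>a \<Phi> f = (?i Y \<otimes>\<^sub>a (?i X \<otimes>\<^sub>a f)) \<cdot> r \<cdot> t"
      using tensor_left_comp[OF Y k tensor_hom[OF iX f]]
        tensor_left_comp[OF Y tensor_hom[OF coev iA] assoc_hom[OF X Y A]]
      by (simp add: \<Phi>_def k_def r_def t_def)
    have 2: "?b Y X B \<cdot> (?i Y \<otimes>\<^sub>a (?i X \<otimes>\<^sub>a f)) = (?i (Y \<otimes>\<^sub>o X) \<otimes>\<^sub>a f) \<cdot> q"
      using inv_assoc_natural[OF iY iX f] tensor_ident[OF Y X] by (simp add: q_def)
    have 3: "(ev \<otimes>\<^sub>a ?i B) \<cdot> (?i (Y \<otimes>\<^sub>o X) \<otimes>\<^sub>a f) = (?i \<one>\<^sub>o \<otimes>\<^sub>a f) \<cdot> p"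
      using tensor_interchange[OF ev f] by (simp add: p_def)
    have "(ev \<otimes>\<^sub>a ?i B) \<cdot> ?b Y X B \<cdot> (?i Y \<otimes>\<^sub>a \<Phi> f)
        = (ev \<otimes>\<^sub>a ?i B) \<cdot> (?b Y X B \<cdot> (?i Y \<otimes>\<^sub>a (?i X \<otimes>\<^sub>a f))) \<cdot> r \<cdot> t"
      unfolding 1 by (simp add: typing r_def t_def)
    also have "\<dots> = ((ev \<otimes>\<^sub>a ?i B) \<cdot> (?i (Y \<otimes>\<^sub>o X) \<otimes>\<^sub>a f)) \<cdot> q \<cdot> r \<cdot> t"
      unfolding 2 by (simp add: typing q_def r_def t_def)
    also have "\<dots> = (?i \<one>\<^sub>o \<otimes>\<^sub>a f) \<cdot> \<theta>"
      unfolding 3 by (simp add: typing \<theta>_def p_def q_def r_def t_def)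
    finally show ?thesis .
  qed
  have \<theta>_iso: "iso_arr C \<theta>"
  proof -
    define m where "m = (ev \<otimes>\<^sub>a ?i Y) \<cdot> ?b Y X Y \<cdot> (?i Y \<otimes>\<^sub>a coev)"
    define e where "e = (ev \<otimes>\<^sub>a ?i Y) \<otimes>\<^sub>a ?i A"
    define c where "c = (?i Y \<otimes>\<^sub>a coev) \<otimes>\<^sub>a ?i A"
    define g where "g = ?a Y X Y \<otimes>\<^sub>a ?i A"
    define h where "h = ?b Y X Y \<otimes>\<^sub>a ?i A"
    note defs = p_def q_def r_def t_def e_def c_def g_def h_def
    have m: "m \<in> Hom C (Y \<otimes>\<^sub>o \<one>\<^sub>o) (\<one>\<^sub>o \<otimes>\<^sub>o Y)" "iso_arr C m" using s by (simp_all add: m_def)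
    have gh: "g \<cdot> h = ?i ((Y \<otimes>\<^sub>o (X \<otimes>\<^sub>o Y)) \<otimes>\<^sub>o A)"
      using tensor_right_comp[OF A inv_assoc(1)[OF Y X Y] assoc_hom[OF Y X Y]] inv_assoc(3)[OF Y X Y]
        tensor_ident[OF tensor_obj[OF Y XY] A] by (simp add: g_def h_def)
    have pent: "?a Y X (Y \<otimes>\<^sub>o A) \<cdot> ?a (Y \<otimes>\<^sub>o X) Y A = r \<cdot> ?a Y (X \<otimes>\<^sub>o Y) A \<cdot> g"
      using pentagon[OF Y X Y A] by (simp add: r_def g_def)
    have 2: "?b Y (X \<otimes>\<^sub>o Y) A \<cdot> t = c \<cdot> ?b Y \<one>\<^sub>o A"
      unfolding t_def c_def by (rule inv_assoc_natural[OF iY coev iA])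
    have 3: "?a \<one>\<^sub>o Y A \<cdot> e = p \<cdot> ?a (Y \<otimes>\<^sub>o X) Y A"
      using assoc_natural[OF ev iY iA] tensor_ident[OF Y A] by (simp add: e_def p_def)
    \<comment> \<open>The pentagon, with all associators but one moved to the other side.\<close>
    have mate: "q \<cdot> r = ?a (Y \<otimes>\<^sub>o X) Y A \<cdot> h \<cdot> ?b Y (X \<otimes>\<^sub>o Y) A" (is "_ = ?rhs")
    proof -
      have r: "r \<in> Hom C (Y \<otimes>\<^sub>o ((X \<otimes>\<^sub>o Y) \<otimes>\<^sub>o A)) (Y \<otimes>\<^sub>o (X \<otimes>\<^sub>o (Y \<otimes>\<^sub>o A)))"
        unfolding r_def by (rule tensor_hom[OF iY assoc_hom[OF X Y A]])
      have rhs: "?rhs \<in> Hom C (Y \<otimes>\<^sub>o ((X \<otimes>\<^sub>o Y) \<otimes>\<^sub>o A)) ((Y \<otimes>\<^sub>o X) \<otimes>\<^sub>o (Y \<otimes>\<^sub>o A))"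
        by (rule HomI) (simp_all add: typing h_def)
      have "q \<cdot> r = q \<cdot> r \<cdot> ?a Y (X \<otimes>\<^sub>o Y) A \<cdot> (g \<cdot> h) \<cdot> ?b Y (X \<otimes>\<^sub>o Y) A"
        using gh inv_assoc(3)[OF Y XY A] comp_ident_left[OF inv_assoc(1)[OF Y XY A]] comp_ident_right[OF r]
        by simp
      also have "\<dots> = q \<cdot> (r \<cdot> ?a Y (X \<otimes>\<^sub>o Y) A \<cdot> g) \<cdot> h \<cdot> ?b Y (X \<otimes>\<^sub>o Y) A"
        by (simp add: typing defs)
      also have "\<dots> = (q \<cdot> ?a Y X (Y \<otimes>\<^sub>o A)) \<cdot> ?rhs"
        unfolding pent[symmetric] by (simp add: typing defs)
      also have "\<dots> = ?rhs" using inv_assoc(2)[OF Y X YA] comp_ident_left[OF rhs] by (simp add: q_def)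
      finally show ?thesis .
    qed
    have "\<theta> = p \<cdot> (q \<cdot> r) \<cdot> t" by (simp add: \<theta>_def typing defs)
    also have "\<dots> = (p \<cdot> ?a (Y \<otimes>\<^sub>o X) Y A) \<cdot> h \<cdot> (?b Y (X \<otimes>\<^sub>o Y) A \<cdot> t)"
      unfolding mate by (simp add: typing defs)
    also have "\<dots> = ?a \<one>\<^sub>o Y A \<cdot> (e \<cdot> h \<cdot> c) \<cdot> ?b Y \<one>\<^sub>o A"
      unfolding 2 3[symmetric] by (simp add: typing defs)
    also have "e \<cdot> h \<cdot> c = m \<otimes>\<^sub>a ?i A"
      using tensor_right_comp[OF A comp_hom[OF tensor_hom[OF iY coev] inv_assoc(1)[OF Y X Y]] tensor_hom[OF ev iY]]
        tensor_right_comp[OF A tensor_hom[OF iY coev] inv_assoc(1)[OF Y X Y]]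
      by (simp add: m_def e_def h_def c_def)
    finally have "\<theta> = ?a \<one>\<^sub>o Y A \<cdot> (m \<otimes>\<^sub>a ?i A) \<cdot> ?b Y \<one>\<^sub>o A" .
    then show ?thesis
      using iso_comp[OF iso_comp[OF inv_assoc(4)[OF Y unit_obj A] inv_assoc(1)[OF Y unit_obj A]
            iso_tensor_right[OF A m(2,1)] tensor_hom[OF m(1) iA]]
          comp_hom[OF inv_assoc(1)[OF Y unit_obj A] tensor_hom[OF m(1) iA]]
          assoc_iso[OF unit_obj Y A] assoc_hom[OF unit_obj Y A]] by simp
  qed
  have inj: "inj_on \<Phi> (Hom C (Y \<otimes>\<^sub>o A) B)"
  proof (rule inj_onI)
    fix f g assume f: "f \<in> Hom C (Y \<otimes>\<^sub>o A) B" and g: "g \<in> Hom C (Y \<otimes>\<^sub>o A) B" and "\<Phi> f = \<Phi> g"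
    then have "(?i \<one>\<^sub>o \<otimes>\<^sub>a f) \<cdot> \<theta> = (?i \<one>\<^sub>o \<otimes>\<^sub>a g) \<cdot> \<theta>" by (simp flip: \<Phi>_\<theta>)
    then have "?i \<one>\<^sub>o \<otimes>\<^sub>a f = ?i \<one>\<^sub>o \<otimes>\<^sub>a g"
      by (rule iso_cancel_right[OF \<theta>_iso \<theta>_hom tensor_hom[OF i1 f] tensor_hom[OF i1 g]])
    then show "f = g" by (rule unit_tensor_faithful(1)[OF f g])
  qed
  have "hdim (Y \<otimes>\<^sub>o A) B \<le> hdim (\<one>\<^sub>o \<otimes>\<^sub>o A) (X \<otimes>\<^sub>o B)"
    by (rule hdim_le_of_injective[OF YA B tensor_obj[OF unit_obj A] tensor_obj[OF X B] lin inj])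
  also have "\<dots> = hdim A (X \<otimes>\<^sub>o B)"
    by (rule hdim_isomorphic_left[OF unit_isomorphic(1)[OF A] tensor_obj[OF X B]])
  finally show ?thesis .
qed

text \<open>The mirror image of the previous argument, again with the snake composite of \<open>Y\<close>.\<close>

lemma hdim_dual_right:
  assumes dual: "is_dual C Y X" and A: "A \<in> Obj C" and B: "B \<in> Obj C"
  shows "hdim A (B \<otimes>\<^sub>o Y) \<le> hdim (A \<otimes>\<^sub>o X) B"
proof -
  have X: "X \<in> Obj C" and Y: "Y \<in> Obj C" using dual by (auto simp: is_dual_def)
  let ?a = "Assoc C" and ?i = "Ident C" and ?b = "\<lambda>U V W. inv_arr C (Assoc C U V W)"
  obtain ev coev where ev: "ev \<in> Hom C (Y \<otimes>\<^sub>o X) \<one>\<^sub>o" and coev: "coev \<in> Hom C \<one>\<^sub>o (X \<otimes>\<^sub>o Y)"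
    and s: "(ev \<otimes>\<^sub>a ?i Y) \<cdot> ?b Y X Y \<cdot> (?i Y \<otimes>\<^sub>a coev) \<in> Hom C (Y \<otimes>\<^sub>o \<one>\<^sub>o) (\<one>\<^sub>o \<otimes>\<^sub>o Y)"
      "iso_arr C ((ev \<otimes>\<^sub>a ?i Y) \<cdot> ?b Y X Y \<cdot> (?i Y \<otimes>\<^sub>a coev))"
    by (rule dual_snake[OF dual])
  note iX = ident_hom[OF X] and iY = ident_hom[OF Y] and iB = ident_hom[OF B]
    and i1 = ident_hom[OF unit_obj]
  have BY: "B \<otimes>\<^sub>o Y \<in> Obj C" and YX: "Y \<otimes>\<^sub>o X \<in> Obj C"
    by (intro tensor_obj X Y B)+
  note typing = comp_assoc_arr comp_arr tensor_arr assoc_arr ident_arr in_Hom[OF ev] in_Hom[OF coev]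
    X Y A B unit_obj tensor_obj
  define k where "k = (?i B \<otimes>\<^sub>a ev) \<cdot> ?a B Y X"
  have k: "k \<in> Hom C ((B \<otimes>\<^sub>o Y) \<otimes>\<^sub>o X) (B \<otimes>\<^sub>o \<one>\<^sub>o)"
    unfolding k_def by (rule comp_hom[OF assoc_hom[OF B Y X] tensor_hom[OF iB ev]])
  define \<Phi> where "\<Phi> f = k \<cdot> (f \<otimes>\<^sub>a ?i X)" for f
  have lin: "\<Phi> \<in> module_hom K (hom_space C A (B \<otimes>\<^sub>o Y)) (hom_space C (A \<otimes>\<^sub>o X) (B \<otimes>\<^sub>o \<one>\<^sub>o))"
    unfolding module_hom_def \<Phi>_def
    by (auto simp: tensor_plus_left[OF _ _ iX] tensor_scale_left[OF _ _ iX]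
          comp_plus_right[OF tensor_hom[OF _ iX] tensor_hom[OF _ iX] k] comp_scale_right[OF _ tensor_hom[OF _ iX] k]
        intro: comp_hom[OF tensor_hom[OF _ iX] k])
  define p where "p = (?i B \<otimes>\<^sub>a ev) \<otimes>\<^sub>a ?i Y"
  define q where "q = ?a B Y X \<otimes>\<^sub>a ?i Y"
  define r where "r = ?b (B \<otimes>\<^sub>o Y) X Y"
  define t where "t = ?i (B \<otimes>\<^sub>o Y) \<otimes>\<^sub>a coev"
  define \<theta> where "\<theta> = p \<cdot> q \<cdot> r \<cdot> t"
  have \<theta>_hom: "\<theta> \<in> Hom C ((B \<otimes>\<^sub>o Y) \<otimes>\<^sub>o \<one>\<^sub>o) ((B \<otimes>\<^sub>o \<one>\<^sub>o) \<otimes>\<^sub>o Y)"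
    unfolding \<theta>_def p_def q_def r_def t_def
    by (rule comp_hom[OF comp_hom[OF comp_hom[OF tensor_hom[OF ident_hom[OF BY] coev]
            inv_assoc(1)[OF BY X Y]] tensor_hom[OF assoc_hom[OF B Y X] iY]] tensor_hom[OF tensor_hom[OF iB ev] iY]])
  have \<Phi>_\<theta>: "(\<Phi> f \<otimes>\<^sub>a ?i Y) \<cdot> ?b A X Y \<cdot> (?i A \<otimes>\<^sub>a coev) = \<theta> \<cdot> (f \<otimes>\<^sub>a ?i \<one>\<^sub>o)"
    if f: "f \<in> Hom C A (B \<otimes>\<^sub>o Y)" for f
  proof -
    note typing = typing in_Hom[OF f]
    define f1 where "f1 = (f \<otimes>\<^sub>a ?i X) \<otimes>\<^sub>a ?i Y"
    have 1: "\<Phi> f \<otimes>\<^sub>a ?i Y = (p \<cdot> q) \<cdot> f1"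
      using tensor_right_comp[OF Y tensor_hom[OF f iX] k]
        tensor_right_comp[OF Y assoc_hom[OF B Y X] tensor_hom[OF iB ev]]
      by (simp add: \<Phi>_def k_def p_def q_def f1_def)
    have 2: "r \<cdot> (f \<otimes>\<^sub>a ?i (X \<otimes>\<^sub>o Y)) = f1 \<cdot> ?b A X Y"
      using inv_assoc_natural[OF f iX iY] tensor_ident[OF X Y] by (simp add: r_def f1_def)
    have 3: "(f \<otimes>\<^sub>a ?i (X \<otimes>\<^sub>o Y)) \<cdot> (?i A \<otimes>\<^sub>a coev) = t \<cdot> (f \<otimes>\<^sub>a ?i \<one>\<^sub>o)"
      using tensor_interchange[OF f coev] by (simp add: t_def)
    have "(\<Phi> f \<otimes>\<^sub>a ?i Y) \<cdot> ?b A X Y \<cdot> (?i A \<otimes>\<^sub>a coev) = p \<cdot> q \<cdot> (f1 \<cdot> ?b A X Y) \<cdot> (?i A \<otimes>\<^sub>a coev)"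
      unfolding 1 by (simp add: typing p_def q_def f1_def)
    also have "\<dots> = p \<cdot> q \<cdot> r \<cdot> ((f \<otimes>\<^sub>a ?i (X \<otimes>\<^sub>o Y)) \<cdot> (?i A \<otimes>\<^sub>a coev))"
      unfolding 2[symmetric] by (simp add: typing p_def q_def r_def)
    also have "\<dots> = \<theta> \<cdot> (f \<otimes>\<^sub>a ?i \<one>\<^sub>o)"
      unfolding 3 by (simp add: typing \<theta>_def p_def q_def r_def t_def)
    finally show ?thesis .
  qed
  have \<theta>_iso: "iso_arr C \<theta>"
  proof -
    define m where "m = (ev \<otimes>\<^sub>a ?i Y) \<cdot> ?b Y X Y \<cdot> (?i Y \<otimes>\<^sub>a coev)"
    define e where "e = ?i B \<otimes>\<^sub>a (ev \<otimes>\<^sub>a ?i Y)"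
    define c where "c = ?i B \<otimes>\<^sub>a (?i Y \<otimes>\<^sub>a coev)"
    define g where "g = ?i B \<otimes>\<^sub>a ?a Y X Y"
    define h where "h = ?i B \<otimes>\<^sub>a ?b Y X Y"
    note defs = p_def q_def r_def t_def e_def c_def g_def h_def
    have m: "m \<in> Hom C (Y \<otimes>\<^sub>o \<one>\<^sub>o) (\<one>\<^sub>o \<otimes>\<^sub>o Y)" "iso_arr C m" using s by (simp_all add: m_def)
    have hg: "h \<cdot> g = ?i (B \<otimes>\<^sub>o ((Y \<otimes>\<^sub>o X) \<otimes>\<^sub>o Y))"
      using tensor_left_comp[OF B assoc_hom[OF Y X Y] inv_assoc(1)[OF Y X Y]] inv_assoc(2)[OF Y X Y]
        tensor_ident[OF B tensor_obj[OF YX Y]] by (simp add: g_def h_def)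
    have pent: "?a B Y (X \<otimes>\<^sub>o Y) \<cdot> ?a (B \<otimes>\<^sub>o Y) X Y = g \<cdot> ?a B (Y \<otimes>\<^sub>o X) Y \<cdot> q"
      using pentagon[OF B Y X Y] by (simp add: q_def g_def)
    have 2: "?a B Y (X \<otimes>\<^sub>o Y) \<cdot> t = c \<cdot> ?a B Y \<one>\<^sub>o"
      using assoc_natural[OF iB iY coev] tensor_ident[OF B Y] by (simp add: t_def c_def)
    have 3: "?b B \<one>\<^sub>o Y \<cdot> e = p \<cdot> ?b B (Y \<otimes>\<^sub>o X) Y"
      unfolding e_def p_def by (rule inv_assoc_natural[OF iB ev iY])
    have mate: "q \<cdot> r = ?b B (Y \<otimes>\<^sub>o X) Y \<cdot> h \<cdot> ?a B Y (X \<otimes>\<^sub>o Y)" (is "_ = ?rhs")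
    proof -
      have q: "q \<in> Hom C (((B \<otimes>\<^sub>o Y) \<otimes>\<^sub>o X) \<otimes>\<^sub>o Y) ((B \<otimes>\<^sub>o (Y \<otimes>\<^sub>o X)) \<otimes>\<^sub>o Y)"
        unfolding q_def by (rule tensor_hom[OF assoc_hom[OF B Y X] iY])
      have rhs: "?rhs \<in> Hom C ((B \<otimes>\<^sub>o Y) \<otimes>\<^sub>o (X \<otimes>\<^sub>o Y)) ((B \<otimes>\<^sub>o (Y \<otimes>\<^sub>o X)) \<otimes>\<^sub>o Y)"
        by (rule HomI) (simp_all add: typing h_def)
      have "?rhs = ?rhs \<cdot> (?a (B \<otimes>\<^sub>o Y) X Y \<cdot> r)"
        using inv_assoc(3)[OF BY X Y] comp_ident_right[OF rhs] by (simp add: r_def)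
      also have "\<dots> = ?b B (Y \<otimes>\<^sub>o X) Y \<cdot> h \<cdot> (?a B Y (X \<otimes>\<^sub>o Y) \<cdot> ?a (B \<otimes>\<^sub>o Y) X Y) \<cdot> r"
        by (simp add: typing defs)
      also have "\<dots> = ?b B (Y \<otimes>\<^sub>o X) Y \<cdot> (h \<cdot> g) \<cdot> ?a B (Y \<otimes>\<^sub>o X) Y \<cdot> q \<cdot> r"
        unfolding pent by (simp add: typing defs)
      also have "\<dots> = (?b B (Y \<otimes>\<^sub>o X) Y \<cdot> ?a B (Y \<otimes>\<^sub>o X) Y) \<cdot> q \<cdot> r"
        unfolding hg using comp_ident_arr(2)[of "?a B (Y \<otimes>\<^sub>o X) Y \<cdot> q \<cdot> r"] by (simp add: typing defs)
      also have "\<dots> = q \<cdot> r"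
        using inv_assoc(2)[OF B YX Y] comp_ident_left[OF comp_hom[OF inv_assoc(1)[OF BY X Y] q]]
        by (simp add: r_def)
      finally show ?thesis by simp
    qed
    have "\<theta> = p \<cdot> (q \<cdot> r) \<cdot> t" by (simp add: \<theta>_def typing defs)
    also have "\<dots> = (p \<cdot> ?b B (Y \<otimes>\<^sub>o X) Y) \<cdot> h \<cdot> (?a B Y (X \<otimes>\<^sub>o Y) \<cdot> t)"
      unfolding mate by (simp add: typing defs)
    also have "\<dots> = ?b B \<one>\<^sub>o Y \<cdot> (e \<cdot> h \<cdot> c) \<cdot> ?a B Y \<one>\<^sub>o"
      unfolding 2 3[symmetric] by (simp add: typing defs)
    also have "e \<cdot> h \<cdot> c = ?i B \<otimes>\<^sub>a m"
      using tensor_left_comp[OF B comp_hom[OF tensor_hom[OF iY coev] inv_assoc(1)[OF Y X Y]] tensor_hom[OF ev iY]]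
        tensor_left_comp[OF B tensor_hom[OF iY coev] inv_assoc(1)[OF Y X Y]]
      by (simp add: m_def e_def h_def c_def)
    finally have "\<theta> = ?b B \<one>\<^sub>o Y \<cdot> (?i B \<otimes>\<^sub>a m) \<cdot> ?a B Y \<one>\<^sub>o" .
    then show ?thesis
      using iso_comp[OF iso_comp[OF assoc_iso[OF B Y unit_obj] assoc_hom[OF B Y unit_obj]
            iso_tensor_left[OF B m(2,1)] tensor_hom[OF iB m(1)]]
          comp_hom[OF assoc_hom[OF B Y unit_obj] tensor_hom[OF iB m(1)]]
          inv_assoc(4)[OF B unit_obj Y] inv_assoc(1)[OF B unit_obj Y]] by simp
  qed
  have inj: "inj_on \<Phi> (Hom C A (B \<otimes>\<^sub>o Y))"
  proof (rule inj_onI)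
    fix f g assume f: "f \<in> Hom C A (B \<otimes>\<^sub>o Y)" and g: "g \<in> Hom C A (B \<otimes>\<^sub>o Y)" and "\<Phi> f = \<Phi> g"
    then have "\<theta> \<cdot> (f \<otimes>\<^sub>a ?i \<one>\<^sub>o) = \<theta> \<cdot> (g \<otimes>\<^sub>a ?i \<one>\<^sub>o)" by (simp flip: \<Phi>_\<theta>)
    then have "f \<otimes>\<^sub>a ?i \<one>\<^sub>o = g \<otimes>\<^sub>a ?i \<one>\<^sub>o"
      by (rule iso_cancel_left[OF \<theta>_iso \<theta>_hom tensor_hom[OF f i1] tensor_hom[OF g i1]])
    then show "f = g" by (rule unit_tensor_faithful(2)[OF f g])
  qed
  have "hdim A (B \<otimes>\<^sub>o Y) \<le> hdim (A \<otimes>\<^sub>o X) (B \<otimes>\<^sub>o \<one>\<^sub>o)"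
    by (rule hdim_le_of_injective[OF A BY tensor_obj[OF A X] tensor_obj[OF B unit_obj] lin inj])
  also have "\<dots> = hdim (A \<otimes>\<^sub>o X) B"
    by (rule hdim_isomorphic_right[OF unit_isomorphic(2)[OF B] tensor_obj[OF A X]])
  finally show ?thesis .
qed

end

context fusion_category begin

text \<open>If \<open>Y\<close> is zero, then so is the coevaluation, and the snake identity of \<open>X\<close> shows that
  the left unit constraint of \<open>X\<close> vanishes.\<close>

lemma dual_not_zero:
  assumes dual: "is_dual C Y X" and nz: "\<not> zero_object C X"
  shows "\<not> zero_object C Y"
proof
  assume zY: "zero_object C Y"
  have X: "X \<in> Obj C" and Y: "Y \<in> Obj C" using dual by (auto simp: is_dual_def)
  obtain ev coev where ev: "ev \<in> Hom C (Y \<otimes>\<^sub>o X) \<one>\<^sub>o" and coev: "coev \<in> Hom C \<one>\<^sub>o (X \<otimes>\<^sub>o Y)"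
    and snake: "RUnit C X \<cdot> (Ident C X \<otimes>\<^sub>a ev) \<cdot> Assoc C X Y X \<cdot> (coev \<otimes>\<^sub>a Ident C X) = LUnit C X"
    using dual unfolding is_dual_def by blast
  note iX = ident_hom[OF X]
  have XY: "X \<otimes>\<^sub>o Y \<in> Obj C" and I: "\<one>\<^sub>o \<otimes>\<^sub>o X \<in> Obj C"
    by (rule tensor_obj[OF X Y], rule tensor_obj[OF unit_obj X])
  have "zero_object C (X \<otimes>\<^sub>o Y)"
    by (rule additive_functor.zero_object_image[OF tensor_left_additive[OF X] zY])
  then have z: "coev = ZeroArr C \<one>\<^sub>o (X \<otimes>\<^sub>o Y)" using zero_object_hom(2)[OF _ coev] by blast
  have c: "coev \<otimes>\<^sub>a Ident C X = ZeroArr C (\<one>\<^sub>o \<otimes>\<^sub>o X) ((X \<otimes>\<^sub>o Y) \<otimes>\<^sub>o X)"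
    unfolding z by (rule additive_functor.g_zero[OF tensor_right_additive[OF X] unit_obj XY])
  have "RUnit C X \<cdot> (Ident C X \<otimes>\<^sub>a ev) \<cdot> Assoc C X Y X \<cdot> ZeroArr C (\<one>\<^sub>o \<otimes>\<^sub>o X) ((X \<otimes>\<^sub>o Y) \<otimes>\<^sub>o X)
      = ZeroArr C (\<one>\<^sub>o \<otimes>\<^sub>o X) X"
    using comp_zero_right[OF assoc_hom[OF X Y X] I] comp_zero_right[OF tensor_hom[OF iX ev] I]
      comp_zero_right[OF runit_hom[OF X] I] by simp
  then have L: "LUnit C X = ZeroArr C (\<one>\<^sub>o \<otimes>\<^sub>o X) X" using snake c by simp
  note l = lunit_iso[OF X] lunit_hom[OF X]
  have "Ident C X = ZeroArr C X X"
    using inv_arr(3)[OF l] comp_zero_left[OF inv_arr(1)[OF l] X] L by simp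
  then show False using nz zero_object_iff[OF X] by simp
qed

text \<open>Taking mates twice embeds \<open>End(Y)\<close> into \<open>End(X)\<close>, which is one-dimensional.\<close>

lemma dual_simple:
  assumes dual: "is_dual C Y X" and X: "simple_object C X"
  shows "simple_object C Y"
proof (rule simple_if_hdim_le_one)
  have Xo: "X \<in> Obj C" and Y: "Y \<in> Obj C" using dual by (auto simp: is_dual_def)
  show "Y \<in> Obj C" by (rule Y)
  show "\<not> zero_object C Y" using dual_not_zero[OF dual] X by (simp add: simple_object_def)
  have "hdim Y Y = hdim (Y \<otimes>\<^sub>o \<one>\<^sub>o) Y"
    by (rule hdim_isomorphic_left[OF isomorphic_sym[OF unit_isomorphic(2)[OF Y]] Y])
  also have "\<dots> \<le> hdim \<one>\<^sub>o (X \<otimes>\<^sub>o Y)" by (rule hdim_dual_left[OF dual unit_obj Y])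
  also have "\<dots> \<le> hdim (\<one>\<^sub>o \<otimes>\<^sub>o X) X" by (rule hdim_dual_right[OF dual unit_obj Xo])
  also have "\<dots> = hdim X X" by (rule hdim_isomorphic_left[OF unit_isomorphic(1)[OF Xo] Xo])
  also have "\<dots> = 1" using hdim_simple[OF X X] isomorphic_refl[OF Xo] by simp
  finally show "hdim Y Y \<le> 1" .
qed

section \<open>The fusion ring of a fusion category\<close>

definition fusion_coeff :: "'o set \<Rightarrow> 'o set \<Rightarrow> 'o set \<Rightarrow> nat" where
  "fusion_coeff s t u = hdim (rep_obj u) (rep_obj s \<otimes>\<^sub>o rep_obj t)"

definition dual_class :: "'o set \<Rightarrow> 'o set" where
  "dual_class s = iso_class C (SOME Y. is_dual C Y (rep_obj s))"

lemma hdim_tensor_left: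
  assumes U: "U \<in> Obj C" and X: "X \<in> Obj C" and Y: "Y \<in> Obj C"
  shows "hdim U (X \<otimes>\<^sub>o Y) = (\<Sum>s\<in>\<Lambda>. hdim (rep_obj s) X * hdim U (rep_obj s \<otimes>\<^sub>o Y))"
proof (rule additive_expansion[OF _ X])
  fix Xs B assume "is_direct_sum C Xs B"
  then obtain inc prj where bp: "is_biproduct C Xs B inc prj" by (auto simp: is_direct_sum_def)
  note bp' = additive_functor.biproduct_image[OF tensor_right_additive[OF Y] bp]
  show "hdim U (B \<otimes>\<^sub>o Y) = (\<Sum>i<length Xs. hdim U (Xs ! i \<otimes>\<^sub>o Y))"
    using hdim_biproduct_right[OF bp' U] by simp
qed

lemma hdim_tensor_right:
  assumes U: "U \<in> Obj C" and X: "X \<in> Obj C" and Y: "Y \<in> Obj C"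
  shows "hdim U (X \<otimes>\<^sub>o Y) = (\<Sum>s\<in>\<Lambda>. hdim (rep_obj s) Y * hdim U (X \<otimes>\<^sub>o rep_obj s))"
proof (rule additive_expansion[OF _ Y])
  fix Xs B assume "is_direct_sum C Xs B"
  then obtain inc prj where bp: "is_biproduct C Xs B inc prj" by (auto simp: is_direct_sum_def)
  note bp' = additive_functor.biproduct_image[OF tensor_left_additive[OF X] bp]
  show "hdim U (X \<otimes>\<^sub>o B) = (\<Sum>i<length Xs. hdim U (X \<otimes>\<^sub>o Xs ! i))"
    using hdim_biproduct_right[OF bp' U] by simp
qed

lemma dual_class:
  assumes s: "s \<in> \<Lambda>"
  obtains Y where "is_dual C Y (rep_obj s)" "simple_object C Y" "dual_class s = iso_class C Y"
proof -
  define Y where "Y = (SOME Y. is_dual C Y (rep_obj s))"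
  have "is_dual C Y (rep_obj s)" unfolding Y_def by (rule someI_ex[OF left_dual[OF rep_simple(3)[OF s]]])
  moreover then have "simple_object C Y" by (rule dual_simple[OF _ rep_simple(1)[OF s]])
  ultimately show thesis using that by (simp add: dual_class_def Y_def)
qed

lemma dual_class_simple: assumes "s \<in> \<Lambda>" shows "dual_class s \<in> \<Lambda>"
  using dual_class[OF assms] iso_class_simple by metis

lemma fusion_coeff_dual_le:
  assumes s: "s \<in> \<Lambda>" and t: "t \<in> \<Lambda>" and u: "u \<in> \<Lambda>"
  shows "fusion_coeff (dual_class s) t u \<le> fusion_coeff s u t"
    "fusion_coeff t (dual_class s) u \<le> fusion_coeff u s t"
proof -
  obtain Y where dual: "is_dual C Y (rep_obj s)" and Y: "simple_object C Y" "dual_class s = iso_class C Y"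
    using dual_class[OF s] by blast
  have iso: "isomorphic C (rep_obj (dual_class s)) Y" using rep_iso_class[OF Y(1)] Y(2) by simp
  note so = rep_simple(3)[OF s] and to = rep_simple(3)[OF t] and uo = rep_simple(3)[OF u]
  note Yo = simple_obj(1)[OF Y(1)]
  have "fusion_coeff (dual_class s) t u = hdim (rep_obj u) (Y \<otimes>\<^sub>o rep_obj t)"
    unfolding fusion_coeff_def
    by (rule hdim_isomorphic_right[OF tensor_isomorphic[OF iso isomorphic_refl[OF to]] uo])
  also have "\<dots> = hdim (Y \<otimes>\<^sub>o rep_obj t) (rep_obj u)"
    by (rule hdim_symmetric[OF tensor_obj[OF Yo to] rep_simple(1)[OF u], symmetric])
  also have "\<dots> \<le> hdim (rep_obj t) (rep_obj s \<otimes>\<^sub>o rep_obj u)" by (rule hdim_dual_left[OF dual to uo])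
  finally show "fusion_coeff (dual_class s) t u \<le> fusion_coeff s u t" by (simp add: fusion_coeff_def)
  have "fusion_coeff t (dual_class s) u = hdim (rep_obj u) (rep_obj t \<otimes>\<^sub>o Y)"
    unfolding fusion_coeff_def
    by (rule hdim_isomorphic_right[OF tensor_isomorphic[OF isomorphic_refl[OF to] iso] uo])
  also have "\<dots> \<le> hdim (rep_obj u \<otimes>\<^sub>o rep_obj s) (rep_obj t)" by (rule hdim_dual_right[OF dual uo to])
  also have "\<dots> = hdim (rep_obj t) (rep_obj u \<otimes>\<^sub>o rep_obj s)"
    by (rule hdim_symmetric[OF tensor_obj[OF uo so] rep_simple(1)[OF t]])
  finally show "fusion_coeff t (dual_class s) u \<le> fusion_coeff u s t" by (simp add: fusion_coeff_def)
qed

abbreviation "unit_class \<equiv> iso_class C \<one>\<^sub>o"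

lemma unit_class: "unit_class \<in> \<Lambda>" by (rule iso_class_simple[OF unit_simple])

lemma fusion_coeff_unit:
  assumes t: "t \<in> \<Lambda>" and u: "u \<in> \<Lambda>"
  shows "fusion_coeff unit_class t u = (if t = u then 1 else 0)"
    "fusion_coeff t unit_class u = (if t = u then 1 else 0)"
proof -
  note to = rep_simple(3)[OF t] and uo = rep_simple(3)[OF u]
  note iso = rep_iso_class[OF unit_simple]
  have "isomorphic C (rep_obj unit_class \<otimes>\<^sub>o rep_obj t) (rep_obj t)"
    by (rule isomorphic_trans[OF tensor_isomorphic[OF iso isomorphic_refl[OF to]] unit_isomorphic(1)[OF to]])
  then show "fusion_coeff unit_class t u = (if t = u then 1 else 0)"
    unfolding fusion_coeff_def using hdim_isomorphic_right[OF _ uo] hdim_rep_rep[OF u t] by simp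
  have "isomorphic C (rep_obj t \<otimes>\<^sub>o rep_obj unit_class) (rep_obj t)"
    by (rule isomorphic_trans[OF tensor_isomorphic[OF isomorphic_refl[OF to] iso] unit_isomorphic(2)[OF to]])
  then show "fusion_coeff t unit_class u = (if t = u then 1 else 0)"
    unfolding fusion_coeff_def using hdim_isomorphic_right[OF _ uo] hdim_rep_rep[OF u t] by simp
qed

text \<open>Applying the inequality to \<open>s\<close> and to its dual bounds multiplication by the double
  dual by multiplication by \<open>s\<close>; now multiply the unit.\<close>

lemma dual_class_involutive: assumes s: "s \<in> \<Lambda>" shows "dual_class (dual_class s) = s"
proof -
  note d = dual_class_simple[OF s] and dd = dual_class_simple[OF dual_class_simple[OF s]]
  have "1 = fusion_coeff (dual_class (dual_class s)) unit_class (dual_class (dual_class s))"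
    using fusion_coeff_unit(2)[OF dd dd] by simp
  also have "\<dots> \<le> fusion_coeff (dual_class s) (dual_class (dual_class s)) unit_class"
    by (rule fusion_coeff_dual_le(1)[OF d unit_class dd])
  also have "\<dots> \<le> fusion_coeff s unit_class (dual_class (dual_class s))"
    by (rule fusion_coeff_dual_le(1)[OF s dd unit_class])
  finally show ?thesis using fusion_coeff_unit(2)[OF s dd] by (simp split: if_splits)
qed

text \<open>Since the dual is an involution, each inequality also holds in the other direction.\<close>

lemma fusion_coeff_dual:
  assumes s: "s \<in> \<Lambda>" and t: "t \<in> \<Lambda>" and u: "u \<in> \<Lambda>"
  shows "fusion_coeff (dual_class s) t u = fusion_coeff s u t"
    "fusion_coeff t (dual_class s) u = fusion_coeff u s t"
  using fusion_coeff_dual_le[OF s t u] fusion_coeff_dual_le[OF dual_class_simple[OF s] u t]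
  by (simp_all add: dual_class_involutive[OF s])

lemma fusion_coeff_assoc:
  assumes s: "s \<in> \<Lambda>" and t: "t \<in> \<Lambda>" and z: "z \<in> \<Lambda>" and u: "u \<in> \<Lambda>"
  shows "(\<Sum>w\<in>\<Lambda>. fusion_coeff s t w * fusion_coeff w z u)
      = (\<Sum>w\<in>\<Lambda>. fusion_coeff t z w * fusion_coeff s w u)"
proof -
  note o = rep_simple(3)[OF s] rep_simple(3)[OF t] rep_simple(3)[OF z] rep_simple(3)[OF u]
  have "(\<Sum>w\<in>\<Lambda>. fusion_coeff s t w * fusion_coeff w z u)
      = hdim (rep_obj u) ((rep_obj s \<otimes>\<^sub>o rep_obj t) \<otimes>\<^sub>o rep_obj z)"
    unfolding fusion_coeff_def by (rule hdim_tensor_left[OF o(4) tensor_obj[OF o(1,2)] o(3), symmetric])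
  also have "\<dots> = hdim (rep_obj u) (rep_obj s \<otimes>\<^sub>o (rep_obj t \<otimes>\<^sub>o rep_obj z))"
    by (rule hdim_isomorphic_right[OF assoc_isomorphic[OF o(1-3)] o(4)])
  also have "\<dots> = (\<Sum>w\<in>\<Lambda>. fusion_coeff t z w * fusion_coeff s w u)"
    unfolding fusion_coeff_def by (rule hdim_tensor_right[OF o(4,1) tensor_obj[OF o(2,3)]])
  finally show ?thesis .
qed

theorem fusion_ring: "fusion_ring \<Lambda> (\<lambda>s t u. real (fusion_coeff s t u)) unit_class dual_class"
proof
  fix x y z u assume x: "x \<in> \<Lambda>" and y: "y \<in> \<Lambda>" and z: "z \<in> \<Lambda>"
  show "real (fusion_coeff (dual_class x) y z) = real (fusion_coeff x z y)"
    "real (fusion_coeff y (dual_class x) z) = real (fusion_coeff z x y)"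
    using fusion_coeff_dual[OF x y z] by simp_all
  assume u: "u \<in> \<Lambda>"
  show "(\<Sum>w\<in>\<Lambda>. real (fusion_coeff x y w) * real (fusion_coeff w z u))
      = (\<Sum>w\<in>\<Lambda>. real (fusion_coeff y z w) * real (fusion_coeff x w u))"
    using fusion_coeff_assoc[OF x y z u] by (simp flip: of_nat_mult of_nat_sum)
qed (simp_all add: finite_simples unit_class dual_class_simple fusion_coeff_unit)

lemma left_mult_matrix_simple:
  assumes X: "simple_object C X" and u: "u \<in> \<Lambda>" and t: "t \<in> \<Lambda>"
  shows "left_mult_matrix K C X u t = int (fusion_coeff (iso_class C X) t u)"
proof -
  have x: "iso_class C X \<in> \<Lambda>" by (rule iso_class_simple[OF X])
  have "left_mult_matrix K C X u t = (\<Sum>s\<in>\<Lambda>. \<Sum>t'\<in>\<Lambda>. int (hdim (rep_obj s) X)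
      * int (hdim (rep_obj t') (rep_obj t)) * int (fusion_coeff s t' u))"
    using u by (simp add: left_mult_matrix_def Gr_ring_def Gr_class_def fusion_coeff_def)
  also have "\<dots> = (\<Sum>s\<in>\<Lambda>. \<Sum>t'\<in>\<Lambda>. if t' = t then int (hdim (rep_obj s) X) * int (fusion_coeff s t' u) else 0)"
    by (intro sum.cong refl) (simp add: hdim_rep_rep t)
  also have "\<dots> = (\<Sum>s\<in>\<Lambda>. int (hdim (rep_obj s) X) * int (fusion_coeff s t u))"
    by (simp add: finite_simples t)
  also have "\<dots> = (\<Sum>s\<in>\<Lambda>. if s = iso_class C X then int (fusion_coeff s t u) else 0)"
    by (intro sum.cong refl) (simp add: hdim_rep X)
  also have "\<dots> = int (fusion_coeff (iso_class C X) t u)" by (simp add: finite_simples x)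
  finally show ?thesis .
qed

lemma FPdim_simple:
  assumes X: "simple_object C X"
  shows "FPdim K C X = fusion_ring.fp \<Lambda> (\<lambda>s t u. real (fusion_coeff s t u)) (iso_class C X)"
proof -
  interpret R: fusion_ring \<Lambda> "\<lambda>s t u. real (fusion_coeff s t u)" unit_class dual_class
    by (rule fusion_ring)
  have "left_mult_eigenvalue K C X a \<longleftrightarrow> (\<exists>w. (\<exists>s\<in>\<Lambda>. w s \<noteq> 0) \<and>
      (\<forall>u\<in>\<Lambda>. (\<Sum>t\<in>\<Lambda>. real (fusion_coeff (iso_class C X) t u) * w t) = a * w u))" for a
    unfolding left_mult_eigenvalue_def by (simp add: left_mult_matrix_simple[OF X])
  then show ?thesis by (simp add: FPdim_def R.fp_def)
qed

lemma FPdim_rep: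
  assumes "s \<in> \<Lambda>"
  shows "FPdim K C (rep_obj s) = fusion_ring.fp \<Lambda> (\<lambda>s t u. real (fusion_coeff s t u)) s"
  using FPdim_simple[OF rep_simple(1)[OF assms]] rep_simple(2)[OF assms] by simp

lemma FPdim_cat_eq: "FPdim_cat K C = fusion_ring.total \<Lambda> (\<lambda>s t u. real (fusion_coeff s t u))"
proof -
  interpret R: fusion_ring \<Lambda> "\<lambda>s t u. real (fusion_coeff s t u)" unit_class dual_class
    by (rule fusion_ring)
  show ?thesis unfolding FPdim_cat_def R.total_def by (intro sum.cong refl) (simp add: FPdim_rep)
qed

lemma FPdim_pos: assumes "simple_object C X" shows "0 < FPdim K C X"
proof -
  interpret R: fusion_ring \<Lambda> "\<lambda>s t u. real (fusion_coeff s t u)" unit_class dual_class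
    by (rule fusion_ring)
  show ?thesis using FPdim_simple[OF assms] R.fp_pos[OF iso_class_simple[OF assms]] by simp
qed

lemma FPdim_isomorphic:
  assumes "simple_object C X" "isomorphic C X Y" shows "FPdim K C X = FPdim K C Y"
  using FPdim_simple[OF assms(1)] FPdim_simple[OF simple_isomorphic[OF assms]]
    iso_class_eq_iff[OF isomorphic_obj[OF assms(2)]] assms(2) by simp

end

section \<open>Trivial objects\<close>

context fusion_category begin

lemma trivial_hdim_left:
  assumes T: "trivial_object C T" and Z: "Z \<in> Obj C" and 0: "hdim \<one>\<^sub>o Z = 0"
  shows "hdim T Z = 0"
proof -
  obtain n P inc prj where bp: "is_biproduct C (replicate n \<one>\<^sub>o) P inc prj" and iso: "isomorphic C T P"
    using T by (auto simp: trivial_object_def is_direct_sum_def)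
  have "hdim T Z = hdim P Z" by (rule hdim_isomorphic_left[OF iso Z])
  also have "\<dots> = 0" using hdim_biproduct_left[OF bp Z] 0 by simp
  finally show ?thesis .
qed

text \<open>Triviality becomes a condition on multiplicities, which passes to direct summands and
  can be tested summand by summand.\<close>

lemma trivial_object_iff:
  assumes X: "X \<in> Obj C"
  shows "trivial_object C X \<longleftrightarrow> (\<forall>T. simple_object C T \<and> \<not> isomorphic C T \<one>\<^sub>o \<longrightarrow> hdim T X = 0)"
proof (intro iffI allI impI; (elim conjE)?)
  fix T assume triv: "trivial_object C X" and T: "simple_object C T" and ni: "\<not> isomorphic C T \<one>\<^sub>o"
  have "\<not> isomorphic C \<one>\<^sub>o T" using ni isomorphic_sym by blast
  then have "hdim \<one>\<^sub>o T = 0" using hdim_simple[OF unit_simple T] by simp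
  then have "hdim X T = 0" by (rule trivial_hdim_left[OF triv simple_obj(1)[OF T]])
  then show "hdim T X = 0" using hdim_symmetric[OF X T] by simp
next
  assume *: "\<forall>T. simple_object C T \<and> \<not> isomorphic C T \<one>\<^sub>o \<longrightarrow> hdim T X = 0"
  obtain Ss inc prj where Ss: "\<And>S. S \<in> set Ss \<Longrightarrow> simple_object C S"
    and bp: "is_biproduct C Ss X inc prj"
    using semisimple[OF X] by (auto simp: is_direct_sum_def)
  note b = biproductD[OF bp]
  have "isomorphic C (Ss ! i) \<one>\<^sub>o" if i: "i < length Ss" for i
  proof (rule ccontr)
    have S: "simple_object C (Ss ! i)" using Ss i by simp
    assume "\<not> isomorphic C (Ss ! i) \<one>\<^sub>o"
    then have "(\<Sum>j<length Ss. hdim (Ss ! i) (Ss ! j)) = 0"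
      using * S hdim_biproduct_right[OF bp b(2)[OF i]] by simp
    then have "hdim (Ss ! i) (Ss ! i) = 0" using i by simp
    then show False using hdim_simple[OF S S] isomorphic_refl[OF b(2)[OF i]] by simp
  qed
  then have iso: "isomorphic C (replicate (length Ss) \<one>\<^sub>o ! i) (Ss ! i)" if "i < length Ss" for i
    using isomorphic_sym that by simp
  have "is_direct_sum C Ss X" using bp by (auto simp: is_direct_sum_def)
  then have "is_direct_sum C (replicate (length Ss) \<one>\<^sub>o) X"
    by (rule direct_sum_cong) (simp_all add: iso del: nth_replicate)
  then show "trivial_object C X"
    using X isomorphic_refl[OF X] by (auto simp: trivial_object_def)
qed

lemma trivial_isomorphic:
  assumes "isomorphic C X Y" "trivial_object C X" shows "trivial_object C Y"
  using assms isomorphic_trans[OF isomorphic_sym[OF assms(1)]] isomorphic_obj[OF assms(1)]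
  unfolding trivial_object_def by blast

lemma trivial_unit: "trivial_object C \<one>\<^sub>o"
  using trivial_object_iff[OF unit_obj] hdim_simple[OF _ unit_simple] by simp

end

section \<open>Tensor functors between fusion categories\<close>

sublocale tensor_functor \<subseteq> additive_functor K C D "FObj F" "FArr F"
  by unfold_locales (simp_all add: map_obj map_hom map_ident map_comp map_plus)

locale fusion_functor = tensor_functor K C D F + C: fusion_category K C + D: fusion_category K D
  for K :: "'k ring"
    and C :: "('o1, 'm1, 'k, 'z1) moncat_scheme"
    and D :: "('o2, 'm2, 'k, 'z2) moncat_scheme"
    and F :: "('o1, 'm1, 'o2, 'm2) monfun"
begin

definition mult :: "'o2 set \<Rightarrow> 'o1 set \<Rightarrow> nat" where
  "mult y x = D.hdim (rep_obj y) (FObj F (rep_obj x))"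

lemma hdim_image:
  assumes U: "U \<in> Obj D" and X: "X \<in> Obj C"
  shows "D.hdim U (FObj F X) = (\<Sum>s\<in>C.\<Lambda>. C.hdim (rep_obj s) X * D.hdim U (FObj F (rep_obj s)))"
proof (rule C.additive_expansion[OF _ X])
  fix Xs B assume "is_direct_sum C Xs B"
  then obtain inc prj where bp: "is_biproduct C Xs B inc prj" by (auto simp: is_direct_sum_def)
  show "D.hdim U (FObj F B) = (\<Sum>i<length Xs. D.hdim U (FObj F (Xs ! i)))"
    using D.hdim_biproduct_right[OF biproduct_image[OF bp] U] by simp
qed

theorem fusion_ring_hom:
  "fusion_ring_hom C.\<Lambda> (\<lambda>s t u. real (C.fusion_coeff s t u)) C.unit_class C.dual_class
     D.\<Lambda> (\<lambda>s t u. real (D.fusion_coeff s t u)) D.unit_class D.dual_class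
     (\<lambda>y x. real (mult y x))"
proof (intro fusion_ring_hom.intro C.fusion_ring D.fusion_ring fusion_ring_hom_axioms.intro)
  fix y assume y: "y \<in> D.\<Lambda>"
  have "isomorphic D (FObj F (rep_obj C.unit_class)) (FObj F \<one>\<^sub>o\<^bsub>C\<^esub>)"
    by (rule isomorphic_image[OF C.rep_iso_class[OF C.unit_simple]])
  moreover have "isomorphic D (FObj F \<one>\<^sub>o\<^bsub>C\<^esub>) \<one>\<^sub>o\<^bsub>D\<^esub>"
    by (rule D.isomorphic_sym[OF D.isomorphicI[OF unit_hom unit_iso]])
  ultimately have "isomorphic D (FObj F (rep_obj C.unit_class)) \<one>\<^sub>o\<^bsub>D\<^esub>" by (rule D.isomorphic_trans)
  then have "mult y C.unit_class = D.hdim (rep_obj y) \<one>\<^sub>o\<^bsub>D\<^esub>"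
    unfolding mult_def by (rule D.hdim_isomorphic_right[OF _ D.rep_simple(3)[OF y]])
  then show "real (mult y C.unit_class) = (if y = D.unit_class then 1 else 0)"
    using D.hdim_rep[OF y D.unit_simple] by simp
next
  fix x x' u assume x: "x \<in> C.\<Lambda>" and x': "x' \<in> C.\<Lambda>" and u: "u \<in> D.\<Lambda>"
  note o = C.rep_simple(3)[OF x] C.rep_simple(3)[OF x'] and uo = D.rep_simple(3)[OF u]
  have "(\<Sum>z\<in>C.\<Lambda>. C.fusion_coeff x x' z * mult u z)
      = D.hdim (rep_obj u) (FObj F (rep_obj x \<otimes>\<^sub>o\<^bsub>C\<^esub> rep_obj x'))"
    unfolding mult_def C.fusion_coeff_def by (rule hdim_image[OF uo C.tensor_obj[OF o], symmetric])
  also have "\<dots> = D.hdim (rep_obj u) (FObj F (rep_obj x) \<otimes>\<^sub>o\<^bsub>D\<^esub> FObj F (rep_obj x'))"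
    by (rule D.hdim_isomorphic_right[OF D.isomorphic_sym[OF D.isomorphicI[OF tens_hom[OF o] tens_iso[OF o]]] uo])
  also have "\<dots> = (\<Sum>y\<in>D.\<Lambda>. mult y x * D.hdim (rep_obj u) (rep_obj y \<otimes>\<^sub>o\<^bsub>D\<^esub> FObj F (rep_obj x')))"
    unfolding mult_def by (rule D.hdim_tensor_left[OF uo map_obj[OF o(1)] map_obj[OF o(2)]])
  also have "\<dots> = (\<Sum>y\<in>D.\<Lambda>. mult y x * (\<Sum>y'\<in>D.\<Lambda>. mult y' x' * D.fusion_coeff y y' u))"
    by (intro sum.cong refl arg_cong2[where f = "(*)"])
      (simp add: mult_def D.fusion_coeff_def D.hdim_tensor_right[OF uo _ map_obj[OF o(2)]] D.rep_simple)
  also have "\<dots> = (\<Sum>y\<in>D.\<Lambda>. \<Sum>y'\<in>D.\<Lambda>. mult y x * mult y' x' * D.fusion_coeff y y' u)"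
    by (simp add: sum_distrib_left mult.assoc)
  finally show "(\<Sum>z\<in>C.\<Lambda>. real (C.fusion_coeff x x' z) * real (mult u z))
      = (\<Sum>y\<in>D.\<Lambda>. \<Sum>y'\<in>D.\<Lambda>. real (mult y x) * real (mult y' x') * real (D.fusion_coeff y y' u))"
    by (simp flip: of_nat_mult of_nat_sum)
qed simp

lemma FPdim_image:
  assumes x: "x \<in> C.\<Lambda>"
  shows "(\<Sum>y\<in>D.\<Lambda>. real (mult y x) * FPdim K D (rep_obj y)) = FPdim K C (rep_obj x)"
proof -
  interpret R: fusion_ring_hom C.\<Lambda> "\<lambda>s t u. real (C.fusion_coeff s t u)" C.unit_class C.dual_class
     D.\<Lambda> "\<lambda>s t u. real (D.fusion_coeff s t u)" D.unit_class D.dual_class "\<lambda>y x. real (mult y x)"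
    by (rule fusion_ring_hom)
  show ?thesis using R.fp_image[OF x] x by (simp add: D.FPdim_rep C.FPdim_rep)
qed

lemma mult_pos_of_dominant:
  assumes dom: "dominant_functor C D F" and y: "y \<in> D.\<Lambda>"
  shows "\<exists>x\<in>C.\<Lambda>. 0 < mult y x"
proof -
  note Y = D.rep_simple[OF y]
  obtain X u where X: "X \<in> Obj C" and u: "u \<in> Hom D (rep_obj y) (FObj F X)" and m: "mono_arr D u"
    using dom Y(3) unfolding dominant_functor_def by blast
  have "u \<noteq> ZeroArr D (rep_obj y) (FObj F X)"
  proof
    assume z: "u = ZeroArr D (rep_obj y) (FObj F X)"
    note zy = D.zero_hom[OF Y(3,3)] and iy = D.ident_hom[OF Y(3)]
    have "u \<cdot>\<^bsub>D\<^esub> Ident D (rep_obj y) = u \<cdot>\<^bsub>D\<^esub> ZeroArr D (rep_obj y) (rep_obj y)"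
      using D.comp_ident_right[OF u] D.comp_zero_right[OF u Y(3)] z by simp
    then have "Ident D (rep_obj y) = ZeroArr D (rep_obj y) (rep_obj y)"
      using m iy zy D.in_Hom[OF u] by (auto simp: mono_arr_def)
    then show False using D.simple_obj(2)[OF Y(1)] by simp
  qed
  then have "0 < D.hdim (rep_obj y) (FObj F X)" by (rule D.hdim_pos_if_nonzero[OF u])
  then have "(\<Sum>s\<in>C.\<Lambda>. C.hdim (rep_obj s) X * mult y s) \<noteq> 0"
    using hdim_image[OF Y(3) X] by (simp add: mult_def)
  then show ?thesis by (metis (no_types, lifting) mult_0_right not_gr0 sum.neutral)
qed

lemma FPdim_regular:
  assumes dom: "dominant_functor C D F" and y: "y \<in> D.\<Lambda>"
  shows "(\<Sum>x\<in>C.\<Lambda>. real (mult y x) * FPdim K C (rep_obj x))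
    = FPdim_cat K C / FPdim_cat K D * FPdim K D (rep_obj y)"
proof -
  interpret R: fusion_ring_hom C.\<Lambda> "\<lambda>s t u. real (C.fusion_coeff s t u)" C.unit_class C.dual_class
     D.\<Lambda> "\<lambda>s t u. real (D.fusion_coeff s t u)" D.unit_class D.dual_class "\<lambda>y x. real (mult y x)"
    by (rule fusion_ring_hom)
  have "(\<Sum>x\<in>C.\<Lambda>. real (mult y x) * R.A.fp x) = R.A.total / R.B.total * R.B.fp y"
    by (rule R.regular_image[OF _ y]) (use mult_pos_of_dominant[OF dom] in simp)
  then show ?thesis by (simp add: C.FPdim_rep D.FPdim_rep[OF y] C.FPdim_cat_eq D.FPdim_cat_eq)
qed

text \<open>Otherwise all multiplicities in the image would vanish, and with them the dimension of
  \<open>X\<close>.\<close>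

lemma simple_image_nonzero: assumes X: "simple_object C X" shows "\<not> zero_object D (FObj F X)"
proof
  assume z: "zero_object D (FObj F X)"
  define x where "x = iso_class C X"
  have x: "x \<in> C.\<Lambda>" unfolding x_def by (rule C.iso_class_simple[OF X])
  have iso: "isomorphic D (FObj F (rep_obj x)) (FObj F X)"
    unfolding x_def by (rule isomorphic_image[OF C.rep_iso_class[OF X]])
  have "mult y x = 0" if y: "y \<in> D.\<Lambda>" for y
  proof -
    note yo = D.rep_simple(3)[OF y]
    have "D.hdim (rep_obj y) (FObj F X) = 0"
      using D.hdim_zero_iff[OF yo D.isomorphic_obj(2)[OF iso]] D.zero_object_hom(2)[OF z]
        D.zero_hom[OF yo D.isomorphic_obj(2)[OF iso]] by blast
    then show ?thesis using D.hdim_isomorphic_right[OF iso yo] by (simp add: mult_def)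
  qed
  then have "FPdim K C (rep_obj x) = 0" using FPdim_image[OF x] by simp
  then show False using C.FPdim_pos[OF C.rep_simple(1)[OF x]] by simp
qed

text \<open>A nonzero arrow has a nonzero component between simple summands. This component is
  invertible by Schur's lemma, and its image is not zero because no simple object is sent to
  zero.\<close>

lemma faithful: "faithful_functor C D F"
  unfolding faithful_functor_def
proof (intro ballI)
  fix X Y assume X: "X \<in> Obj C" and Y: "Y \<in> Obj C"
  have lin: "FArr F \<in> module_hom K (hom_space C X Y) (hom_space D (FObj F X) (FObj F Y))"
    unfolding module_hom_def by (auto intro: map_hom map_plus map_scale)
  have "inj_on (FArr F) (carrier (hom_space C X Y))"
  proof (rule module_hom_injI[OF C.hom_module[OF X Y] D.hom_module[OF map_obj[OF X] map_obj[OF Y]] lin])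
    fix f assume "f \<in> carrier (hom_space C X Y)"
      and "FArr F f = \<zero>\<^bsub>hom_space D (FObj F X) (FObj F Y)\<^esub>"
    then have f: "f \<in> Hom C X Y" and Ff: "FArr F f = ZeroArr D (FObj F X) (FObj F Y)" by simp_all
    obtain Ss inc prj where Ss: "\<And>S. S \<in> set Ss \<Longrightarrow> simple_object C S"
      and bpX: "is_biproduct C Ss X inc prj" using C.semisimple[OF X] by (auto simp: is_direct_sum_def)
    obtain Ts inc' prj' where Ts: "\<And>S. S \<in> set Ts \<Longrightarrow> simple_object C S"
      and bpY: "is_biproduct C Ts Y inc' prj'" using C.semisimple[OF Y] by (auto simp: is_direct_sum_def)
    note a = C.biproductD[OF bpX] and b = C.biproductD[OF bpY]
    have "f = ZeroArr C X Y"
    proof (rule C.cocomponents_eqI[OF bpX f C.zero_hom[OF X Y]])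
      fix i assume i: "i < length Ss"
      note fi = C.comp_hom[OF a(3)[OF i] f]
      have "f \<cdot>\<^bsub>C\<^esub> inc i = ZeroArr C (Ss ! i) Y"
      proof (rule C.components_eqI[OF bpY fi C.zero_hom[OF a(2)[OF i] Y]])
        fix j assume j: "j < length Ts"
        define h where "h = prj' j \<cdot>\<^bsub>C\<^esub> f \<cdot>\<^bsub>C\<^esub> inc i"
        have h: "h \<in> Hom C (Ss ! i) (Ts ! j)" unfolding h_def by (rule C.comp_hom[OF fi b(4)[OF j]])
        note o = map_obj[OF a(2)[OF i]] map_obj[OF b(2)[OF j]]
        have "FArr F h = FArr F (prj' j) \<cdot>\<^bsub>D\<^esub> FArr F f \<cdot>\<^bsub>D\<^esub> FArr F (inc i)"
          using map_comp[OF fi b(4)[OF j]] map_comp[OF a(3)[OF i] f] by (simp add: h_def)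
        also have "\<dots> = ZeroArr D (FObj F (Ss ! i)) (FObj F (Ts ! j))"
          using Ff D.comp_zero_left[OF map_hom[OF a(3)[OF i]] map_obj[OF Y]]
            D.comp_zero_right[OF map_hom[OF b(4)[OF j]] o(1)] by simp
        finally have Fh: "FArr F h = ZeroArr D (FObj F (Ss ! i)) (FObj F (Ts ! j))" .
        have "h = ZeroArr C (Ss ! i) (Ts ! j)"
        proof (rule ccontr)
          assume "h \<noteq> ZeroArr C (Ss ! i) (Ts ! j)"
          then have "iso_arr C h" using C.schur[OF _ _ h] Ss Ts i j by simp
          then have iso: "iso_arr D (FArr F h)" by (rule iso_image[OF _ h])
          note I = D.inv_arr[OF iso map_hom[OF h]]
          have "Ident D (FObj F (Ss ! i)) = ZeroArr D (FObj F (Ss ! i)) (FObj F (Ss ! i))"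
            using I(2) Fh D.comp_zero_right[OF I(1) o(1)] by simp
          then have "zero_object D (FObj F (Ss ! i))" using D.zero_object_iff[OF o(1)] by simp
          then show False using simple_image_nonzero Ss i by simp
        qed
        then show "prj' j \<cdot>\<^bsub>C\<^esub> f \<cdot>\<^bsub>C\<^esub> inc i = prj' j \<cdot>\<^bsub>C\<^esub> ZeroArr C (Ss ! i) Y"
          using C.comp_zero_right[OF b(4)[OF j] a(2)[OF i]] by (simp add: h_def)
      qed
      then show "f \<cdot>\<^bsub>C\<^esub> inc i = ZeroArr C X Y \<cdot>\<^bsub>C\<^esub> inc i"
        using C.comp_zero_left[OF a(3)[OF i] Y] by simp
    qed
    then show "f = \<zero>\<^bsub>hom_space C X Y\<^esub>" by simp
  qed
  then show "inj_on (FArr F) (Hom C X Y)" by simp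
qed

text \<open>The unit is the only simple constituent of a trivial object and has dimension one.\<close>

lemma FPdim_trivial_image:
  assumes x: "x \<in> C.\<Lambda>" and triv: "trivial_object D (FObj F (rep_obj x))"
  shows "FPdim K C (rep_obj x) = real (mult D.unit_class x)"
proof -
  interpret R: fusion_ring D.\<Lambda> "\<lambda>s t u. real (D.fusion_coeff s t u)" D.unit_class D.dual_class
    by (rule D.fusion_ring)
  have 0: "mult y x = 0" if y: "y \<in> D.\<Lambda>" "y \<noteq> D.unit_class" for y
  proof -
    have "\<not> isomorphic D (rep_obj y) \<one>\<^sub>o\<^bsub>D\<^esub>"
      using D.iso_class_eq_iff[OF D.rep_simple(3)[OF y(1)] D.unit_obj] D.rep_simple(2)[OF y(1)] y(2) by simp
    then show ?thesis
      using triv D.trivial_object_iff[OF map_obj[OF C.rep_simple(3)[OF x]]] D.rep_simple(1)[OF y(1)]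
      by (simp add: mult_def)
  qed
  have "FPdim K C (rep_obj x) = (\<Sum>y\<in>D.\<Lambda>. real (mult y x) * FPdim K D (rep_obj y))"
    using FPdim_image[OF x] by simp
  also have "\<dots> = (\<Sum>y\<in>D.\<Lambda>. if y = D.unit_class then real (mult y x) * FPdim K D (rep_obj y) else 0)"
    by (rule sum.cong[OF refl]) (simp add: 0)
  also have "\<dots> = real (mult D.unit_class x)"
    by (simp add: D.finite_simples D.unit_class D.FPdim_rep[OF D.unit_class] R.fp_unit)
  finally show ?thesis .
qed

text \<open>By fullness the endomorphisms of the image are scalars too.\<close>

lemma full_image_simple:
  assumes full: "full_functor C D F" and X: "simple_object C X"
  shows "simple_object D (FObj F X)"
proof -
  have Xo: "X \<in> Obj C" using C.simple_obj[OF X] by simp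
  note FX = map_obj[OF Xo]
  show ?thesis
  proof (rule D.scalar_endomorphisms_imp_simple[OF FX])
    show "Ident D (FObj F X) \<noteq> ZeroArr D (FObj F X) (FObj F X)"
      using simple_image_nonzero[OF X] D.zero_object_iff[OF FX] by simp
    fix f assume "f \<in> Hom D (FObj F X) (FObj F X)"
    then obtain h where h: "h \<in> Hom C X X" "f = FArr F h"
      using full Xo unfolding full_functor_def by blast
    then obtain a where a: "a \<in> carrier K" "h = Scale C a (Ident C X)"
      using C.split_simple[OF X] unfolding scalar_End_def bij_betw_def by blast
    then show "\<exists>a\<in>carrier K. f = Scale D a (Ident D (FObj F X))"
      using map_scale[OF a(1) C.ident_hom[OF Xo]] map_ident[OF Xo] h(2) by auto
  qed
qed

text \<open>An isomorphism of the images lifts to a nonzero arrow between simple objects.\<close>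

lemma full_reflects_isomorphic:
  assumes full: "full_functor C D F" and X: "simple_object C X" and Y: "simple_object C Y"
    and iso: "isomorphic D (FObj F X) (FObj F Y)"
  shows "isomorphic C X Y"
proof -
  note Xo = C.simple_obj(1)[OF X] and Yo = C.simple_obj(1)[OF Y]
  obtain f where f: "f \<in> Hom D (FObj F X) (FObj F Y)" "iso_arr D f"
    using iso by (auto simp: isomorphic_def)
  obtain h where h: "h \<in> Hom C X Y" "f = FArr F h"
    using full Xo Yo f(1) unfolding full_functor_def by blast
  have "h \<noteq> ZeroArr C X Y"
  proof
    assume "h = ZeroArr C X Y"
    then have z: "f = ZeroArr D (FObj F X) (FObj F Y)" using h(2) g_zero[OF Xo Yo] by simp
    note I = D.inv_arr[OF f(2,1)]
    have "Ident D (FObj F X) = ZeroArr D (FObj F X) (FObj F X)"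
      using I(2) z D.comp_zero_right[OF I(1) map_obj[OF Xo]] by simp
    then show False using D.simple_obj(2)[OF full_image_simple[OF full X]] by simp
  qed
  then show ?thesis using C.isomorphicI[OF h(1)] C.schur[OF X Y h(1)] by blast
qed

definition image_class :: "'o1 set \<Rightarrow> 'o2 set" where
  "image_class s = iso_class D (FObj F (rep_obj s))"

lemma image_class:
  assumes full: "full_functor C D F" and s: "s \<in> C.\<Lambda>"
  shows "image_class s \<in> D.\<Lambda>" "isomorphic D (rep_obj (image_class s)) (FObj F (rep_obj s))"
    "FPdim K D (rep_obj (image_class s)) = FPdim K C (rep_obj s)"
proof -
  note S = full_image_simple[OF full C.rep_simple(1)[OF s]]
  show i: "image_class s \<in> D.\<Lambda>" unfolding image_class_def by (rule D.iso_class_simple[OF S])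
  show "isomorphic D (rep_obj (image_class s)) (FObj F (rep_obj s))"
    unfolding image_class_def by (rule D.rep_iso_class[OF S])
  have "FPdim K C (rep_obj s) = (\<Sum>y\<in>D.\<Lambda>. real (mult y s) * FPdim K D (rep_obj y))"
    using FPdim_image[OF s] by simp
  also have "\<dots> = (\<Sum>y\<in>D.\<Lambda>. if y = image_class s then FPdim K D (rep_obj y) else 0)"
    by (rule sum.cong[OF refl]) (simp add: mult_def D.hdim_rep[OF _ S] image_class_def)
  also have "\<dots> = FPdim K D (rep_obj (image_class s))" by (simp add: D.finite_simples i)
  finally show "FPdim K D (rep_obj (image_class s)) = FPdim K C (rep_obj s)" by simp
qed

lemma inj_image_class: assumes full: "full_functor C D F" shows "inj_on image_class C.\<Lambda>"
proof (rule inj_onI)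
  fix s t assume s: "s \<in> C.\<Lambda>" and t: "t \<in> C.\<Lambda>" and "image_class s = image_class t"
  then have "isomorphic D (FObj F (rep_obj s)) (FObj F (rep_obj t))"
    using D.iso_class_eq_iff[OF map_obj map_obj] C.rep_simple(3) by (simp add: image_class_def)
  then have "isomorphic C (rep_obj s) (rep_obj t)"
    by (rule full_reflects_isomorphic[OF full C.rep_simple(1)[OF s] C.rep_simple(1)[OF t]])
  then show "s = t"
    using C.iso_class_eq_iff[OF C.rep_simple(3)[OF s] C.rep_simple(3)[OF t]]
      C.rep_simple(2)[OF s] C.rep_simple(2)[OF t] by simp
qed

lemma FPdim_cat_full:
  assumes full: "full_functor C D F"
  shows "FPdim_cat K C = (\<Sum>x\<in>image_class ` C.\<Lambda>. (FPdim K D (rep_obj x))\<^sup>2)"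
  unfolding FPdim_cat_def sum.reindex[OF inj_image_class[OF full]] o_def
  by (intro sum.cong refl) (simp add: image_class[OF full])

lemma simple_in_essential_image:
  assumes full: "full_functor C D F" and Y: "simple_object D Y" "Y \<in> essential_image C D F"
  shows "iso_class D Y \<in> image_class ` C.\<Lambda>"
proof -
  note Yo = D.simple_obj(1)[OF Y(1)]
  obtain X where X: "X \<in> Obj C" and iso: "isomorphic D (FObj F X) Y"
    using Y(2) by (auto simp: essential_image_def)
  obtain Ss inc prj where Ss: "\<And>S. S \<in> set Ss \<Longrightarrow> simple_object C S"
    and bp: "is_biproduct C Ss X inc prj" using C.semisimple[OF X] by (auto simp: is_direct_sum_def)
  note bp' = biproduct_image[OF bp]
  have simple: "simple_object C (Ss ! j)" if "j < length Ss" for j using Ss that by simp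
  have "(\<Sum>j<length Ss. D.hdim Y (FObj F (Ss ! j))) = D.hdim Y (FObj F X)"
    using D.hdim_biproduct_right[OF bp' Yo] by simp
  also have "\<dots> = D.hdim Y Y" by (rule D.hdim_isomorphic_right[OF iso Yo])
  also have "\<dots> = 1" using D.hdim_simple[OF Y(1) Y(1)] D.isomorphic_refl[OF Yo] by simp
  finally have "\<exists>j<length Ss. D.hdim Y (FObj F (Ss ! j)) \<noteq> 0"
    by (metis (no_types, lifting) lessThan_iff one_neq_zero sum.neutral)
  then obtain j where j: "j < length Ss" and nz: "D.hdim Y (FObj F (Ss ! j)) \<noteq> 0" by blast
  define s where "s = iso_class C (Ss ! j)"
  have s: "s \<in> C.\<Lambda>" unfolding s_def by (rule C.iso_class_simple[OF simple[OF j]])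
  have "isomorphic D Y (FObj F (Ss ! j))"
    using nz D.hdim_simple[OF Y(1) full_image_simple[OF full simple[OF j]]] by (simp split: if_splits)
  moreover have "isomorphic D (FObj F (Ss ! j)) (FObj F (rep_obj s))"
    unfolding s_def by (rule isomorphic_image[OF C.isomorphic_sym[OF C.rep_iso_class[OF simple[OF j]]]])
  ultimately have "isomorphic D Y (FObj F (rep_obj s))" by (rule D.isomorphic_trans)
  then have "iso_class D Y = image_class s"
    using D.iso_class_eq_iff[OF Yo map_obj[OF C.rep_simple(3)[OF s]]] by (simp add: image_class_def)
  then show ?thesis using s by blast
qed

end

section \<open>Sequences of fusion categories\<close>

locale fusion_sequence = I: fusion_functor K C' C i + F: fusion_functor K C C'' F
  for K :: "'k ring"
    and C' :: "('o1, 'm1, 'k, 'z1) moncat_scheme"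
    and C :: "('o2, 'm2, 'k, 'z2) moncat_scheme"
    and C'' :: "('o3, 'm3, 'k, 'z3) moncat_scheme"
    and i :: "('o1, 'm1, 'o2, 'm2) monfun"
    and F :: "('o2, 'm2, 'o3, 'm3) monfun" +
  assumes dominant: "dominant_functor C C'' F"
    and full: "full_functor C' C i"
    and image_trivial: "FObj i ` Obj C' \<subseteq> Ker_functor C C'' F"
begin

text \<open>By \<open>inj_image_class\<close> this is a copy of the simple classes of \<open>C'\<close> inside those of \<open>C\<close>.\<close>

definition kernel_classes :: "'o2 set set" where
  "kernel_classes = I.image_class ` simple_classes C'"

lemma kernel_classes_subset: "kernel_classes \<subseteq> simple_classes C"
  using I.image_class(1)[OF full] by (auto simp: kernel_classes_def)

lemma kernel_class_trivial:
  assumes X: "simple_object C X" and x: "iso_class C X \<in> kernel_classes"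
  shows "trivial_object C'' (FObj F X)"
proof -
  obtain s where s: "s \<in> simple_classes C'" "iso_class C X = I.image_class s"
    using x by (auto simp: kernel_classes_def)
  have "isomorphic C (FObj i (rep_obj s)) X"
    using I.image_class(2)[OF full s(1)] I.D.rep_iso_class[OF X] s(2)
      I.D.isomorphic_trans[OF I.D.isomorphic_sym] by metis
  then have "isomorphic C'' (FObj F (FObj i (rep_obj s))) (FObj F X)" by (rule F.isomorphic_image)
  moreover have "trivial_object C'' (FObj F (FObj i (rep_obj s)))"
    using image_trivial I.C.rep_simple(3)[OF s(1)] by (auto simp: Ker_functor_def)
  ultimately show ?thesis by (rule F.D.trivial_isomorphic)
qed

text \<open>The coefficient of the unit in \<open>F R = (FPdim C / FPdim C'') R''\<close>. On a kernel class
  \<open>x\<close> the multiplicity of the unit is the dimension of \<open>x\<close>, so that the kernel classes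
  contribute the sum of the squares of their dimensions.\<close>

lemma FPdim_quotient:
  "FPdim_cat K C / FPdim_cat K C'' = FPdim_cat K C'
     + (\<Sum>x\<in>simple_classes C - kernel_classes. real (F.mult F.D.unit_class x) * FPdim K C (rep_obj x))"
proof -
  interpret R: fusion_ring "simple_classes C''" "\<lambda>s t u. real (F.D.fusion_coeff s t u)"
    F.D.unit_class F.D.dual_class by (rule F.D.fusion_ring)
  have "FPdim_cat K C / FPdim_cat K C''
      = (\<Sum>x\<in>simple_classes C. real (F.mult F.D.unit_class x) * FPdim K C (rep_obj x))"
    using F.FPdim_regular[OF dominant F.D.unit_class] F.D.FPdim_rep[OF F.D.unit_class] R.fp_unit by simp
  also have "\<dots> = (\<Sum>x\<in>simple_classes C - kernel_classes. real (F.mult F.D.unit_class x) * FPdim K C (rep_obj x))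
      + (\<Sum>x\<in>kernel_classes. real (F.mult F.D.unit_class x) * FPdim K C (rep_obj x))"
    by (rule sum.subset_diff[OF kernel_classes_subset I.D.finite_simples])
  also have "(\<Sum>x\<in>kernel_classes. real (F.mult F.D.unit_class x) * FPdim K C (rep_obj x))
      = (\<Sum>x\<in>kernel_classes. (FPdim K C (rep_obj x))\<^sup>2)"
  proof (rule sum.cong[OF refl])
    fix x assume x: "x \<in> kernel_classes"
    then have xL: "x \<in> simple_classes C" using kernel_classes_subset by blast
    have "trivial_object C'' (FObj F (rep_obj x))"
      using kernel_class_trivial[OF I.D.rep_simple(1)[OF xL]] I.D.rep_simple(2)[OF xL] x by simp
    then show "real (F.mult F.D.unit_class x) * FPdim K C (rep_obj x) = (FPdim K C (rep_obj x))\<^sup>2"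
      using F.FPdim_trivial_image[OF xL] by (simp add: power2_eq_square)
  qed
  also have "\<dots> = FPdim_cat K C'" using I.FPdim_cat_full[OF full] by (simp add: kernel_classes_def)
  finally show ?thesis by simp
qed

lemma FPdim_cat_pos: "0 < FPdim_cat K C'" "0 < FPdim_cat K C''"
  using fusion_ring.total_pos[OF I.C.fusion_ring] fusion_ring.total_pos[OF F.D.fusion_ring]
  by (simp_all add: I.C.FPdim_cat_eq F.D.FPdim_cat_eq)

theorem FPdim_inequality: "FPdim_cat K C' * FPdim_cat K C'' \<le> FPdim_cat K C"
proof -
  have "0 \<le> (\<Sum>x\<in>simple_classes C - kernel_classes.
      real (F.mult F.D.unit_class x) * FPdim K C (rep_obj x))"
  proof (rule sum_nonneg)
    fix x assume "x \<in> simple_classes C - kernel_classes"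
    then have "0 < FPdim K C (rep_obj x)" using I.D.FPdim_pos[OF I.D.rep_simple(1)] by simp
    then show "0 \<le> real (F.mult F.D.unit_class x) * FPdim K C (rep_obj x)" by simp
  qed
  then have "FPdim_cat K C' \<le> FPdim_cat K C / FPdim_cat K C''" using FPdim_quotient by simp
  then show ?thesis using FPdim_cat_pos(2) by (simp add: field_simps)
qed

lemma FPdim_equality_iff:
  "FPdim_cat K C = FPdim_cat K C' * FPdim_cat K C'' \<longleftrightarrow>
    (\<forall>x\<in>simple_classes C - kernel_classes. F.mult F.D.unit_class x = 0)"
proof -
  have pos: "0 < FPdim K C (rep_obj x)" if "x \<in> simple_classes C" for x
    by (rule I.D.FPdim_pos[OF I.D.rep_simple(1)[OF that]])
  have "FPdim_cat K C = FPdim_cat K C' * FPdim_cat K C'' \<longleftrightarrow>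
      FPdim_cat K C / FPdim_cat K C'' = FPdim_cat K C'"
    using FPdim_cat_pos(2) by (simp add: field_simps)
  also have "\<dots> \<longleftrightarrow> (\<Sum>x\<in>simple_classes C - kernel_classes.
      real (F.mult F.D.unit_class x) * FPdim K C (rep_obj x)) = 0"
    using FPdim_quotient by simp
  also have "\<dots> \<longleftrightarrow> (\<forall>x\<in>simple_classes C - kernel_classes.
      real (F.mult F.D.unit_class x) * FPdim K C (rep_obj x) = 0)"
    by (rule sum_nonneg_eq_0_iff) (use I.D.finite_simples pos in \<open>auto simp: less_imp_le\<close>)
  also have "\<dots> \<longleftrightarrow> (\<forall>x\<in>simple_classes C - kernel_classes. F.mult F.D.unit_class x = 0)"
    using pos by fastforce
  finally show ?thesis .
qed

lemma mult_unit: assumes X: "simple_object C X"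
  shows "F.mult F.D.unit_class (iso_class C X) = F.D.hdim \<one>\<^sub>o\<^bsub>C''\<^esub> (FObj F X)"
proof -
  have Fo: "FObj F X \<in> Obj C''" by (rule F.map_obj[OF I.D.simple_obj(1)[OF X]])
  have "F.mult F.D.unit_class (iso_class C X) = F.D.hdim (rep_obj F.D.unit_class) (FObj F X)"
    unfolding F.mult_def
    by (rule F.D.hdim_isomorphic_right[OF F.isomorphic_image[OF I.D.rep_iso_class[OF X]]
          F.D.rep_simple(3)[OF F.D.unit_class]])
  also have "\<dots> = F.D.hdim \<one>\<^sub>o\<^bsub>C''\<^esub> (FObj F X)"
    by (rule F.D.hdim_isomorphic_left[OF F.D.rep_iso_class[OF F.D.unit_simple] Fo])
  finally show ?thesis .
qed

text \<open>If \<open>F X\<close> contains the unit, then the subobject of \<open>X\<close> that normality provides is not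
  zero, hence it is all of the simple object \<open>X\<close>. Then \<open>F X\<close> is trivial, and exactness puts
  \<open>X\<close> into the essential image of \<open>i\<close>.\<close>

lemma exact_imp_no_unit:
  assumes exact: "exact_sequence C' C C'' i F" and x: "x \<in> simple_classes C" "x \<notin> kernel_classes"
  shows "F.mult F.D.unit_class x = 0"
proof (rule ccontr)
  assume nz: "F.mult F.D.unit_class x \<noteq> 0"
  define X where "X = rep_obj x"
  have X: "simple_object C X" "iso_class C X = x" "X \<in> Obj C"
    using I.D.rep_simple[OF x(1)] by (simp_all add: X_def)
  note FX = F.map_obj[OF X(3)]
  obtain X0 u where X0: "X0 \<in> Obj C" and u: "u \<in> Hom C X0 X" "mono_arr C u"
    and largest: "largest_trivial_subobject C'' (FArr F u) (FObj F X)"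
  proof -
    have "normal_functor C C'' F" using exact by (simp only: exact_sequence_def)
    then have "\<exists>X\<^sub>0\<in>Obj C. \<exists>u\<in>Hom C X\<^sub>0 X. mono_arr C u \<and>
        largest_trivial_subobject C'' (FArr F u) (FObj F X)"
      unfolding normal_functor_def using X(3) by (rule bspec)
    then show thesis using that by blast
  qed
  note Fu = F.map_hom[OF u(1)]
  have triv0: "trivial_object C'' (FObj F X0)"
    using largest unfolding largest_trivial_subobject_def F.D.in_Hom(2)[OF Fu] by blast
  have "0 < F.D.hdim \<one>\<^sub>o\<^bsub>C''\<^esub> (FObj F X)" using nz mult_unit[OF X(1)] X(2) by simp
  then obtain v where v: "v \<in> Hom C'' \<one>\<^sub>o\<^bsub>C''\<^esub> (FObj F X)" "v \<noteq> ZeroArr C'' \<one>\<^sub>o\<^bsub>C''\<^esub> (FObj F X)"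
    by (rule F.D.nonzero_if_hdim_pos[OF F.D.unit_obj FX])
  have mono: "mono_arr C'' v" by (rule F.D.simple_nonzero_mono[OF F.D.unit_simple v])
  have "\<forall>T. \<forall>v \<in> Hom C'' T (FObj F X). mono_arr C'' v \<and> trivial_object C'' T \<longrightarrow>
      (\<exists>w \<in> Hom C'' T (FObj F X0). FArr F u \<cdot>\<^bsub>C''\<^esub> w = v)"
    using largest unfolding largest_trivial_subobject_def F.D.in_Hom(2)[OF Fu] by blast
  then obtain w where w: "w \<in> Hom C'' \<one>\<^sub>o\<^bsub>C''\<^esub> (FObj F X0)" "FArr F u \<cdot>\<^bsub>C''\<^esub> w = v"
    using v(1) mono F.D.trivial_unit by blast
  have "\<not> zero_object C X0"
  proof
    assume "zero_object C X0"
    then have "w = ZeroArr C'' \<one>\<^sub>o\<^bsub>C''\<^esub> (FObj F X0)"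
      by (rule F.D.zero_object_hom(2)[OF F.zero_object_image w(1)])
    then have "v = FArr F u \<cdot>\<^bsub>C''\<^esub> ZeroArr C'' \<one>\<^sub>o\<^bsub>C''\<^esub> (FObj F X0)" using w(2) by simp
    also have "\<dots> = ZeroArr C'' \<one>\<^sub>o\<^bsub>C''\<^esub> (FObj F X)" by (rule F.D.comp_zero_right[OF Fu F.D.unit_obj])
    finally show False using v(2) by contradiction
  qed
  moreover have "mono_arr C u \<longrightarrow> zero_object C X0 \<or> iso_arr C u"
    using X(1) u(1) by (simp add: simple_object_def)
  ultimately have "iso_arr C u" using u(2) by blast
  then have "isomorphic C'' (FObj F X0) (FObj F X)"
    by (rule F.isomorphic_image[OF I.D.isomorphicI[OF u(1)]])
  then have "trivial_object C'' (FObj F X)" using triv0 by (rule F.D.trivial_isomorphic)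
  then have "X \<in> Ker_functor C C'' F" using X(3) by (simp add: Ker_functor_def)
  moreover have "essential_image C' C i = Ker_functor C C'' F"
    using exact by (simp only: exact_sequence_def)
  ultimately have "X \<in> essential_image C' C i" by simp
  from I.simple_in_essential_image[OF full X(1) this] X(2) have "x \<in> kernel_classes"
    by (simp only: kernel_classes_def)
  then show False using x(2) by contradiction
qed

context
  assumes no_unit: "\<forall>x\<in>simple_classes C - kernel_classes. F.mult F.D.unit_class x = 0"
begin

lemma simple_dichotomy:
  assumes S: "simple_object C S" and "iso_class C S \<notin> kernel_classes"
  shows "F.D.hdim \<one>\<^sub>o\<^bsub>C''\<^esub> (FObj F S) = 0"
  using no_unit mult_unit[OF S] I.D.iso_class_simple[OF S] assms(2) by auto

text \<open>Outside the kernel classes the image is not zero and does not contain the unit, so it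
  is not trivial.\<close>

lemma simple_trivial_imp_kernel_class:
  assumes S: "simple_object C S" and triv: "trivial_object C'' (FObj F S)"
  shows "iso_class C S \<in> kernel_classes"
proof (rule ccontr)
  assume "iso_class C S \<notin> kernel_classes"
  then have 0: "F.D.hdim \<one>\<^sub>o\<^bsub>C''\<^esub> (FObj F S) = 0" by (rule simple_dichotomy[OF S])
  have Fo: "FObj F S \<in> Obj C''" by (rule F.map_obj[OF I.D.simple_obj(1)[OF S]])
  have "F.D.hdim (FObj F S) (FObj F S) = 0" by (rule F.D.trivial_hdim_left[OF triv Fo 0])
  then have "Ident C'' (FObj F S) = ZeroArr C'' (FObj F S) (FObj F S)"
    using F.D.hdim_zero_iff[OF Fo Fo] F.D.ident_hom[OF Fo] by blast
  then show False using F.simple_image_nonzero[OF S] F.D.zero_object_iff[OF Fo] by simp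
qed

text \<open>If \<open>F X\<close> is trivial, then so is \<open>F S\<close> for every simple summand \<open>S\<close> of \<open>X\<close>. These
  summands come from \<open>C'\<close>, and the direct sum of their preimages is a preimage of \<open>X\<close>.\<close>

lemma no_unit_imp_essential_image: "essential_image C' C i = Ker_functor C C'' F"
proof (intro equalityI subsetI)
  fix Y assume "Y \<in> essential_image C' C i"
  then obtain X where Y: "Y \<in> Obj C" and X: "X \<in> Obj C'" and iso: "isomorphic C (FObj i X) Y"
    by (auto simp: essential_image_def)
  have "trivial_object C'' (FObj F (FObj i X))" using image_trivial X by (auto simp: Ker_functor_def)
  then have "trivial_object C'' (FObj F Y)" by (rule F.D.trivial_isomorphic[OF F.isomorphic_image[OF iso]])
  then show "Y \<in> Ker_functor C C'' F" using Y by (simp add: Ker_functor_def)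
next
  fix X assume "X \<in> Ker_functor C C'' F"
  then have X: "X \<in> Obj C" and triv: "trivial_object C'' (FObj F X)" by (auto simp: Ker_functor_def)
  obtain Ss inc prj where Ss: "\<And>S. S \<in> set Ss \<Longrightarrow> simple_object C S"
    and bp: "is_biproduct C Ss X inc prj" using I.D.semisimple[OF X] by (auto simp: is_direct_sum_def)
  note b = I.D.biproductD[OF bp] and bp' = F.biproduct_image[OF bp]
  have simple: "simple_object C (Ss ! j)" if "j < length Ss" for j using Ss that by simp
  have "\<exists>s\<in>simple_classes C'. isomorphic C (FObj i (rep_obj s)) (Ss ! j)" if j: "j < length Ss" for j
  proof -
    have "trivial_object C'' (FObj F (Ss ! j))"
    proof (subst F.D.trivial_object_iff[OF F.map_obj[OF b(2)[OF j]]], intro allI impI, elim conjE)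
      fix T assume T: "simple_object C'' T" and ni: "\<not> isomorphic C'' T \<one>\<^sub>o\<^bsub>C''\<^esub>"
      have "F.D.hdim T (FObj F X) = 0"
        using triv F.D.trivial_object_iff[OF F.map_obj[OF X]] T ni by blast
      then have "(\<Sum>k<length Ss. F.D.hdim T (FObj F (Ss ! k))) = 0"
        using F.D.hdim_biproduct_right[OF bp' F.D.simple_obj(1)[OF T]] by simp
      then show "F.D.hdim T (FObj F (Ss ! j)) = 0" using j by simp
    qed
    then have "iso_class C (Ss ! j) \<in> kernel_classes" by (rule simple_trivial_imp_kernel_class[OF simple[OF j]])
    then obtain s where s: "s \<in> simple_classes C'" "iso_class C (Ss ! j) = I.image_class s"
      by (auto simp: kernel_classes_def)
    have "isomorphic C (FObj i (rep_obj s)) (Ss ! j)"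
      using I.D.iso_class_eq_iff[OF I.map_obj[OF I.C.rep_simple(3)[OF s(1)]] b(2)[OF j]] s(2)
      by (simp add: I.image_class_def)
    then show ?thesis using s(1) by blast
  qed
  then obtain t where t: "\<And>j. j < length Ss \<Longrightarrow> t j \<in> simple_classes C'"
      "\<And>j. j < length Ss \<Longrightarrow> isomorphic C (FObj i (rep_obj (t j))) (Ss ! j)" by metis
  define Ts where "Ts = map (\<lambda>j. rep_obj (t j)) [0..<length Ss]"
  have "set Ts \<subseteq> Obj C'" using t(1) I.C.rep_simple(3) by (auto simp: Ts_def)
  then obtain B where B: "is_direct_sum C' Ts B" using I.C.direct_sum_exists by blast
  have "is_direct_sum C (map (FObj i) Ts) (FObj i B)" by (rule I.direct_sum_image[OF B])
  moreover have "is_direct_sum C (map (FObj i) Ts) X"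
  proof (rule I.D.direct_sum_cong)
    show "is_direct_sum C Ss X" using bp by (auto simp: is_direct_sum_def)
    show "length (map (FObj i) Ts) = length Ss" by (simp add: Ts_def)
    show "isomorphic C (map (FObj i) Ts ! j) (Ss ! j)" if "j < length Ss" for j
      using t(2)[OF that] that by (simp add: Ts_def)
  qed
  ultimately have "isomorphic C (FObj i B) X" by (rule I.D.direct_sum_unique)
  moreover have "B \<in> Obj C'" using B by (auto simp: is_direct_sum_def is_biproduct_def)
  ultimately show "X \<in> essential_image C' C i" using X by (auto simp: essential_image_def)
qed

text \<open>The required subobject \<open>X0\<close> is the sum of those simple summands of \<open>X\<close> whose classes
  are kernel classes, realised as the kernel of the projection \<open>e'\<close> onto the others. Its image
  is trivial, and a map from a trivial object to \<open>F X\<close> has no component in the images of the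
  other summands, because these do not contain the unit.\<close>

lemma no_unit_imp_normal: "normal_functor C C'' F"
  unfolding normal_functor_def
proof (intro ballI)
  fix X assume X: "X \<in> Obj C"
  note FX = F.map_obj[OF X]
  obtain Ss inc prj where Ss: "\<And>S. S \<in> set Ss \<Longrightarrow> simple_object C S"
    and bp: "is_biproduct C Ss X inc prj" using I.D.semisimple[OF X] by (auto simp: is_direct_sum_def)
  note b = I.D.biproductD[OF bp] and bp' = F.biproduct_image[OF bp]
  have simple: "simple_object C (Ss ! j)" if "j < length Ss" for j using Ss that by simp
  note Fo = F.map_obj[OF b(2)]
  define N where "N j \<longleftrightarrow> iso_class C (Ss ! j) \<in> kernel_classes" for j
  obtain e where e: "e \<in> Hom C X X"
    and pe: "\<And>j. j < length Ss \<Longrightarrow> prj j \<cdot>\<^bsub>C\<^esub> e = (if N j then prj j else ZeroArr C X (Ss ! j))"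
    by (rule I.D.biproduct_arrow[OF bp X, of "\<lambda>j. if N j then prj j else ZeroArr C X (Ss ! j)"])
      (simp_all add: b(4) I.D.zero_hom[OF X b(2)])
  obtain e' where e': "e' \<in> Hom C X X"
    and pe': "\<And>j. j < length Ss \<Longrightarrow> prj j \<cdot>\<^bsub>C\<^esub> e' = (if N j then ZeroArr C X (Ss ! j) else prj j)"
    by (rule I.D.biproduct_arrow[OF bp X, of "\<lambda>j. if N j then ZeroArr C X (Ss ! j) else prj j"])
      (simp_all add: b(4) I.D.zero_hom[OF X b(2)])
  obtain u where ker: "is_kernel C u e'" using I.D.has_kernels I.D.in_Hom(1)[OF e'] by blast
  define X0 where "X0 = Src C u"
  have u: "u \<in> Hom C X0 X" using ker I.D.in_Hom[OF e'] by (auto simp: is_kernel_def Hom_def X0_def)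
  have X0: "X0 \<in> Obj C" using I.D.in_Hom[OF u] by simp
  have e'u: "e' \<cdot>\<^bsub>C\<^esub> u = ZeroArr C X0 X" using ker I.D.in_Hom[OF e'] by (simp add: is_kernel_def X0_def)
  \<comment> \<open>Hence the complementary projection \<open>e\<close> factors through the kernel and splits it.\<close>
  have "e' \<cdot>\<^bsub>C\<^esub> e = ZeroArr C X X"
  proof (rule I.D.components_eqI[OF bp I.D.comp_hom[OF e e'] I.D.zero_hom[OF X X]])
    fix j assume j: "j < length Ss"
    show "prj j \<cdot>\<^bsub>C\<^esub> e' \<cdot>\<^bsub>C\<^esub> e = prj j \<cdot>\<^bsub>C\<^esub> ZeroArr C X X"
      using I.D.comp_assoc[OF e e' b(4)[OF j]] pe[OF j] pe'[OF j] I.D.comp_zero_left[OF e b(2)[OF j]]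
        I.D.comp_zero_right[OF b(4)[OF j] X] by (cases "N j") auto
  qed
  then obtain r where r: "r \<in> Hom C X X0" "u \<cdot>\<^bsub>C\<^esub> r = e"
    using ker e I.D.in_Hom[OF e'] unfolding is_kernel_def X0_def by metis
  have pu: "prj j \<cdot>\<^bsub>C\<^esub> u = ZeroArr C X0 (Ss ! j)" if j: "j < length Ss" and "\<not> N j" for j
    using I.D.comp_assoc[OF u e' b(4)[OF j]] pe'[OF j] e'u I.D.comp_zero_right[OF b(4)[OF j] X0] that(2)
    by simp
  have eu: "e \<cdot>\<^bsub>C\<^esub> u = u"
  proof (rule I.D.components_eqI[OF bp I.D.comp_hom[OF u e] u])
    fix j assume j: "j < length Ss"
    show "prj j \<cdot>\<^bsub>C\<^esub> e \<cdot>\<^bsub>C\<^esub> u = prj j \<cdot>\<^bsub>C\<^esub> u"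
      using I.D.comp_assoc[OF u e b(4)[OF j]] pe[OF j] pu[OF j] I.D.comp_zero_left[OF u b(2)[OF j]]
      by (cases "N j") auto
  qed
  have mono: "mono_arr C u" by (rule I.D.kernel_mono[OF ker])
  have "u \<cdot>\<^bsub>C\<^esub> r \<cdot>\<^bsub>C\<^esub> u = u \<cdot>\<^bsub>C\<^esub> Ident C X0"
    using I.D.comp_assoc[OF u r(1) u] r(2) eu I.D.comp_ident_right[OF u] by simp
  then have ru: "r \<cdot>\<^bsub>C\<^esub> u = Ident C X0"
    using mono I.D.comp_hom[OF u r(1)] I.D.ident_hom[OF X0] I.D.in_Hom[OF u]
    unfolding mono_arr_def by metis
  define U where "U = FArr F u"
  define R where "R = FArr F r"
  note FX0 = F.map_obj[OF X0]
  have U: "U \<in> Hom C'' (FObj F X0) (FObj F X)" unfolding U_def by (rule F.map_hom[OF u])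
  have R: "R \<in> Hom C'' (FObj F X) (FObj F X0)" unfolding R_def by (rule F.map_hom[OF r(1)])
  have RU: "R \<cdot>\<^bsub>C''\<^esub> U = Ident C'' (FObj F X0)"
    using F.map_comp[OF u r(1)] ru F.map_ident[OF X0] by (simp add: U_def R_def)
  have UR: "U \<cdot>\<^bsub>C''\<^esub> R = FArr F e" using F.map_comp[OF r(1) u] r(2) by (simp add: U_def R_def)
  have P: "FArr F (prj j) \<in> Hom C'' (FObj F X) (FObj F (Ss ! j))" if "j < length Ss" for j
    by (rule F.map_hom[OF b(4)[OF that]])
  have zero_if_hdim: "h = ZeroArr C'' T Z" if "h \<in> Hom C'' T Z" "F.D.hdim T Z = 0" for h T Z
    using F.D.hdim_zero_iff[OF F.D.in_Hom(4,5)[OF that(1)]] that by auto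
  have "trivial_object C'' (FObj F X0)"
  proof (subst F.D.trivial_object_iff[OF FX0], intro allI impI, elim conjE)
    fix T assume T: "simple_object C'' T" and ni: "\<not> isomorphic C'' T \<one>\<^sub>o\<^bsub>C''\<^esub>"
    note To = F.D.simple_obj(1)[OF T]
    have "h = ZeroArr C'' T (FObj F X0)" if h: "h \<in> Hom C'' T (FObj F X0)" for h
    proof -
      note Uh = F.D.comp_hom[OF h U]
      have "U \<cdot>\<^bsub>C''\<^esub> h = ZeroArr C'' T (FObj F X)"
      proof (rule F.D.components_eqI[OF bp' Uh F.D.zero_hom[OF To FX]])
        fix j assume "j < length (map (FObj F) Ss)"
        then have j: "j < length Ss" by simp
        have "FArr F (prj j) \<cdot>\<^bsub>C''\<^esub> U \<cdot>\<^bsub>C''\<^esub> h = ZeroArr C'' T (FObj F (Ss ! j))"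
        proof (cases "N j")
          case True
          then have "trivial_object C'' (FObj F (Ss ! j))"
            using kernel_class_trivial[OF simple[OF j]] by (simp add: N_def)
          then have "F.D.hdim T (FObj F (Ss ! j)) = 0"
            using F.D.trivial_object_iff[OF Fo[OF j]] T ni by blast
          then show ?thesis by (rule zero_if_hdim[OF F.D.comp_hom[OF Uh P[OF j]]])
        next
          case False
          have "FArr F (prj j) \<cdot>\<^bsub>C''\<^esub> U = ZeroArr C'' (FObj F X0) (FObj F (Ss ! j))"
            using F.map_comp[OF u b(4)[OF j]] pu[OF j False] F.g_zero[OF X0 b(2)[OF j]] by (simp add: U_def)
          then show ?thesis
            using F.D.comp_assoc[OF h U P[OF j]] F.D.comp_zero_left[OF h Fo[OF j]] by simp
        qed
        then show "FArr F (prj j) \<cdot>\<^bsub>C''\<^esub> U \<cdot>\<^bsub>C''\<^esub> h = FArr F (prj j) \<cdot>\<^bsub>C''\<^esub> ZeroArr C'' T (FObj F X)"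
          using F.D.comp_zero_right[OF P[OF j] To] by simp
      qed
      then have "(R \<cdot>\<^bsub>C''\<^esub> U) \<cdot>\<^bsub>C''\<^esub> h = ZeroArr C'' T (FObj F X0)"
        using F.D.comp_assoc[OF h U R] F.D.comp_zero_right[OF R To] by simp
      then show ?thesis using RU F.D.comp_ident_left[OF h] by simp
    qed
    then show "F.D.hdim T (FObj F X0) = 0"
      using F.D.hdim_zero_iff[OF To FX0] F.D.zero_hom[OF To FX0] by blast
  qed
  moreover have "\<exists>w\<in>Hom C'' T (FObj F X0). U \<cdot>\<^bsub>C''\<^esub> w = v"
    if v: "v \<in> Hom C'' T (FObj F X)" and T: "trivial_object C'' T" for T v
  proof (rule bexI[of _ "R \<cdot>\<^bsub>C''\<^esub> v"])
    note To = F.D.in_Hom(4)[OF v]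
    note Fe = F.map_hom[OF e]
    show "R \<cdot>\<^bsub>C''\<^esub> v \<in> Hom C'' T (FObj F X0)" by (rule F.D.comp_hom[OF v R])
    have "FArr F e \<cdot>\<^bsub>C''\<^esub> v = v"
    proof (rule F.D.components_eqI[OF bp' F.D.comp_hom[OF v Fe] v])
      fix j assume "j < length (map (FObj F) Ss)"
      then have j: "j < length Ss" by simp
      have c: "FArr F (prj j) \<cdot>\<^bsub>C''\<^esub> FArr F e \<cdot>\<^bsub>C''\<^esub> v = FArr F (prj j \<cdot>\<^bsub>C\<^esub> e) \<cdot>\<^bsub>C''\<^esub> v"
        using F.D.comp_assoc[OF v Fe P[OF j]] F.map_comp[OF e b(4)[OF j]] by simp
      show "FArr F (prj j) \<cdot>\<^bsub>C''\<^esub> FArr F e \<cdot>\<^bsub>C''\<^esub> v = FArr F (prj j) \<cdot>\<^bsub>C''\<^esub> v"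
      proof (cases "N j")
        case True
        then show ?thesis using c pe[OF j] by simp
      next
        case False
        have "F.D.hdim \<one>\<^sub>o\<^bsub>C''\<^esub> (FObj F (Ss ! j)) = 0"
          using simple_dichotomy[OF simple[OF j]] False by (simp add: N_def)
        then have "F.D.hdim T (FObj F (Ss ! j)) = 0" by (rule F.D.trivial_hdim_left[OF T Fo[OF j]])
        then have "FArr F (prj j) \<cdot>\<^bsub>C''\<^esub> v = ZeroArr C'' T (FObj F (Ss ! j))"
          by (rule zero_if_hdim[OF F.D.comp_hom[OF v P[OF j]]])
        moreover have "FArr F (prj j \<cdot>\<^bsub>C\<^esub> e) \<cdot>\<^bsub>C''\<^esub> v = ZeroArr C'' T (FObj F (Ss ! j))"
          using pe[OF j] False F.g_zero[OF X b(2)[OF j]] F.D.comp_zero_left[OF v Fo[OF j]] by simp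
        ultimately show ?thesis using c by simp
      qed
    qed
    then show "U \<cdot>\<^bsub>C''\<^esub> R \<cdot>\<^bsub>C''\<^esub> v = v" using F.D.comp_assoc[OF v R U] UR by simp
  qed
  ultimately have "largest_trivial_subobject C'' U (FObj F X)"
    unfolding largest_trivial_subobject_def F.D.in_Hom(2,3)[OF U]
    using F.D.split_mono[OF U R RU] by blast
  then show "\<exists>X\<^sub>0\<in>Obj C. \<exists>u\<in>Hom C X\<^sub>0 X. mono_arr C u \<and>
      largest_trivial_subobject C'' (FArr F u) (FObj F X)"
    using X0 u mono unfolding U_def by blast
qed

end

theorem exact_iff: "exact_sequence C' C C'' i F \<longleftrightarrow> FPdim_cat K C = FPdim_cat K C' * FPdim_cat K C''"
proof
  assume "exact_sequence C' C C'' i F"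
  then show "FPdim_cat K C = FPdim_cat K C' * FPdim_cat K C''"
    using exact_imp_no_unit FPdim_equality_iff by blast
next
  assume "FPdim_cat K C = FPdim_cat K C' * FPdim_cat K C''"
  then have "\<forall>x\<in>simple_classes C - kernel_classes. F.mult F.D.unit_class x = 0"
    using FPdim_equality_iff by blast
  then show "exact_sequence C' C C'' i F"
    unfolding exact_sequence_def
    using dominant full I.faithful no_unit_imp_normal no_unit_imp_essential_image by blast
qed

theorem FPdim_formula:
  assumes eq: "FPdim_cat K C = FPdim_cat K C' * FPdim_cat K C''" and Y: "simple_object C'' Y"
  shows "FPdim K C'' Y = 1 / FPdim_cat K C' *
    (\<Sum>x\<in>simple_classes C. real (simple_multiplicity K C'' Y (FObj F (rep_obj x))) * FPdim K C (rep_obj x))"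
proof -
  define y where "y = iso_class C'' Y"
  have y: "y \<in> simple_classes C''" unfolding y_def by (rule F.D.iso_class_simple[OF Y])
  have iso: "isomorphic C'' (rep_obj y) Y" unfolding y_def by (rule F.D.rep_iso_class[OF Y])
  have "(\<Sum>x\<in>simple_classes C. real (simple_multiplicity K C'' Y (FObj F (rep_obj x))) * FPdim K C (rep_obj x))
      = (\<Sum>x\<in>simple_classes C. real (F.mult y x) * FPdim K C (rep_obj x))"
    by (intro sum.cong refl) (simp add: F.mult_def F.D.hdim_isomorphic_left[OF iso] F.map_obj I.D.rep_simple)
  also have "\<dots> = FPdim_cat K C / FPdim_cat K C'' * FPdim K C'' (rep_obj y)"
    by (rule F.FPdim_regular[OF dominant y])
  also have "FPdim_cat K C / FPdim_cat K C'' = FPdim_cat K C'" using eq FPdim_cat_pos(2) by simp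
  also have "FPdim K C'' (rep_obj y) = FPdim K C'' Y"
    by (rule F.D.FPdim_isomorphic[OF F.D.rep_simple(1)[OF y] iso])
  finally show ?thesis using FPdim_cat_pos(1) by simp
qed

end

theorem proposition3p10:
  fixes K :: "'k ring"
    and C' :: "('o1, 'm1, 'k) moncat"
    and C :: "('o2, 'm2, 'k) moncat"
    and C'' :: "('o3, 'm3, 'k) moncat"
    and i :: "('o1, 'm1, 'o2, 'm2) monfun"
    and F :: "('o2, 'm2, 'o3, 'm3) monfun"
  assumes "fusion_category K C'"
    and "fusion_category K C"
    and "fusion_category K C''"
    and "tensor_functor K C' C i"
    and "tensor_functor K C C'' F"
    and "dominant_functor C C'' F"
    and "full_functor C' C i"
    and "FObj i ` Obj C' \<subseteq> Ker_functor C C'' F"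
  shows "FPdim_cat K C \<ge> FPdim_cat K C' * FPdim_cat K C'' \<and>
    (exact_sequence C' C C'' i F \<longleftrightarrow> FPdim_cat K C = FPdim_cat K C' * FPdim_cat K C'') \<and>
    (exact_sequence C' C C'' i F \<longrightarrow>
      (\<forall>Y. simple_object C'' Y \<longrightarrow>
        FPdim K C'' Y = 1 / FPdim_cat K C' *
          (\<Sum>X \<in> simple_classes C. real (simple_multiplicity K C'' Y (FObj F (rep_obj X))) * FPdim K C (rep_obj X))))"
proof -
  interpret S: fusion_sequence K C' C C'' i F
    using assms by (intro fusion_sequence.intro fusion_functor.intro fusion_sequence_axioms.intro)
  show ?thesis using S.FPdim_inequality S.exact_iff S.FPdim_formula by blast
qed

end
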